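(* Let $\Gamma$ be a connected finite acyclic quiver with vertex set $V$ and set of faces $F$. Then: (a) $\dim\mathfrak{D}_V=|V|-1$; (b) $\dim\mathfrak{D}_F=|F|-1$; (c) $\mathfrak{D}_V$ and $\mathfrak{D}_F$ are linearly disjoint subspaces of $\mathfrak{D}_E$, that is, $\mathfrak{D}_V\cap\mathfrak{D}_F=0$.
   Context: $\mathbf{k}$ is a field. A quiver $\Gamma=(V,E,t,h)$ consists of a set $V$ of vertices, a set $E$ of arrows and maps $t,h:E\to V$ (tail and head). It is finite if $V$ and $E$ are finite, acyclic if it has no oriented cycles, and connected if its underlying graph is connected. The path algebra $\mathbf{k}\Gamma$ has as $\mathbf{k}$-basis the paths of $\Gamma$ (vertices being the paths of length $0$), with product of $p,q$ the concatenation $pq$ if $h(p)=t(q)$ and $0$ otherwise. A derivation of $\mathbf{k}\Gamma$ is a $\mathbf{k}$-linear map $D:\mathbf{k}\Gamma\to\mathbf{k}\Gamma$ with $D(xy)=D(x)y+xD(y)$ for all $x,y$. Quivers come with a fixed embedding of the underlying graph into a closed connected oriented surface $S$ of genus $g$, with $g$ smallest possible ($\Gamma$ is then called a quiver of genus $g$). The set $F$ of faces is the set of connected components of $S\setminus\Gamma$. For $f\in F$, its boundary $\mathfrak{c}=\mathfrak{c}_f$, consisting of arrows not necessarily all in one direction, is called a primitive cycle. The face derivation $D_{\mathfrak{c}}$ is the derivation of $\mathbf{k}\Gamma$ with $D_{\mathfrak{c}}(v)=0$ for $v\in V$ and, for $p\in E$, $D_{\mathfrak{c}}(p)=p$ if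 $p$ is clockwise on $\mathfrak{c}$, $D_{\mathfrak{c}}(p)=-p$ if $p$ is counterclockwise on $\mathfrak{c}$, and $D_{\mathfrak{c}}(p)=0$ if $p$ is not on $\mathfrak{c}$; clockwise is as viewed from inside the face $f$ (i.e. $f$ lies on the right of $p$). If both sides of $p$ lie in $f$, then $p$ occurs once in each direction, the contributions cancel, and $D_{\mathfrak{c}}(p)=0$. For $v\in V$, $D_v$ is the inner derivation $D_v(b)=vb-bv$. For $p\in E$, $D_{p,p}$ is the derivation with $D_{p,p}(v)=0$ for $v\in V$, $D_{p,p}(p)=p$, and $D_{p,p}(q)=0$ for $q\in E$, $q\neq p$. $\mathfrak{D}_V$, $\mathfrak{D}_E$, $\mathfrak{D}_F$ are the $\mathbf{k}$-linear spans of $\{D_v\mid v\in V\}$, $\{D_{p,p}\mid p\in E\}$, $\{D_{\mathfrak{c}_f}\mid f\in F\}$ respectively; $\mathfrak{D}_V$ and $\mathfrak{D}_F$ are contained in $\mathfrak{D}_E$.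
   Formalization: Part (c), the equality 𝔇_V ∩ 𝔇_F = 0, is proved only for k of characteristic 0; over each field of positive characteristic it fails for some quiver (e.g. the acyclic triangle in characteristic 3, two parallel arrows in characteristic 2). *)

theory Defs
  imports
    "HOL-Complex_Analysis.Complex_Analysis"
    "HOL-Homology.Homology"
    "HOL-Library.Poly_Mapping"
    "HOL-Library.Function_Algebras"
    "Graph_Theory.Digraph_Component"
begin

text \<open>
  A quiver is a \<open>wf_digraph\<close> of the Graph Theory entry (\<open>verts\<close>, \<open>arcs\<close>, \<open>tail\<close>, \<open>head\<close>);
  parallel arrows and loops are allowed there.
\<close>

section \<open>The path algebra\<close>

text \<open>
  A path is a pair of its initial vertex and its list of arrows, so that \<open>(v, [])\<close> is the path of
  length 0 at \<open>v\<close>.  Elements of the path algebra are the finitely supported functions on such pairs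
  whose support consists of paths of the quiver.
\<close>

type_synonym ('v, 'e) qpath = "'v \<times> 'e list"
type_synonym ('v, 'e, 'k) pa_elem = "('v, 'e) qpath \<Rightarrow>\<^sub>0 'k"
type_synonym ('v, 'e, 'k) pa_map = "('v, 'e, 'k) pa_elem \<Rightarrow> ('v, 'e, 'k) pa_elem"

definition acyclic_quiver :: "('v, 'e) pre_digraph \<Rightarrow> bool" where
  "acyclic_quiver G \<longleftrightarrow> (\<nexists>p. pre_digraph.cycle G p)"

definition qpaths :: "('v, 'e) pre_digraph \<Rightarrow> ('v, 'e) qpath set" where
  "qpaths G = {(u, p). \<exists>v. pre_digraph.awalk G u p v}"

definition path_algebra :: "('v, 'e) pre_digraph \<Rightarrow> ('v, 'e, 'k::field) pa_elem set" where
  "path_algebra G = {x. Poly_Mapping.keys x \<subseteq> qpaths G}"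

definition pa_scale :: "'k::field \<Rightarrow> ('v, 'e, 'k) pa_elem \<Rightarrow> ('v, 'e, 'k) pa_elem" where
  "pa_scale c x = Poly_Mapping.map ((*) c) x"

definition composable :: "('v, 'e) pre_digraph \<Rightarrow> ('v, 'e) qpath \<Rightarrow> ('v, 'e) qpath \<Rightarrow> bool" where
  "composable G p q \<longleftrightarrow> pre_digraph.awlast G (fst p) (snd p) = fst q"

definition pa_mult ::
  "('v, 'e) pre_digraph \<Rightarrow> ('v, 'e, 'k::field) pa_elem \<Rightarrow> ('v, 'e, 'k) pa_elem \<Rightarrow> ('v, 'e, 'k) pa_elem"
where
  "pa_mult G x y =
     (\<Sum>p\<in>Poly_Mapping.keys x. \<Sum>q\<in>Poly_Mapping.keys y.
        if composable G p q
        then Poly_Mapping.single (fst p, snd p @ snd q) (Poly_Mapping.lookup x p * Poly_Mapping.lookup y q)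
        else 0)"

definition pa_vertex :: "'v \<Rightarrow> ('v, 'e, 'k::field) pa_elem" where
  "pa_vertex v = Poly_Mapping.single (v, []) 1"

definition pa_arrow :: "('v, 'e) pre_digraph \<Rightarrow> 'e \<Rightarrow> ('v, 'e, 'k::field) pa_elem" where
  "pa_arrow G p = Poly_Mapping.single (tail G p, [p]) 1"


section \<open>Derivations\<close>

text \<open>
  The path algebra is a subset of a type; the last clause fixes the (irrelevant) values outside it,
  so that a map on the path algebra has exactly one representative and the pointwise vector space
  operations on \<open>pa_map\<close> are those of the space of derivations.
\<close>

definition pa_derivation :: "('v, 'e) pre_digraph \<Rightarrow> ('v, 'e, 'k::field) pa_map \<Rightarrow> bool" where
  "pa_derivation G D \<longleftrightarrow>
     (\<forall>x\<in>path_algebra G. D x \<in> path_algebra G) \<and>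
     (\<forall>x\<in>path_algebra G. \<forall>y\<in>path_algebra G. D (x + y) = D x + D y) \<and>
     (\<forall>c. \<forall>x\<in>path_algebra G. D (pa_scale c x) = pa_scale c (D x)) \<and>
     (\<forall>x\<in>path_algebra G. \<forall>y\<in>path_algebra G.
        D (pa_mult G x y) = pa_mult G (D x) y + pa_mult G x (D y)) \<and>
     (\<forall>x. x \<notin> path_algebra G \<longrightarrow> D x = 0)"

definition map_scale :: "'k::field \<Rightarrow> ('v, 'e, 'k) pa_map \<Rightarrow> ('v, 'e, 'k) pa_map" where
  "map_scale c D = (\<lambda>x. pa_scale c (D x))"

definition map_span :: "('v, 'e, 'k::field) pa_map set \<Rightarrow> ('v, 'e, 'k) pa_map set" where
  "map_span B = module.span map_scale B"

definition map_dim :: "('v, 'e, 'k::field) pa_map set \<Rightarrow> nat" where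
  "map_dim W = vector_space.dim map_scale W"

text \<open>
  The derivation that annihilates the vertices and multiplies each arrow \<open>p\<close> by the scalar \<open>w p\<close>;
  see \<open>ex1_weight_derivation\<close> below.
\<close>

definition weight_derivation ::
  "('v, 'e) pre_digraph \<Rightarrow> ('e \<Rightarrow> 'k) \<Rightarrow> ('v, 'e, 'k::field) pa_map"
where
  "weight_derivation G w =
     (THE D. pa_derivation G D \<and>
        (\<forall>v\<in>verts G. D (pa_vertex v) = 0) \<and>
        (\<forall>p\<in>arcs G. D (pa_arrow G p) = pa_scale (w p) (pa_arrow G p)))"

definition vertex_derivation ::
  "('v, 'e) pre_digraph \<Rightarrow> 'v \<Rightarrow> ('v, 'e, 'k::field) pa_map"
where
  "vertex_derivation G v =
     (\<lambda>b. if b \<in> path_algebra G then pa_mult G (pa_vertex v) b - pa_mult G b (pa_vertex v) else 0)"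

definition arrow_derivation ::
  "('v, 'e) pre_digraph \<Rightarrow> 'e \<Rightarrow> ('v, 'e, 'k::field) pa_map"
where
  "arrow_derivation G p = weight_derivation G (\<lambda>q. if q = p then 1 else 0)"

definition vertex_derivations :: "('v, 'e) pre_digraph \<Rightarrow> ('v, 'e, 'k::field) pa_map set" where
  "vertex_derivations G = map_span (vertex_derivation G ` verts G)"

definition arrow_derivations :: "('v, 'e) pre_digraph \<Rightarrow> ('v, 'e, 'k::field) pa_map set" where
  "arrow_derivations G = map_span (arrow_derivation G ` arcs G)"


section \<open>Closed connected oriented surfaces\<close>

text \<open>
  A chart is given by its domain and its coordinate map into the plane.  A local homeomorphism of
  the plane preserves orientation if the images of small counterclockwise circles wind once
  counterclockwise around the image of the centre.
\<close>

type_synonym 's chart = "'s set \<times> ('s \<Rightarrow> complex)"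

definition chart_on :: "'s topology \<Rightarrow> 's chart \<Rightarrow> bool" where
  "chart_on S c \<longleftrightarrow>
     (case c of (U, \<phi>) \<Rightarrow>
        openin S U \<and> open (\<phi> ` U) \<and>
        homeomorphic_map (subtopology S U) (top_of_set (\<phi> ` U)) \<phi>)"

definition orientation_preserving_on :: "(complex \<Rightarrow> complex) \<Rightarrow> complex set \<Rightarrow> bool" where
  "orientation_preserving_on h W \<longleftrightarrow>
     (\<forall>z r. 0 < r \<longrightarrow> cball z r \<subseteq> W \<longrightarrow> winding_number (h \<circ> circlepath z r) (h z) = 1)"

definition charts_compatible :: "'s chart \<Rightarrow> 's chart \<Rightarrow> bool" where
  "charts_compatible c d \<longleftrightarrow>
     (case c of (U, \<phi>) \<Rightarrow> case d of (W, \<psi>) \<Rightarrow>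
        orientation_preserving_on (\<psi> \<circ> inv_into U \<phi>) (\<phi> ` (U \<inter> W)))"

text \<open>
  An orientation is a maximal atlas with orientation preserving transition maps.
\<close>

definition orientation_of :: "'s topology \<Rightarrow> 's chart set \<Rightarrow> bool" where
  "orientation_of S A \<longleftrightarrow>
     (\<forall>c\<in>A. chart_on S c) \<and> (\<Union>c\<in>A. fst c) = topspace S \<and>
     (\<forall>c\<in>A. \<forall>d\<in>A. charts_compatible c d) \<and>
     (\<forall>c. chart_on S c \<and> (\<forall>d\<in>A. charts_compatible c d \<and> charts_compatible d c) \<longrightarrow> c \<in> A)"

definition closed_oriented_surface :: "'s topology \<Rightarrow> 's chart set \<Rightarrow> bool" where
  "closed_oriented_surface S A \<longleftrightarrow>
     topspace S \<noteq> {} \<and> connected_space S \<and> compact_space S \<and> Hausdorff_space S \<and>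
     orientation_of S A"

definition has_genus :: "'s topology \<Rightarrow> nat \<Rightarrow> bool" where
  "has_genus S g \<longleftrightarrow> homology_group 1 S \<cong> free_Abelian_group {..<2 * g}"


section \<open>Embedded quivers and their faces\<close>

definition embedded_graph ::
  "('v, 'e) pre_digraph \<Rightarrow> ('v \<Rightarrow> 's) \<Rightarrow> ('e \<Rightarrow> real \<Rightarrow> 's) \<Rightarrow> 's set"
where
  "embedded_graph G pos crv = pos ` verts G \<union> (\<Union>p\<in>arcs G. crv p ` {0..1})"

text \<open>
  An oriented chart onto the unit disc, centred at the point \<open>crv p t\<close> of the arrow \<open>p\<close>, in which the
  graph is the real axis and \<open>p\<close> runs in the positive direction.  As the chart is oriented, the
  lower half disc lies to the right of \<open>p\<close> and the upper half disc to its left.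
\<close>

definition arrow_chart ::
  "'s chart set \<Rightarrow> ('v, 'e) pre_digraph \<Rightarrow> ('v \<Rightarrow> 's) \<Rightarrow> ('e \<Rightarrow> real \<Rightarrow> 's) \<Rightarrow>
   'e \<Rightarrow> real \<Rightarrow> 's set \<Rightarrow> ('s \<Rightarrow> complex) \<Rightarrow> bool"
where
  "arrow_chart A G pos crv p t U \<phi> \<longleftrightarrow>
     (U, \<phi>) \<in> A \<and> \<phi> ` U = ball 0 1 \<and> crv p t \<in> U \<and> \<phi> (crv p t) = 0 \<and>
     \<phi> ` (U \<inter> embedded_graph G pos crv) = {z \<in> ball 0 1. Im z = 0} \<and>
     (\<forall>\<^sub>F s in at_right t. 0 < Re (\<phi> (crv p s)))"

text \<open>
  An oriented chart onto the unit disc, centred at the vertex \<open>v\<close>, in which the graph is a finite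
  union of radii.
\<close>

definition vertex_chart ::
  "'s chart set \<Rightarrow> ('v, 'e) pre_digraph \<Rightarrow> ('v \<Rightarrow> 's) \<Rightarrow> ('e \<Rightarrow> real \<Rightarrow> 's) \<Rightarrow>
   'v \<Rightarrow> 's set \<Rightarrow> ('s \<Rightarrow> complex) \<Rightarrow> bool"
where
  "vertex_chart A G pos crv v U \<phi> \<longleftrightarrow>
     (U, \<phi>) \<in> A \<and> \<phi> ` U = ball 0 1 \<and> pos v \<in> U \<and> \<phi> (pos v) = 0 \<and>
     (\<exists>R. finite R \<and> R \<subseteq> sphere 0 1 \<and>
        \<phi> ` (U \<inter> embedded_graph G pos crv) =
          {0} \<union> {of_real r * d | r d. 0 < r \<and> r < 1 \<and> d \<in> R})"

text \<open>
  Embeddings of the underlying graph.  The last two conditions say that the embedding is locally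
  flat.  They exclude nothing (by the Schoenflies theorem every embedding of a finite graph in a
  surface satisfies them), and they are what gives each arrow a right and a left side.
\<close>

definition quiver_embedding ::
  "('v, 'e) pre_digraph \<Rightarrow> 's topology \<Rightarrow> 's chart set \<Rightarrow> ('v \<Rightarrow> 's) \<Rightarrow> ('e \<Rightarrow> real \<Rightarrow> 's) \<Rightarrow> bool"
where
  "quiver_embedding G S A pos crv \<longleftrightarrow>
     pos ` verts G \<subseteq> topspace S \<and> inj_on pos (verts G) \<and>
     (\<forall>p\<in>arcs G. pathin S (crv p) \<and> crv p 0 = pos (tail G p) \<and> crv p 1 = pos (head G p) \<and>
        inj_on (crv p) {0<..<1} \<and> crv p ` {0<..<1} \<inter> pos ` verts G = {}) \<and>
     (\<forall>p\<in>arcs G. \<forall>q\<in>arcs G. p \<noteq> q \<longrightarrow> crv p ` {0<..<1} \<inter> crv q ` {0<..<1} = {}) \<and>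
     (\<forall>p\<in>arcs G. \<forall>t\<in>{0<..<1}. \<exists>U \<phi>. arrow_chart A G pos crv p t U \<phi>) \<and>
     (\<forall>v\<in>verts G. \<exists>U \<phi>. vertex_chart A G pos crv v U \<phi>)"

text \<open>
  The competing surfaces in the minimality condition live on the same type \<open>'s\<close>.  This is no
  restriction: \<open>'s\<close> contains the points of one surface, hence has at least continuum many elements,
  and a closed surface has continuum many points, so every one has a homeomorphic copy on \<open>'s\<close>.
\<close>

definition minimal_genus_embedding ::
  "('v, 'e) pre_digraph \<Rightarrow> nat \<Rightarrow> 's topology \<Rightarrow> 's chart set \<Rightarrow> ('v \<Rightarrow> 's) \<Rightarrow>
   ('e \<Rightarrow> real \<Rightarrow> 's) \<Rightarrow> bool"
where
  "minimal_genus_embedding G g S A pos crv \<longleftrightarrow>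
     closed_oriented_surface S A \<and> has_genus S g \<and> quiver_embedding G S A pos crv \<and>
     (\<forall>(S' :: 's topology) A' pos' crv' g'.
        closed_oriented_surface S' A' \<and> has_genus S' g' \<and> quiver_embedding G S' A' pos' crv'
        \<longrightarrow> g \<le> g')"

definition faces ::
  "('v, 'e) pre_digraph \<Rightarrow> 's topology \<Rightarrow> ('v \<Rightarrow> 's) \<Rightarrow> ('e \<Rightarrow> real \<Rightarrow> 's) \<Rightarrow> 's set set"
where
  "faces G S pos crv =
     connected_components_of (subtopology S (topspace S - embedded_graph G pos crv))"

definition on_right ::
  "'s chart set \<Rightarrow> ('v, 'e) pre_digraph \<Rightarrow> ('v \<Rightarrow> 's) \<Rightarrow> ('e \<Rightarrow> real \<Rightarrow> 's) \<Rightarrow> 's set \<Rightarrow> 'e \<Rightarrow> bool"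
where
  "on_right A G pos crv f p \<longleftrightarrow>
     (\<exists>t\<in>{0<..<1}. \<exists>U \<phi>. arrow_chart A G pos crv p t U \<phi> \<and> {x \<in> U. Im (\<phi> x) < 0} \<subseteq> f)"

definition on_left ::
  "'s chart set \<Rightarrow> ('v, 'e) pre_digraph \<Rightarrow> ('v \<Rightarrow> 's) \<Rightarrow> ('e \<Rightarrow> real \<Rightarrow> 's) \<Rightarrow> 's set \<Rightarrow> 'e \<Rightarrow> bool"
where
  "on_left A G pos crv f p \<longleftrightarrow>
     (\<exists>t\<in>{0<..<1}. \<exists>U \<phi>. arrow_chart A G pos crv p t U \<phi> \<and> {x \<in> U. Im (\<phi> x) > 0} \<subseteq> f)"

text \<open>
  An arrow is clockwise on the boundary of \<open>f\<close> if \<open>f\<close> lies on its right, counterclockwise if \<open>f\<close> lies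
  on its left; if both hold, the two contributions cancel.
\<close>

definition face_derivation ::
  "'s chart set \<Rightarrow> ('v, 'e) pre_digraph \<Rightarrow> ('v \<Rightarrow> 's) \<Rightarrow> ('e \<Rightarrow> real \<Rightarrow> 's) \<Rightarrow> 's set \<Rightarrow>
   ('v, 'e, 'k::field) pa_map"
where
  "face_derivation A G pos crv f =
     weight_derivation G
       (\<lambda>p. (if on_right A G pos crv f p then 1 else 0) - (if on_left A G pos crv f p then 1 else 0))"

definition face_derivations ::
  "('v, 'e) pre_digraph \<Rightarrow> 's topology \<Rightarrow> 's chart set \<Rightarrow> ('v \<Rightarrow> 's) \<Rightarrow> ('e \<Rightarrow> real \<Rightarrow> 's) \<Rightarrow>
   ('v, 'e, 'k::field) pa_map set"
where
  "face_derivations G S A pos crv = map_span (face_derivation A G pos crv ` faces G S pos crv)"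


section \<open>Well-definedness\<close>

lemma lookup_pa_scale [simp]:
  "Poly_Mapping.lookup (pa_scale c x) p = c * Poly_Mapping.lookup x p"
  unfolding pa_scale_def by (simp add: Poly_Mapping.map.rep_eq when_def)

lemma vector_space_map_scale:
  "vector_space (map_scale :: 'k::field \<Rightarrow> ('v, 'e, 'k) pa_map \<Rightarrow> _)"
  by unfold_locales
    (auto simp: map_scale_def fun_eq_iff poly_mapping_eq_iff lookup_add algebra_simps)

lemma keys_pa_scale: "Poly_Mapping.keys (pa_scale c x) \<subseteq> Poly_Mapping.keys x"
  by (auto simp: in_keys_iff)

lemma path_algebra_add:
  "x \<in> path_algebra G \<Longrightarrow> y \<in> path_algebra G \<Longrightarrow> x + y \<in> path_algebra G"
  using Poly_Mapping.keys_add[of x y] by (fastforce simp: path_algebra_def)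

lemma path_algebra_0: "0 \<in> path_algebra G"
  by (simp add: path_algebra_def)

lemma path_algebra_scale: "x \<in> path_algebra G \<Longrightarrow> pa_scale c x \<in> path_algebra G"
  using keys_pa_scale by (fastforce simp: path_algebra_def)

lemma path_algebra_sum:
  "(\<And>i. i \<in> I \<Longrightarrow> f i \<in> path_algebra G) \<Longrightarrow> (\<Sum>i\<in>I. f i) \<in> path_algebra G"
  by (induction I rule: infinite_finite_induct) (auto intro: path_algebra_add path_algebra_0)

lemma path_algebra_single: "q \<in> qpaths G \<Longrightarrow> Poly_Mapping.single q c \<in> path_algebra G"
  by (auto simp: path_algebra_def split: if_splits)

lemma qpaths_append:
  assumes "wf_digraph G" "(u, p) \<in> qpaths G" "(v, q) \<in> qpaths G" "composable G (u, p) (v, q)"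
  shows "(u, p @ q) \<in> qpaths G"
proof -
  interpret wf_digraph G by fact
  from assms(2,3) obtain a b where ab: "awalk u p a" "awalk v q b" by (auto simp: qpaths_def)
  moreover have "a = v" using ab(1) assms(4) by (auto simp: composable_def)
  ultimately show ?thesis by (auto simp: qpaths_def)
qed

lemma path_algebra_mult:
  assumes "wf_digraph G" "x \<in> path_algebra G" "y \<in> path_algebra G"
  shows "pa_mult G x y \<in> path_algebra G"
  unfolding pa_mult_def
proof (intro path_algebra_sum)
  fix p q assume "p \<in> Poly_Mapping.keys x" "q \<in> Poly_Mapping.keys y"
  hence "p \<in> qpaths G" "q \<in> qpaths G" using assms by (auto simp: path_algebra_def)
  thus "(if composable G p q
        then Poly_Mapping.single (fst p, snd p @ snd q) (Poly_Mapping.lookup x p * Poly_Mapping.lookup y q)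
        else 0) \<in> path_algebra G"
    using qpaths_append[OF assms(1), of "fst p" "snd p" "fst q" "snd q"]
    by (auto intro: path_algebra_single path_algebra_0)
qed

lemma pa_mult_superset:
  assumes "finite P" "finite Q" "Poly_Mapping.keys x \<subseteq> P" "Poly_Mapping.keys y \<subseteq> Q"
  shows "pa_mult G x y =
     (\<Sum>p\<in>P. \<Sum>q\<in>Q.
        if composable G p q
        then Poly_Mapping.single (fst p, snd p @ snd q) (Poly_Mapping.lookup x p * Poly_Mapping.lookup y q)
        else 0)"
proof -
  have "pa_mult G x y =
     (\<Sum>p\<in>Poly_Mapping.keys x. \<Sum>q\<in>Q.
        if composable G p q
        then Poly_Mapping.single (fst p, snd p @ snd q) (Poly_Mapping.lookup x p * Poly_Mapping.lookup y q)
        else 0)"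
    unfolding pa_mult_def using assms
    by (intro sum.cong refl sum.mono_neutral_left) (auto simp: in_keys_iff)
  also have "\<dots> = (\<Sum>p\<in>P. \<Sum>q\<in>Q.
        if composable G p q
        then Poly_Mapping.single (fst p, snd p @ snd q) (Poly_Mapping.lookup x p * Poly_Mapping.lookup y q)
        else 0)"
    using assms by (intro sum.mono_neutral_left) (auto simp: in_keys_iff intro!: sum.neutral)
  finally show ?thesis .
qed

lemma poly_mapping_sum_singles:
  "x = (\<Sum>p\<in>Poly_Mapping.keys x. pa_scale (Poly_Mapping.lookup x p) (Poly_Mapping.single p 1))"
proof (rule poly_mapping_eqI)
  fix k
  show "Poly_Mapping.lookup x k = Poly_Mapping.lookup
     (\<Sum>p\<in>Poly_Mapping.keys x. pa_scale (Poly_Mapping.lookup x p) (Poly_Mapping.single p 1)) k"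
    by (cases "k \<in> Poly_Mapping.keys x")
       (auto simp: lookup_sum lookup_single when_def in_keys_iff if_distrib[of "(*) _"] sum.delta cong: if_cong)
qed

lemma ex1_weight_derivation:
  fixes G :: "('v, 'e) pre_digraph" and w :: "'e \<Rightarrow> 'k::field"
  assumes "wf_digraph G"
  shows "\<exists>!D. pa_derivation G D \<and>
        (\<forall>v\<in>verts G. D (pa_vertex v) = 0) \<and>
        (\<forall>p\<in>arcs G. D (pa_arrow G p) = pa_scale (w p) (pa_arrow G p))"
proof -
  interpret wf_digraph G by fact
  define wt :: "('v, 'e) qpath \<Rightarrow> 'k" where "wt = (\<lambda>p. sum_list (map w (snd p)))"
  define M :: "('v, 'e, 'k) pa_map" where "M = Poly_Mapping.mapp (\<lambda>p c. wt p * c)"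
  have lookup_M: "Poly_Mapping.lookup (M x) p = wt p * Poly_Mapping.lookup x p" for x p
    by (auto simp: M_def mapp.rep_eq in_keys_iff)
  have keys_M: "Poly_Mapping.keys (M x) \<subseteq> Poly_Mapping.keys x" for x
    by (auto simp: in_keys_iff lookup_M)
  have M_add: "M (x + y) = M x + M y" for x y
    by (rule poly_mapping_eqI) (simp add: lookup_M lookup_add algebra_simps)
  have M_0: "M 0 = 0" by (rule poly_mapping_eqI) (simp add: lookup_M)
  have M_sum: "M (\<Sum>i\<in>I. f i) = (\<Sum>i\<in>I. M (f i))" for f :: "'z \<Rightarrow> _" and I
    by (induction I rule: infinite_finite_induct) (auto simp: M_add M_0)
  have M_single: "M (Poly_Mapping.single p c) = Poly_Mapping.single p (wt p * c)" for p c
    by (rule poly_mapping_eqI) (auto simp: lookup_M lookup_single when_def)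
  have M_mult: "M (pa_mult G x y) = pa_mult G (M x) y + pa_mult G x (M y)" for x y
  proof -
    have *: "wt (fst p, snd p @ snd q) = wt p + wt q" for p q :: "('v, 'e) qpath"
      by (simp add: wt_def)
    have "pa_mult G (M x) y + pa_mult G x (M y) =
      (\<Sum>p\<in>Poly_Mapping.keys x. \<Sum>q\<in>Poly_Mapping.keys y.
        (if composable G p q
        then Poly_Mapping.single (fst p, snd p @ snd q) (Poly_Mapping.lookup (M x) p * Poly_Mapping.lookup y q)
        else 0) +
        (if composable G p q
        then Poly_Mapping.single (fst p, snd p @ snd q) (Poly_Mapping.lookup x p * Poly_Mapping.lookup (M y) q)
        else 0))"
      by (simp add: pa_mult_superset[of "Poly_Mapping.keys x" "Poly_Mapping.keys y"] keys_M sum.distrib)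
    also have "\<dots> = M (pa_mult G x y)"
      unfolding pa_mult_def M_sum
      by (intro sum.cong refl)
        (auto simp: M_single M_0 * lookup_M single_add[symmetric] algebra_simps)
    finally show ?thesis by simp
  qed
  define D where "D = (\<lambda>x. if x \<in> path_algebra G then M x else 0)"
  have vert: "pa_vertex v \<in> path_algebra G" if "v \<in> verts G" for v
    using that unfolding pa_vertex_def
    by (intro path_algebra_single) (auto simp: qpaths_def awalk_def intro!: exI[of _ v])
  have arr: "pa_arrow G p \<in> path_algebra G" if "p \<in> arcs G" for p
    using that unfolding pa_arrow_def
    by (intro path_algebra_single) (auto simp: qpaths_def awalk_def)
  have "M x \<in> path_algebra G" if "x \<in> path_algebra G" for x
    using that keys_M[of x] by (auto simp: path_algebra_def)
  moreover have "M (pa_scale c x) = pa_scale c (M x)" for c x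
    by (rule poly_mapping_eqI) (simp add: lookup_M)
  ultimately have "pa_derivation G D"
    unfolding pa_derivation_def D_def
    by (auto simp: M_add M_mult path_algebra_add path_algebra_scale path_algebra_mult[OF assms])
  moreover have "\<forall>v\<in>verts G. D (pa_vertex v) = 0"
    using vert by (auto simp: D_def pa_vertex_def M_single wt_def)
  moreover have "\<forall>p\<in>arcs G. D (pa_arrow G p) = pa_scale (w p) (pa_arrow G p)"
    using arr by (auto simp: D_def pa_arrow_def M_single wt_def poly_mapping_eq_iff fun_eq_iff lookup_single when_def)
  moreover have "D1 = D2"
    if 1: "pa_derivation G D1" "\<forall>v\<in>verts G. D1 (pa_vertex v) = 0"
       "\<forall>p\<in>arcs G. D1 (pa_arrow G p) = pa_scale (w p) (pa_arrow G p)"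
    and 2: "pa_derivation G D2" "\<forall>v\<in>verts G. D2 (pa_vertex v) = 0"
       "\<forall>p\<in>arcs G. D2 (pa_arrow G p) = pa_scale (w p) (pa_arrow G p)"
     for D1 D2 :: "('v, 'e, 'k) pa_map"
  proof
    fix x
    have path: "D1 (Poly_Mapping.single (u, p) 1) = D2 (Poly_Mapping.single (u, p) 1)"
      if "awalk u p v" for u p v
      using that
    proof (induction p arbitrary: u)
      case Nil
      hence "u \<in> verts G" by (auto simp: awalk_def)
      thus ?case using 1(2) 2(2) by (simp add: pa_vertex_def)
    next
      case (Cons e p)
      hence e: "e \<in> arcs G" "u = tail G e" and p: "awalk (head G e) p v"
        by (auto simp: awalk_Cons_iff)
      have s: "Poly_Mapping.single (u, e # p) (1::'k)
          = pa_mult G (pa_arrow G e) (Poly_Mapping.single (head G e, p) 1)"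
        using e by (simp add: pa_mult_def pa_arrow_def composable_def)
      let ?y = "Poly_Mapping.single (head G e, p) (1::'k)"
      have y: "?y \<in> path_algebra G"
        using p by (intro path_algebra_single) (auto simp: qpaths_def)
      have leibniz: "D' (pa_mult G (pa_arrow G e) ?y)
          = pa_mult G (D' (pa_arrow G e)) ?y + pa_mult G (pa_arrow G e) (D' ?y)"
        if "pa_derivation G D'" for D' :: "('v, 'e, 'k) pa_map"
        using that arr[OF e(1)] y unfolding pa_derivation_def by blast
      show ?case
        unfolding s leibniz[OF 1(1)] leibniz[OF 2(1)] using 1(3) 2(3) e Cons.IH[OF p] by simp
    qed
    show "D1 x = D2 x"
    proof (cases "x \<in> path_algebra G")
      case False
      thus ?thesis using 1 2 by (simp add: pa_derivation_def)
    next
      case True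
      have zero: "D' 0 = 0" if "pa_derivation G D'" for D' :: "('v, 'e, 'k) pa_map"
      proof -
        have "D' (0 + 0) = D' 0 + D' 0"
          using that path_algebra_0 unfolding pa_derivation_def by blast
        thus ?thesis by simp
      qed
      have sum: "D' (\<Sum>i\<in>I. f i) = (\<Sum>i\<in>I. D' (f i))"
        if "pa_derivation G D'" "\<And>i. i \<in> I \<Longrightarrow> f i \<in> path_algebra G"
        for D' :: "('v, 'e, 'k) pa_map" and f :: "('v, 'e) qpath \<Rightarrow> _" and I
        using that(2)
      proof (induction I rule: infinite_finite_induct)
        case (insert i I)
        hence "D' (f i + sum f I) = D' (f i) + D' (sum f I)"
          using that(1) path_algebra_sum[of I f G] unfolding pa_derivation_def by blast
        thus ?case using insert by simp
      qed (use zero[OF that(1)] in auto)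
      let ?s = "\<lambda>p. Poly_Mapping.single p 1 :: ('v, 'e, 'k) pa_elem"
      have s: "?s p \<in> path_algebra G" "D1 (?s p) = D2 (?s p)" if "p \<in> Poly_Mapping.keys x" for p
      proof -
        have p: "p \<in> qpaths G" using that True by (auto simp: path_algebra_def)
        thus "?s p \<in> path_algebra G" by (rule path_algebra_single)
        show "D1 (?s p) = D2 (?s p)" using p path by (cases p) (auto simp: qpaths_def)
      qed
      have ex: "D' x = (\<Sum>p\<in>Poly_Mapping.keys x. pa_scale (Poly_Mapping.lookup x p) (D' (?s p)))"
        if "pa_derivation G D'" for D' :: "('v, 'e, 'k) pa_map"
      proof -
        have "D' x = D' (\<Sum>p\<in>Poly_Mapping.keys x. pa_scale (Poly_Mapping.lookup x p) (?s p))"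
          using poly_mapping_sum_singles[of x] by simp
        also have "\<dots> = (\<Sum>p\<in>Poly_Mapping.keys x. D' (pa_scale (Poly_Mapping.lookup x p) (?s p)))"
          by (intro sum that path_algebra_scale s)
        also have "\<dots> = (\<Sum>p\<in>Poly_Mapping.keys x. pa_scale (Poly_Mapping.lookup x p) (D' (?s p)))"
          using that s unfolding pa_derivation_def by (intro sum.cong refl) blast
        finally show ?thesis .
      qed
      show ?thesis unfolding ex[OF 1(1)] ex[OF 2(1)] using s by (intro sum.cong) auto
    qed
  qed
  ultimately show ?thesis by (intro ex1I[of _ D]) blast+
qed

end

theory Submission
  imports Defs
begin

text \<open>
  All derivations in question multiply each arrow \<open>p\<close> by a weight \<open>w p\<close>, so everything is linear algebra
  in the space of weights.  \<open>D\<^sub>v\<close> has weight \<open>[tail p = v] - [head p = v]\<close>; a relation among the \<open>D\<^sub>v\<close> is a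
  function on vertices that is constant along arrows, hence constant.  The face derivation of \<open>f\<close> has
  weight \<open>[f right of p] - [f left of p]\<close>; a relation among these is a function on faces that does not
  jump across arrows, hence extends to a locally constant function on the connected surface.

  Going once around a vertex, the jumps of a function on faces across the arrows at that vertex add
  up to \<open>0\<close>.  Summation by parts turns this into \<open>\<Sum>\<^sub>p (X (tail p) - X (head p)) (C (right p) - C (left p)) = 0\<close>
  over every commutative ring.  Over \<open>\<rat>\<close> two orthogonal spaces intersect in \<open>0\<close>; a field of
  characteristic \<open>0\<close> is reduced to \<open>\<rat>\<close> by applying \<open>\<rat>\<close>-linear functionals.

  That an arrow has one right face and one left face is where the orientation enters: a transition
  map that swapped the sides of an arrow while preserving its direction would send a small circle to
  a loop of winding number \<open>-1\<close>.
\<close>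

text \<open>Otherwise \<open>connected\<close> would mean connectedness of digraphs.\<close>
hide_const (open) Digraph_Component.connected

text \<open>Characteristic 0 is essential for the trivial intersection. For the arrows a -> b, b ->
  c, a -> c, drawn as a triangle on the sphere, a face derivation has the weights 1, 1, -1 up to
  sign; in characteristic 3 these are differences of vertex values, because 1 + 1 = -1. In
  characteristic 0 orthogonality still does not suffice by itself, since over the complex numbers a
  nonzero vector can be orthogonal to itself. The rationals supply positivity, and additive
  functionals are enough to get there because all weights are differences.

  On the topological side two kinds of charts must be compared: arrow charts, which define the sides
  of an arrow, and vertex charts, in which the circling takes place and an arrow runs along a radius
  in an arbitrary direction. \<open>flat_chart\<close> and \<open>directed_chart\<close> cover both.
  The face on a given side has to be shown independent of the chart and of the point chosen on the
  arrow.\<close>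

section \<open>Derivations that scale paths\<close>

text \<open>\<open>weight_derivation\<close> is a definite description and
  \<open>vertex_derivation\<close> a difference of products. Both turn out to scale every path by a
  scalar, and this is the explicit form in which they are compared. The value 0 outside the path
  algebra matches the last clause of \<open>pa_derivation\<close>.\<close>

definition diagonal_map ::
  "('v, 'e) pre_digraph \<Rightarrow> (('v, 'e) qpath \<Rightarrow> 'k) \<Rightarrow> ('v, 'e, 'k::field) pa_map"
where
  "diagonal_map G \<omega> = (\<lambda>x. if x \<in> path_algebra G then Poly_Mapping.mapp (\<lambda>p c. \<omega> p * c) x else 0)"

lemma lookup_diagonal_map:
  "Poly_Mapping.lookup (diagonal_map G \<omega> x) p
     = (if x \<in> path_algebra G then \<omega> p * Poly_Mapping.lookup x p else 0)"
  by (auto simp: diagonal_map_def mapp.rep_eq in_keys_iff)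

lemma diagonal_map_eqI:
  assumes "\<And>p. p \<in> qpaths G \<Longrightarrow> \<omega> p = \<omega>' p"
  shows "diagonal_map G \<omega> = diagonal_map G \<omega>'"
proof
  fix x show "diagonal_map G \<omega> x = diagonal_map G \<omega>' x"
    by (rule poly_mapping_eqI)
       (use assms in \<open>force simp: lookup_diagonal_map path_algebra_def in_keys_iff\<close>)
qed

lemma diagonal_map_single:
  "p \<in> qpaths G \<Longrightarrow>
     diagonal_map G \<omega> (Poly_Mapping.single p c) = Poly_Mapping.single p (\<omega> p * c)"
  by (rule poly_mapping_eqI)
     (auto simp: lookup_diagonal_map path_algebra_single lookup_single when_def)

lemma sum_diagonal_map:
  "(\<Sum>i\<in>I. map_scale (c i) (diagonal_map G (\<omega> i))) = diagonal_map G (\<lambda>p. \<Sum>i\<in>I. c i * \<omega> i p)"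
proof
  fix x
  have "(\<Sum>i\<in>I. map_scale (c i) (diagonal_map G (\<omega> i))) x
      = (\<Sum>i\<in>I. map_scale (c i) (diagonal_map G (\<omega> i)) x)"
    by (induction I rule: infinite_finite_induct) auto
  also have "\<dots> = diagonal_map G (\<lambda>p. \<Sum>i\<in>I. c i * \<omega> i p) x"
    by (rule poly_mapping_eqI)
       (auto simp: map_scale_def lookup_sum lookup_diagonal_map sum_distrib_right mult.assoc)
  finally show "(\<Sum>i\<in>I. map_scale (c i) (diagonal_map G (\<omega> i))) x = \<dots>" .
qed

text \<open>On two composable paths both terms on the right are multiples of the concatenated path,
  so the Leibniz rule is the additivity of \<open>\<omega>\<close> under concatenation; bilinearity
  does the rest.\<close>

lemma diagonal_map_mult:
  assumes "wf_digraph G"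
    and \<omega>: "\<And>p q. p \<in> qpaths G \<Longrightarrow> q \<in> qpaths G \<Longrightarrow> composable G p q \<Longrightarrow>
          \<omega> (fst p, snd p @ snd q) = \<omega> p + \<omega> q"
    and x: "x \<in> path_algebra G" and y: "y \<in> path_algebra G"
  shows "diagonal_map G \<omega> (pa_mult G x y) =
     pa_mult G (diagonal_map G \<omega> x) y + pa_mult G x (diagonal_map G \<omega> y)"
proof -
  let ?M = "diagonal_map G \<omega>"
  have keys: "Poly_Mapping.keys (?M z) \<subseteq> Poly_Mapping.keys z" for z
    by (auto simp: in_keys_iff lookup_diagonal_map split: if_splits)
  have M_add: "?M (a + b) = ?M a + ?M b" if "a \<in> path_algebra G" "b \<in> path_algebra G" for a b
    by (rule poly_mapping_eqI)
       (simp add: that lookup_diagonal_map lookup_add path_algebra_add algebra_simps)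
  have M_0: "?M 0 = 0"
    by (rule poly_mapping_eqI) (simp add: lookup_diagonal_map)
  have M_sum: "?M (\<Sum>i\<in>I. f i) = (\<Sum>i\<in>I. ?M (f i))"
    if "\<And>i. i \<in> I \<Longrightarrow> f i \<in> path_algebra G" for f :: "('v, 'e) qpath \<Rightarrow> _" and I
    using that
    by (induction I rule: infinite_finite_induct) (auto simp: M_add M_0 path_algebra_sum)
  have kx: "p \<in> qpaths G" if "p \<in> Poly_Mapping.keys x" for p
    using x that by (auto simp: path_algebra_def)
  have ky: "q \<in> qpaths G" if "q \<in> Poly_Mapping.keys y" for q
    using y that by (auto simp: path_algebra_def)
  let ?t = "\<lambda>x y p q. if composable G p q
        then Poly_Mapping.single (fst p, snd p @ snd q) (Poly_Mapping.lookup x p * Poly_Mapping.lookup y q)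
        else 0"
  have cat: "(fst p, snd p @ snd q) \<in> qpaths G"
    if "p \<in> Poly_Mapping.keys x" "q \<in> Poly_Mapping.keys y" "composable G p q" for p q
    using qpaths_append[OF assms(1), of "fst p" "snd p" "fst q" "snd q"] that kx ky by auto
  have t: "?t x y p q \<in> path_algebra G"
    if "p \<in> Poly_Mapping.keys x" "q \<in> Poly_Mapping.keys y" for p q
    using cat[OF that] by (auto intro: path_algebra_single path_algebra_0)
  \<comment> \<open>A scalar 0 removes keys, so all products are expanded over the keys of the
    original \<open>x\<close> and \<open>y\<close>.\<close>
  have "pa_mult G (?M x) y + pa_mult G x (?M y) =
      (\<Sum>p\<in>Poly_Mapping.keys x. \<Sum>q\<in>Poly_Mapping.keys y. ?t (?M x) y p q + ?t x (?M y) p q)"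
    by (simp add: pa_mult_superset[of "Poly_Mapping.keys x" "Poly_Mapping.keys y"] keys sum.distrib)
  also have "\<dots> = (\<Sum>p\<in>Poly_Mapping.keys x. \<Sum>q\<in>Poly_Mapping.keys y. ?M (?t x y p q))"
    by (intro sum.cong refl)
       (auto simp: M_0 diagonal_map_single cat \<omega> kx ky lookup_diagonal_map x y single_add[symmetric]
          algebra_simps)
  also have "\<dots> = ?M (pa_mult G x y)"
    unfolding pa_mult_def by (simp add: M_sum t path_algebra_sum)
  finally show ?thesis by simp
qed

lemma pa_derivation_diagonal_map:
  assumes "wf_digraph G"
    and \<omega>: "\<And>p q. p \<in> qpaths G \<Longrightarrow> q \<in> qpaths G \<Longrightarrow> composable G p q \<Longrightarrow>
          \<omega> (fst p, snd p @ snd q) = \<omega> p + \<omega> q"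
  shows "pa_derivation G (diagonal_map G \<omega>)"
  unfolding pa_derivation_def
proof (intro conjI ballI allI impI)
  fix x :: "('a, 'b, 'c) pa_elem" assume x: "x \<in> path_algebra G"
  show "diagonal_map G \<omega> x \<in> path_algebra G"
    using x by (auto simp: path_algebra_def in_keys_iff lookup_diagonal_map split: if_splits)
  show "diagonal_map G \<omega> (pa_scale c x) = pa_scale c (diagonal_map G \<omega> x)" for c
    by (rule poly_mapping_eqI) (simp add: lookup_diagonal_map path_algebra_scale x)
  fix y :: "('a, 'b, 'c) pa_elem" assume y: "y \<in> path_algebra G"
  show "diagonal_map G \<omega> (x + y) = diagonal_map G \<omega> x + diagonal_map G \<omega> y"
    by (rule poly_mapping_eqI)
       (simp add: x y lookup_diagonal_map lookup_add path_algebra_add algebra_simps)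
qed (auto simp: diagonal_map_def diagonal_map_mult[OF assms, unfolded diagonal_map_def])

section \<open>Derivations given by weights on the arrows\<close>

definition path_weight :: "('e \<Rightarrow> 'k::field) \<Rightarrow> ('v, 'e) qpath \<Rightarrow> 'k" where
  "path_weight w p = sum_list (map w (snd p))"

lemma arrow_in_qpaths: "wf_digraph G \<Longrightarrow> p \<in> arcs G \<Longrightarrow> (tail G p, [p]) \<in> qpaths G"
  using wf_digraph.arc_implies_awalk by (fastforce simp: qpaths_def)

lemma vertex_in_qpaths: "wf_digraph G \<Longrightarrow> v \<in> verts G \<Longrightarrow> (v, []) \<in> qpaths G"
  by (auto simp: qpaths_def wf_digraph.awalk_Nil_iff)

lemma weight_derivation_eq_diagonal_map:
  assumes "wf_digraph G"
  shows "weight_derivation G w = diagonal_map G (path_weight w)"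
  unfolding weight_derivation_def
proof (rule the1_equality[OF ex1_weight_derivation[OF assms]], intro conjI ballI)
  show "pa_derivation G (diagonal_map G (path_weight w))"
    by (rule pa_derivation_diagonal_map[OF assms]) (simp add: path_weight_def)
  fix v assume "v \<in> verts G"
  thus "diagonal_map G (path_weight w) (pa_vertex v) = 0"
    by (simp add: pa_vertex_def diagonal_map_single vertex_in_qpaths[OF assms] path_weight_def)
next
  fix p assume "p \<in> arcs G"
  thus "diagonal_map G (path_weight w) (pa_arrow G p) = pa_scale (w p) (pa_arrow G p)"
    by (intro poly_mapping_eqI)
       (simp add: pa_arrow_def diagonal_map_single arrow_in_qpaths[OF assms] path_weight_def
          lookup_single when_def)
qed

text \<open>Evaluation at the arrow \<open>p\<close> recovers \<open>w p\<close>, and a path of the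
  quiver passes through arrows of \<open>G\<close> only. Identities between derivations thereby
  become identities between functions on \<open>arcs G\<close>.\<close>

lemma weight_derivation_eq_iff:
  assumes "wf_digraph G"
  shows "weight_derivation G w = weight_derivation G w' \<longleftrightarrow> (\<forall>p\<in>arcs G. w p = w' p)"
proof
  assume eq: "weight_derivation G w = weight_derivation G w'"
  show "\<forall>p\<in>arcs G. w p = w' p"
  proof
    fix p assume p: "p \<in> arcs G"
    from eq have "diagonal_map G (path_weight w) (pa_arrow G p)
        = diagonal_map G (path_weight w') (pa_arrow G p)"
      by (simp add: weight_derivation_eq_diagonal_map[OF assms])
    hence "Poly_Mapping.single (tail G p, [p]) (w p) = Poly_Mapping.single (tail G p, [p]) (w' p)"
      by (simp add: pa_arrow_def diagonal_map_single arrow_in_qpaths[OF assms p] path_weight_def)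
    thus "w p = w' p" by (metis lookup_single_eq)
  qed
next
  assume "\<forall>p\<in>arcs G. w p = w' p"
  moreover have "set q \<subseteq> arcs G" if "(u, q) \<in> qpaths G" for u q
    using that by (auto simp: qpaths_def pre_digraph.awalk_def)
  ultimately show "weight_derivation G w = weight_derivation G w'"
    unfolding weight_derivation_eq_diagonal_map[OF assms]
    by (intro diagonal_map_eqI) (force simp: path_weight_def intro!: arg_cong[of _ _ sum_list])
qed

lemma sum_weight_derivation:
  fixes G :: "('v, 'e) pre_digraph" and c :: "'i \<Rightarrow> 'k::field"
  assumes "wf_digraph G"
  shows "(\<Sum>i\<in>I. map_scale (c i) (weight_derivation G (w i)))
      = weight_derivation G (\<lambda>p. \<Sum>i\<in>I. c i * w i p)"
proof -
  have "sum_list (map (\<lambda>p. \<Sum>i\<in>I. c i * w i p) q) = (\<Sum>i\<in>I. c i * sum_list (map (w i) q))" for q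
    by (induction q) (auto simp: sum.distrib algebra_simps)
  hence "path_weight (\<lambda>p. \<Sum>i\<in>I. c i * w i p) = (\<lambda>q :: ('v, 'e) qpath. \<Sum>i\<in>I. c i * path_weight (w i) q)"
    unfolding path_weight_def by (intro ext) simp
  thus ?thesis by (simp add: weight_derivation_eq_diagonal_map[OF assms] sum_diagonal_map)
qed

lemma weight_derivation_0:
  assumes "wf_digraph G"
  shows "weight_derivation G (\<lambda>_. 0) = 0"
  using sum_weight_derivation[OF assms, of "\<lambda>_. 0" "\<lambda>_ _. 0" "{}"] by simp

lemma lookup_pa_mult:
  "Poly_Mapping.lookup (pa_mult G x y) r =
     (\<Sum>p\<in>Poly_Mapping.keys x. \<Sum>q\<in>Poly_Mapping.keys y.
        if composable G p q \<and> r = (fst p, snd p @ snd q)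
        then Poly_Mapping.lookup x p * Poly_Mapping.lookup y q else 0)"
  unfolding pa_mult_def lookup_sum
  by (intro sum.cong refl) (auto simp: lookup_single when_def)

text \<open>Multiplication by \<open>v\<close> on the left keeps the paths that start at
  \<open>v\<close>, on the right those that end there. The difference of the two indicators
  telescopes along a path into a sum over its arrows.\<close>

lemma vertex_derivation_eq_weight_derivation:
  assumes "wf_digraph G"
  shows "vertex_derivation G v = weight_derivation G
    (\<lambda>p. (if tail G p = v then 1 else 0) - (if head G p = v then 1 else 0))"
proof -
  interpret wf_digraph G by fact
  let ?w = "\<lambda>p. (if tail G p = v then 1 else 0) - (if head G p = v then 1 else 0) :: 'c"
  let ?\<omega> = "\<lambda>q. (if fst q = v then 1 else 0) - (if awlast (fst q) (snd q) = v then 1 else 0) :: 'c"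
  have left: "Poly_Mapping.lookup (pa_mult G (pa_vertex v) b) r
      = (if fst r = v then 1 else 0) * Poly_Mapping.lookup b r" for b :: "('a, 'b, 'c) pa_elem" and r
  proof -
    have *: "composable G (v, []) q \<and> r = (v, snd q) \<longleftrightarrow> r = q \<and> fst r = v" for q
      by (cases r; cases q) (auto simp: composable_def)
    show ?thesis
      by (auto simp: lookup_pa_mult pa_vertex_def * in_keys_iff sum.delta cong: if_cong)
  qed
  have right: "Poly_Mapping.lookup (pa_mult G b (pa_vertex v)) r
      = (if awlast (fst r) (snd r) = v then 1 else 0) * Poly_Mapping.lookup b r"
    for b :: "('a, 'b, 'c) pa_elem" and r
  proof -
    have *: "composable G q (v, []) \<and> r = (fst q, snd q) \<longleftrightarrow> r = q \<and> awlast (fst r) (snd r) = v" for q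
      by (cases r; cases q) (auto simp: composable_def)
    show ?thesis
      by (auto simp: lookup_pa_mult pa_vertex_def * [simplified] in_keys_iff sum.delta cong: if_cong)
  qed
  have "vertex_derivation G v = diagonal_map G ?\<omega>"
  proof
    fix b :: "('a, 'b, 'c) pa_elem"
    show "vertex_derivation G v b = diagonal_map G ?\<omega> b"
      by (rule poly_mapping_eqI)
         (simp add: vertex_derivation_def lookup_diagonal_map lookup_minus left right algebra_simps)
  qed
  also have "\<dots> = diagonal_map G (path_weight ?w)"
  proof (rule diagonal_map_eqI)
    fix q assume "q \<in> qpaths G"
    then obtain u p z where q: "q = (u, p)" and z: "awalk u p z" by (auto simp: qpaths_def)
    from z have "(if u = v then 1 else 0) - (if z = v then 1 else 0) = path_weight ?w (u, p)"
    proof (induction p arbitrary: u)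
      case (Cons e p)
      from Cons.IH[of "head G e"] Cons.prems show ?case
        by (auto simp: path_weight_def awalk_Cons_iff algebra_simps)
    qed (auto simp: path_weight_def)
    moreover have "awlast u p = z" using z by (simp add: awalkE)
    ultimately show "?\<omega> q = path_weight ?w q" by (simp add: q)
  qed
  finally show ?thesis by (simp add: weight_derivation_eq_diagonal_map[OF assms])
qed

lemma weight_derivation_in_arrow_derivations:
  assumes "fin_digraph G"
  shows "weight_derivation G w \<in> arrow_derivations G"
proof -
  interpret fin_digraph G by fact
  interpret M: vector_space "map_scale :: 'c \<Rightarrow> ('a, 'b, 'c) pa_map \<Rightarrow> _"
    by (rule vector_space_map_scale)
  have "weight_derivation G w = (\<Sum>p\<in>arcs G. map_scale (w p) (arrow_derivation G p))"
    unfolding arrow_derivation_def sum_weight_derivation[OF wf_digraph_axioms]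
      weight_derivation_eq_iff[OF wf_digraph_axioms]
    by (simp add: if_distrib cong: if_cong)
  also have "\<dots> \<in> arrow_derivations G"
    unfolding arrow_derivations_def map_span_def
    by (intro M.span_sum M.span_scale M.span_base imageI)
  finally show ?thesis .
qed

lemma sum_vertex_derivation:
  assumes "fin_digraph G"
  shows "(\<Sum>v\<in>verts G. map_scale (c v) (vertex_derivation G v))
    = weight_derivation G (\<lambda>p. c (tail G p) - c (head G p))"
proof -
  interpret fin_digraph G by fact
  show ?thesis
    unfolding vertex_derivation_eq_weight_derivation[OF wf_digraph_axioms]
      sum_weight_derivation[OF wf_digraph_axioms] weight_derivation_eq_iff[OF wf_digraph_axioms]
    by (simp add: right_diff_distrib sum_subtractf if_distrib[of "(*) _"] cong: if_cong)
qed

lemma connected_imp_constant: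
  assumes "Digraph_Component.connected G"
    and c: "\<And>p. p \<in> arcs G \<Longrightarrow> c (tail G p) = c (head G p)"
    and "u \<in> verts G" "v \<in> verts G"
  shows "c u = c v"
proof -
  have "u \<rightarrow>\<^sup>*\<^bsub>mk_symmetric G\<^esub> v"
    using assms by (auto simp: Digraph_Component.connected_def strongly_connected_def)
  hence "(u, v) \<in> rtrancl_on (verts G) (parcs (mk_symmetric G))"
    by (simp add: reachable_def)
  thus ?thesis
    by (induction rule: rtrancl_on_induct) (auto simp: mk_symmetric_def c)
qed

section \<open>Linear algebra\<close>

lemma (in vector_space) in_span_finite_image:
  assumes "finite I" "x \<in> span (b ` I)"
  shows "\<exists>c. x = (\<Sum>i\<in>I. scale (c i) (b i))"
  using assms
proof (induction I arbitrary: x)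
  case (insert j I)
  from insert.prems obtain k where "x - scale k (b j) \<in> span (b ` I)" by (auto simp: span_insert)
  from insert.IH[OF this] obtain c where c: "x - scale k (b j) = (\<Sum>i\<in>I. scale (c i) (b i))" by blast
  have "(\<Sum>i\<in>I. scale ((c(j := k)) i) (b i)) = (\<Sum>i\<in>I. scale (c i) (b i))"
    using insert.hyps(2) by (intro sum.cong) auto
  hence "x = (\<Sum>i\<in>insert j I. scale ((c(j := k)) i) (b i))"
    using insert.hyps c by (simp add: algebra_simps)
  thus ?case by blast
qed simp

text \<open>The relations form the line through (1, ..., 1). A relation that avoids one index
  \<open>k\<close> has coefficient 0 there and is therefore zero, while the relation with all
  coefficients 1 puts \<open>b k\<close> into the span of the others. Indices are counted, not
  vectors: with two indices in characteristic 2 the two vectors coincide.\<close>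

lemma (in vector_space) dim_span_image_if_relations_constant:
  assumes I: "finite I" "I \<noteq> {}"
    and rel: "\<And>c. (\<Sum>i\<in>I. scale (c i) (b i)) = 0 \<longleftrightarrow> (\<forall>i\<in>I. \<forall>j\<in>I. c i = c j)"
  shows "int (dim (span (b ` I))) = int (card I) - 1"
proof -
  from I obtain k where k: "k \<in> I" by auto
  let ?J = "I - {k}"
  have split: "(\<Sum>i\<in>I. f i) = f k + (\<Sum>i\<in>?J. f i)" for f :: "'c \<Rightarrow> 'b"
    using I k by (simp add: sum.remove)
  have zero: "\<forall>i\<in>?J. c i = 0" if "(\<Sum>i\<in>?J. scale (c i) (b i)) = 0" for c
  proof -
    have "(\<Sum>i\<in>?J. scale ((c(k := 0)) i) (b i)) = (\<Sum>i\<in>?J. scale (c i) (b i))"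
      by (intro sum.cong) auto
    hence "(\<Sum>i\<in>I. scale ((c(k := 0)) i) (b i)) = 0"
      unfolding split using that by simp
    hence *: "\<forall>i\<in>I. \<forall>j\<in>I. (c(k := 0)) i = (c(k := 0)) j" by (simp only: rel)
    show ?thesis
    proof
      fix i assume i: "i \<in> ?J"
      hence "(c(k := 0)) i = (c(k := 0)) k" using * k by blast
      thus "c i = 0" using i by simp
    qed
  qed
  have inj: "inj_on b ?J"
  proof (rule inj_onI, rule ccontr)
    fix i j assume ij: "i \<in> ?J" "j \<in> ?J" "b i = b j" "i \<noteq> j"
    define c :: "'c \<Rightarrow> 'a" where "c = (\<lambda>l. if l = i then 1 else if l = j then -1 else 0)"
    have "(\<Sum>l\<in>?J. scale (c l) (b l)) = (\<Sum>l\<in>{i, j}. scale (c l) (b l))"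
      using I ij by (intro sum.mono_neutral_right) (auto simp: c_def)
    also have "\<dots> = 0" using ij by (simp add: c_def)
    finally have "c i = 0" using zero ij(1) by blast
    thus False by (simp add: c_def)
  qed
  have "independent (b ` ?J)"
  proof (rule independent_if_scalars_zero)
    fix f x assume *: "(\<Sum>x\<in>b ` ?J. scale (f x) x) = 0" "x \<in> b ` ?J"
    hence "(\<Sum>i\<in>?J. scale (f (b i)) (b i)) = 0" using inj by (simp add: sum.reindex)
    thus "f x = 0" using zero[of "f \<circ> b"] *(2) by auto
  qed (use I in auto)
  moreover have "span (b ` I) = span (b ` ?J)"
  proof -
    have "(\<Sum>i\<in>I. scale 1 (b i)) = 0" using rel[of "\<lambda>_. 1"] by simp
    hence "b k = - (\<Sum>i\<in>?J. b i)" unfolding split by (simp add: eq_neg_iff_add_eq_0)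
    hence "b k \<in> span (b ` ?J)" by (simp only:) (intro span_neg span_sum span_base imageI)
    moreover have "b ` I = insert (b k) (b ` ?J)" using k by auto
    ultimately show ?thesis by (metis span_redundant)
  qed
  ultimately have "dim (span (b ` I)) = card (b ` ?J)"
    by (simp add: dim_eq_card_independent)
  also have "\<dots> = card I - 1" using inj I k by (simp add: card_image)
  finally show ?thesis using I by (simp add: card_gt_0_iff Suc_leI of_nat_diff)
qed

section \<open>The field as a rational vector space\<close>

definition scale_rat :: "rat \<Rightarrow> 'k::field \<Rightarrow> 'k" where
  "scale_rat q x = of_int (fst (quotient_of q)) / of_int (snd (quotient_of q)) * x"

text \<open>\<open>of_rat\<close> belongs to the class \<open>field_char_0\<close>, whereas
  characteristic 0 is here a hypothesis about a type of class \<open>field\<close>; hence the action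
  by numerator and denominator. The hypothesis makes every denominator invertible.\<close>

lemma vector_space_scale_rat:
  assumes "CHAR('k::field) = 0"
  shows "vector_space (scale_rat :: rat \<Rightarrow> 'k \<Rightarrow> 'k)"
proof -
  have nz: "(of_int n :: 'k) = 0 \<longleftrightarrow> n = 0" for n
    using of_int_eq_0_iff_char_dvd[where 'a = 'k] assms by simp
  \<comment> \<open>Sums and products of reduced fractions need not be reduced, so the action must
    be computable from any representative.\<close>
  have eq: "scale_rat (Fract a b) x = of_int a / of_int b * x" if "b \<noteq> 0" for a b and x :: 'k
  proof -
    obtain c d where cd: "quotient_of (Fract a b) = (c, d)" by fastforce
    hence "Fract a b = Fract c d" "d > 0" using quotient_of_denom_pos quotient_of_div
      by (auto simp: Fract_of_int_quotient)
    hence "a * d = c * b" using that by (simp add: eq_rat)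
    hence "(of_int a * of_int d :: 'k) = of_int c * of_int b" by (metis of_int_mult)
    thus ?thesis using that cd \<open>d > 0\<close> by (auto simp: scale_rat_def field_simps nz)
  qed
  have rat: "\<exists>a b. q = Fract a b \<and> b \<noteq> 0" for q by (cases q) auto
  show ?thesis
  proof
    fix q r :: rat and x y :: 'k
    obtain a b c d where q: "q = Fract a b" "r = Fract c d" "b \<noteq> 0" "d \<noteq> 0" using rat by metis
    show "scale_rat q (x + y) = scale_rat q x + scale_rat q y"
      by (simp add: scale_rat_def distrib_left)
    show "scale_rat (q + r) x = scale_rat q x + scale_rat r x"
      using q by (simp add: eq nz field_simps)
    show "scale_rat q (scale_rat r x) = scale_rat (q * r) x"
      using q by (simp add: eq nz field_simps)
    show "scale_rat 1 x = x" by (simp add: scale_rat_def)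
  qed
qed

text \<open>The single vector \<open>x\<close> is independent over the rationals, so a linear
  functional may be prescribed on it. Compatibility with differences is the part of linearity that
  the weights call for.\<close>

lemma ex_additive_functional_rat:
  fixes x :: "'k::field"
  assumes "CHAR('k) = 0" "x \<noteq> 0"
  shows "\<exists>l :: 'k \<Rightarrow> rat. (\<forall>a b. l (a - b) = l a - l b) \<and> l x = 1"
proof -
  interpret V: vector_space "scale_rat :: rat \<Rightarrow> 'k \<Rightarrow> 'k"
    by (rule vector_space_scale_rat) fact
  interpret Q: vector_space "(*) :: rat \<Rightarrow> rat \<Rightarrow> rat"
    by unfold_locales (auto simp: algebra_simps)
  interpret vector_space_pair "scale_rat :: rat \<Rightarrow> 'k \<Rightarrow> 'k" "(*) :: rat \<Rightarrow> rat \<Rightarrow> rat" ..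
  have "V.independent {x}" using assms(2) by simp
  then obtain l where l: "Vector_Spaces.linear scale_rat (*) l" "l x = 1"
    using linear_independent_extend[of "{x}" "\<lambda>_. 1"] by auto
  thus ?thesis using linear_diff by blast
qed

section \<open>Topology of the plane\<close>

lemma connected_nonzero_sign:
  fixes f :: "'a::topological_space \<Rightarrow> real"
  assumes "connected S" "continuous_on S f" "\<And>x. x \<in> S \<Longrightarrow> f x \<noteq> 0"
  shows "(\<forall>x\<in>S. f x > 0) \<or> (\<forall>x\<in>S. f x < 0)"
proof (rule ccontr)
  assume "\<not> ?thesis"
  then obtain x y where "x \<in> S" "y \<in> S" "f x \<le> 0" "0 \<le> f y" by force
  moreover have "connected (f ` S)" using assms by (intro connected_continuous_image)
  ultimately have "0 \<in> f ` S" using connectedD_interval[of "f ` S" "f x" "f y" 0] by blast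
  thus False using assms(3) by auto
qed

text \<open>By injectivity the difference of the values at \<open>y\<close> and \<open>x\<close> has
  no zero on the set of pairs with \<open>x < y\<close>. That set is convex, hence connected, so the
  sign is the same for all pairs.\<close>

lemma continuous_inj_on_strict_mono_cases:
  fixes f :: "real \<Rightarrow> real"
  assumes "convex I" "continuous_on I f" "inj_on f I"
  shows "(\<forall>x\<in>I. \<forall>y\<in>I. x < y \<longrightarrow> f x < f y) \<or> (\<forall>x\<in>I. \<forall>y\<in>I. x < y \<longrightarrow> f y < f x)"
proof -
  let ?D = "(I \<times> I) \<inter> {p :: real \<times> real. fst p - snd p < 0}"
  have "linear (\<lambda>p :: real \<times> real. fst p - snd p)"
    by (auto intro!: linearI simp: algebra_simps)
  hence "convex ((\<lambda>p :: real \<times> real. fst p - snd p) -` {..<0})"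
    by (intro convex_linear_vimage) auto
  hence "convex ?D" using assms(1)
    by (intro convex_Int convex_Times) (simp_all add: vimage_def)
  moreover have "continuous_on ?D (\<lambda>p. f (snd p) - f (fst p))"
    by (intro continuous_on_diff continuous_on_compose2[OF assms(2)] continuous_intros) auto
  moreover have "f (snd p) - f (fst p) \<noteq> 0" if "p \<in> ?D" for p
    using that inj_onD[OF assms(3), of "snd p" "fst p"] by auto
  ultimately have "(\<forall>p\<in>?D. f (snd p) - f (fst p) > 0) \<or> (\<forall>p\<in>?D. f (snd p) - f (fst p) < 0)"
    by (intro connected_nonzero_sign convex_connected)
  thus ?thesis
  proof (rule disj_forward)
    assume *: "\<forall>p\<in>?D. f (snd p) - f (fst p) > 0"
    show "\<forall>x\<in>I. \<forall>y\<in>I. x < y \<longrightarrow> f x < f y"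
      using bspec[OF *, of "(_, _)"] by simp
  next
    assume *: "\<forall>p\<in>?D. f (snd p) - f (fst p) < 0"
    show "\<forall>x\<in>I. \<forall>y\<in>I. x < y \<longrightarrow> f y < f x"
      using bspec[OF *, of "(_, _)"] by simp
  qed
qed

text \<open>The path \<open>g\<close> satisfies g' = -2 pi i (g - w), so the integrand is constant.
  This is the loop with which the image of a circle under a side-swapping map is compared.\<close>

lemma winding_number_reversed_circle:
  assumes "c \<noteq> 0"
  shows "winding_number (\<lambda>t. w + c * exp (- (2 * of_real pi * \<i> * of_real t))) w = -1"
proof -
  define g where "g = (\<lambda>t :: real. w + c * exp (- (2 * of_real pi * \<i> * of_real t)))"
  have "valid_path ((\<lambda>z. w + c * exp z) \<circ> linepath 0 (- (2 * of_real pi * \<i>)))"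
    by (rule valid_path_compose_holomorphic[where S = UNIV]) (auto intro!: holomorphic_intros)
  moreover have "(\<lambda>z. w + c * exp z) \<circ> linepath 0 (- (2 * of_real pi * \<i>)) = g"
    by (auto simp: g_def linepath_def scaleR_conv_of_real fun_eq_iff mult_ac)
  ultimately have vp: "valid_path g" by simp
  have ni: "w \<notin> path_image g" using assms by (auto simp: path_image_def g_def)
  have d: "(g has_vector_derivative - (2 * of_real pi * \<i>) * (g t - w)) (at t within {0..1})" for t
    unfolding g_def
    by (rule has_vector_derivative_real_field[THEN has_vector_derivative_at_within] derivative_eq_intros refl | simp)+
  have "((\<lambda>z. 1 / (z - w)) has_contour_integral (- (2 * of_real pi * \<i>))) g"
  proof -
    have "((\<lambda>t :: real. - (2 * of_real pi * \<i>)) has_integral (- (2 * of_real pi * \<i>))) {0..1}"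
      using has_integral_const_real[of "- (2 * of_real pi * \<i>)" 0 1] by simp
    moreover have "1 / (g t - w) * vector_derivative g (at t within {0..1}) = - (2 * of_real pi * \<i>)"
      if "t \<in> {0..1}" for t
      using vector_derivative_within_cbox[of 0 1 t g] d[of t] that assms by (simp add: g_def)
    ultimately show ?thesis unfolding has_contour_integral_def
      by (subst has_integral_cong) auto
  qed
  hence "contour_integral g (\<lambda>z. 1 / (z - w)) = - (2 * of_real pi * \<i>)"
    by (rule contour_integral_unique)
  thus ?thesis using winding_number_valid_path[OF vp ni] by (simp add: g_def)
qed

text \<open>Division by \<open>d\<close> turns the line through \<open>a\<close> in direction
  \<open>d\<close> horizontal, so this is an open half-plane beside that line; the sign of
  \<open>s\<close> selects the left or the right one.\<close>

lemma convex_side: "convex {z :: complex. s * Im ((z - a) / d) > 0}"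
proof -
  have "linear (\<lambda>z. s * Im (z / d))"
  proof (rule linearI)
    fix r z show "s * Im (r *\<^sub>R z / d) = r *\<^sub>R (s * Im (z / d))"
    proof -
      have "r *\<^sub>R z / d = r *\<^sub>R (z / d)" by (simp add: scaleR_conv_of_real)
      moreover have "Im (r *\<^sub>R w) = r * Im w" for w by simp
      ultimately have "Im (r *\<^sub>R z / d) = r * Im (z / d)" by metis
      thus ?thesis by simp
    qed
  qed (simp add: add_divide_distrib distrib_left)
  hence "convex ((\<lambda>z. s * Im (z / d)) -` {s * Im (a / d)<..})"
    by (intro convex_linear_vimage) auto
  moreover have "(\<lambda>z. s * Im (z / d)) -` {s * Im (a / d)<..} = {z. s * Im ((z - a) / d) > 0}"
    by (auto simp: diff_divide_distrib right_diff_distrib)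
  ultimately show ?thesis by simp
qed

text \<open>By \<open>off\<close>, each open half disc, being connected, goes strictly above or
  strictly below the height of \<open>h z0\<close>. If both go to the same side, the image of the
  circle contracts away from \<open>h z0\<close> and has winding number 0; if the sides are swapped,
  it deforms into a reflected circle and has winding number -1. The conditions \<open>fwd\<close>
  and \<open>bwd\<close> are indispensable: a half turn swaps the sides with winding number
  1.\<close>

lemma sides_preserved:
  fixes h :: "complex \<Rightarrow> complex"
  assumes r: "0 < r" and d: "norm d = 1" and cont: "continuous_on (cball z0 r) h"
    and wn: "winding_number (h \<circ> circlepath z0 r) (h z0) = 1"
    and off: "\<And>z. z \<in> cball z0 r \<Longrightarrow> Im ((z - z0) / d) \<noteq> 0 \<Longrightarrow> Im (h z) \<noteq> Im (h z0)"
    and fwd: "Im (h (z0 + of_real r * d)) = Im (h z0)" "Re (h (z0 + of_real r * d)) > Re (h z0)"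
    and bwd: "Im (h (z0 - of_real r * d)) = Im (h z0)" "Re (h (z0 - of_real r * d)) < Re (h z0)"
    and z: "z \<in> cball z0 r"
  shows "Im ((z - z0) / d) > 0 \<Longrightarrow> Im (h z) > Im (h z0)"
    and "Im ((z - z0) / d) < 0 \<Longrightarrow> Im (h z) < Im (h z0)"
proof -
  have d0: "d \<noteq> 0" using d by auto
  define a where "a = (\<lambda>z. (z - z0) / d)"
  define k where "k = (\<lambda>z. Im (h z) - Im (h z0))"
  have a: "norm (a z) = norm (z - z0)" for z by (simp add: a_def norm_divide d)
  have P: "connected (cball z0 r \<inter> {z. Im (a z) > 0})"
    using convex_side[of 1 z0 d] by (simp add: a_def convex_connected convex_Int)
  have N: "connected (cball z0 r \<inter> {z. Im (a z) < 0})"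
    using convex_side[of "-1" z0 d] by (simp add: a_def convex_connected convex_Int)
  have ck: "continuous_on (cball z0 r) k" unfolding k_def by (intro continuous_intros cont)
  have k0: "k z \<noteq> 0" if "z \<in> cball z0 r" "Im (a z) \<noteq> 0" for z
    using off that by (auto simp: k_def a_def)
  have signP: "(\<forall>z\<in>cball z0 r \<inter> {z. Im (a z) > 0}. k z > 0) \<or> (\<forall>z\<in>cball z0 r \<inter> {z. Im (a z) > 0}. k z < 0)"
    using k0 by (intro connected_nonzero_sign P continuous_on_subset[OF ck]) auto
  have signN: "(\<forall>z\<in>cball z0 r \<inter> {z. Im (a z) < 0}. k z > 0) \<or> (\<forall>z\<in>cball z0 r \<inter> {z. Im (a z) < 0}. k z < 0)"
    using k0 by (intro connected_nonzero_sign N continuous_on_subset[OF ck]) auto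
  let ?c = "circlepath z0 r"
  have c: "?c t \<in> cball z0 r" "norm (?c t - z0) = r" for t
    using r by (auto simp: circlepath dist_norm norm_mult)
  have axis: "z = z0 + of_real r * d \<or> z = z0 - of_real r * d"
    if "norm (z - z0) = r" "Im (a z) = 0" for z
  proof -
    have "a z = of_real (Re (a z))" using that by (simp add: complex_eq_iff)
    moreover have "\<bar>Re (a z)\<bar> = r" using that a[of z] by (metis calculation norm_of_real)
    ultimately have "a z = of_real r \<or> a z = - of_real r" by (metis abs_eq_iff' of_real_minus abs_real_def)
    thus ?thesis using d0 by (auto simp: a_def field_simps)
  qed
  have path: "path (h \<circ> ?c)"
    by (intro path_continuous_image continuous_on_subset[OF cont]) (use r in auto)
  have loop: "pathfinish (h \<circ> ?c) = pathstart (h \<circ> ?c)"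
    by (simp add: pathstart_compose pathfinish_compose)
  \<comment> \<open>The loop is contracted linearly to a point at signed height \<open>s\<close>
    relative to \<open>h z0\<close>. It reaches the height of \<open>h z0\<close> itself only at the
    two ends of the diameter, and there the real part differs.\<close>
  have one_side: False if "s = 1 \<or> s = -1" "\<And>z. z \<in> cball z0 r \<Longrightarrow> Im (a z) \<noteq> 0 \<Longrightarrow> s * k z > 0" for s
  proof -
    have "homotopic_loops (- {h z0}) (h \<circ> ?c) (\<lambda>_. h z0 + of_real s * \<i>)"
    proof (rule homotopic_loops_linear)
      fix t :: real
      show "closed_segment ((h \<circ> ?c) t) (h z0 + of_real s * \<i>) \<subseteq> - {h z0}"
      proof
        fix y assume "y \<in> closed_segment ((h \<circ> ?c) t) (h z0 + of_real s * \<i>)"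
        then obtain u where u: "0 \<le> u" "u \<le> 1" "y = (1 - u) *\<^sub>R h (?c t) + u *\<^sub>R (h z0 + of_real s * \<i>)"
          by (auto simp: closed_segment_def)
        have "Im y = (1 - u) * Im (h (?c t)) + u * (Im (h z0) + s)"
          using u(3) by simp
        hence "Im y - Im (h z0) = (1 - u) * k (?c t) + u * s"
          by (simp add: k_def algebra_simps)
        hence "s * (Im y - Im (h z0)) = s * ((1 - u) * k (?c t) + u * s)"
          by (rule arg_cong)
        also have "\<dots> = (1 - u) * (s * k (?c t)) + u * s * s"
          by (simp add: distrib_left mult_ac)
        also have "u * s * s = u" using that(1) by auto
        finally have eq: "s * (Im y - Im (h z0)) = (1 - u) * (s * k (?c t)) + u" .
        show "y \<in> - {h z0}"
        proof (cases "Im (a (?c t)) = 0")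
          case False
          hence "s * k (?c t) > 0" using that(2) c(1) by blast
          hence "(1 - u) * (s * k (?c t)) + u > 0" using u(1,2)
            by (cases "u = 0") (auto intro: add_nonneg_pos)
          thus ?thesis using eq by auto
        next
          case True
          hence *: "?c t = z0 + of_real r * d \<or> ?c t = z0 - of_real r * d" using axis c(2) by blast
          hence "k (?c t) = 0" using fwd bwd by (auto simp: k_def)
          show ?thesis
          proof (cases "u = 0")
            case True thus ?thesis using u(3) * fwd bwd by auto
          next
            case False thus ?thesis using eq \<open>k (?c t) = 0\<close> by auto
          qed
        qed
      qed
    qed (use path loop in \<open>auto simp: pathstart_def pathfinish_def path_def\<close>)
    hence "winding_number (h \<circ> ?c) (h z0) = winding_number (\<lambda>_. h z0 + of_real s * \<i>) (h z0)"
      by (rule winding_number_homotopic_loops)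
    also have "\<dots> = 0" by (rule winding_number_zero_const) (use that(1) in auto)
    finally show False using wn by simp
  qed
  have flipped: False
    if kP: "\<And>z. z \<in> cball z0 r \<Longrightarrow> Im (a z) > 0 \<Longrightarrow> k z < 0"
      and kN: "\<And>z. z \<in> cball z0 r \<Longrightarrow> Im (a z) < 0 \<Longrightarrow> k z > 0"
  proof -
    \<comment> \<open>The reflection swaps the sides but keeps the direction of the diameter, just
      as \<open>h\<close> does here. So along each segment the imaginary parts at both ends have the
      same sign relative to \<open>h z0\<close>, and at the ends of the diameter the real parts
      do.\<close>
    let ?g = "\<lambda>t. h z0 + cnj (a (?c t))"
    have g: "?g = (\<lambda>t. h z0 + cnj (of_real r / d) * exp (- (2 * of_real pi * \<i> * of_real t)))"
      by (rule ext) (simp add: a_def circlepath exp_cnj)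
    have "homotopic_loops (- {h z0}) (h \<circ> ?c) ?g"
    proof (rule homotopic_loops_linear)
      show "path ?g" unfolding g path_def by (intro continuous_intros)
      show "pathfinish ?g = pathstart ?g" unfolding g pathfinish_def pathstart_def
        by (simp add: exp_minus)
      fix t :: real
      show "closed_segment ((h \<circ> ?c) t) (?g t) \<subseteq> - {h z0}"
      proof
        fix y assume "y \<in> closed_segment ((h \<circ> ?c) t) (?g t)"
        then obtain u where u: "0 \<le> u" "u \<le> 1" "y = (1 - u) *\<^sub>R h (?c t) + u *\<^sub>R ?g t"
          by (auto simp: closed_segment_def)
        have "Im y = (1 - u) * Im (h (?c t)) + u * (Im (h z0) - Im (a (?c t)))"
          using u(3) by simp
        hence im: "Im y - Im (h z0) = (1 - u) * k (?c t) + u * (- Im (a (?c t)))"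
          by (simp add: k_def algebra_simps)
        have "Re y = (1 - u) * Re (h (?c t)) + u * (Re (h z0) + Re (a (?c t)))"
          using u(3) by simp
        hence re: "Re y - Re (h z0) = (1 - u) * (Re (h (?c t)) - Re (h z0)) + u * Re (a (?c t))"
          by (simp add: algebra_simps)
        have comb: "(1 - u) * p + u * q > 0" if "p > 0" "q > 0" for p q :: real
          using u(1,2) that by (cases "u = 0") (auto intro: add_nonneg_pos)
        consider "Im (a (?c t)) > 0" | "Im (a (?c t)) < 0"
          | "?c t = z0 + of_real r * d" | "?c t = z0 - of_real r * d"
          using axis c(2) by (meson linorder_neqE_linordered_idom)
        thus "y \<in> - {h z0}"
        proof cases
          case 1
          thus ?thesis using comb[of "- k (?c t)" "Im (a (?c t))"] kP[OF c(1)] im by auto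
        next
          case 2
          thus ?thesis using comb[of "k (?c t)" "- Im (a (?c t))"] kN[OF c(1)] im by auto
        next
          case 3
          hence "Re (a (?c t)) = r" using d0 by (simp add: a_def)
          thus ?thesis using comb[of "Re (h (?c t)) - Re (h z0)" r] r fwd(2) re 3 by auto
        next
          case 4
          hence "Re (a (?c t)) = - r" using d0 by (simp add: a_def)
          thus ?thesis using comb[of "Re (h z0) - Re (h (?c t))" r] r bwd(2) re 4
            by (auto simp: algebra_simps)
        qed
      qed
    qed (use path loop in auto)
    hence "winding_number (h \<circ> ?c) (h z0) = winding_number ?g (h z0)"
      by (rule winding_number_homotopic_loops)
    also have "\<dots> = -1" unfolding g
      by (rule winding_number_reversed_circle) (use r d0 in auto)
    finally show False using wn by simp
  qed
  have "(\<forall>z\<in>cball z0 r. Im (a z) > 0 \<longrightarrow> k z > 0) \<and> (\<forall>z\<in>cball z0 r. Im (a z) < 0 \<longrightarrow> k z < 0)"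
    using signP signN
  proof (elim disjE)
    assume "\<forall>z\<in>cball z0 r \<inter> {z. Im (a z) > 0}. k z > 0" "\<forall>z\<in>cball z0 r \<inter> {z. Im (a z) < 0}. k z > 0"
    hence False by (intro one_side[of 1]) (auto simp: neq_iff)
    thus ?thesis ..
  next
    assume "\<forall>z\<in>cball z0 r \<inter> {z. Im (a z) > 0}. k z < 0" "\<forall>z\<in>cball z0 r \<inter> {z. Im (a z) < 0}. k z < 0"
    hence False by (intro one_side[of "-1"]) (auto simp: neq_iff)
    thus ?thesis ..
  next
    assume "\<forall>z\<in>cball z0 r \<inter> {z. Im (a z) > 0}. k z < 0" "\<forall>z\<in>cball z0 r \<inter> {z. Im (a z) < 0}. k z > 0"
    hence False by (intro flipped) auto
    thus ?thesis ..
  qed auto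
  thus "Im ((z - z0) / d) > 0 \<Longrightarrow> Im (h z) > Im (h z0)" "Im ((z - z0) / d) < 0 \<Longrightarrow> Im (h z) < Im (h z0)"
    using z by (auto simp: k_def a_def)
qed

section \<open>Jumps of functions on an interval, and rays in the unit disc\<close>

lemma sum_jumps:
  fixes f :: "real \<Rightarrow> 'a::ab_group_add"
  assumes T: "finite T" "T \<subseteq> {a<..<b}" and "a \<le> b"
    and loc: "\<And>x. x \<in> {a..b} - T \<Longrightarrow> \<forall>\<^sub>F y in at x. f y = f x"
    and lim: "\<And>t. t \<in> T \<Longrightarrow> \<forall>\<^sub>F y in at_left t. f y = l t"
             "\<And>t. t \<in> T \<Longrightarrow> \<forall>\<^sub>F y in at_right t. f y = r t"
  shows "f b - f a = (\<Sum>t\<in>T. r t - l t)"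
proof -
  \<comment> \<open>\<open>F\<close> is \<open>f\<close> with the jumps accumulated so far removed,
    hence locally constant. At a point of \<open>T\<close> the value of \<open>f\<close> is replaced
    by its left value, and the sum leaves out the jump at the point itself; immediately to the right
    that jump enters the sum and cancels the passage from \<open>l\<close> to
    \<open>r\<close>.\<close>
  define F where "F = (\<lambda>x. (if x \<in> T then l x else f x) - (\<Sum>t\<in>T \<inter> {..<x}. r t - l t))"
  have away: "\<forall>\<^sub>F y in at x. y \<notin> T \<and> T \<inter> {..<y} = (if y \<le> x then T \<inter> {..<x} else T \<inter> {..x})" for x
  proof -
    obtain e where e: "e > 0" "\<And>t. t \<in> T \<Longrightarrow> t \<noteq> x \<Longrightarrow> e \<le> dist x t"
      using finite_set_avoid[OF T(1), of x] by auto
    have "y \<notin> T \<and> T \<inter> {..<y} = (if y \<le> x then T \<inter> {..<x} else T \<inter> {..x})"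
      if "y \<noteq> x" "dist y x < e" for y
      using e(2) that by (force simp: dist_real_def)
    thus ?thesis unfolding eventually_at using e(1) by blast
  qed
  have ev: "\<forall>\<^sub>F y in at x. F y = F x" if x: "x \<in> {a..b}" for x
  proof (cases "x \<in> T")
    case False
    hence *: "T \<inter> {..x} = T \<inter> {..<x}" by (auto simp: le_less)
    have "\<forall>\<^sub>F y in at x. f y = f x" using loc x False by blast
    thus ?thesis using away[of x]
      by eventually_elim (simp add: F_def False *)
  next
    case True
    hence *: "T \<inter> {..x} = insert x (T \<inter> {..<x})" by auto
    have left: "\<forall>\<^sub>F y in at_left x. y < x" and right: "\<forall>\<^sub>F y in at_right x. x < y"
      by (simp_all add: eventually_at_filter)
    have "\<forall>\<^sub>F y in at_left x. F y = F x"
      using lim(1)[OF True] filter_leD[OF at_le[OF subset_UNIV] away[of x]] left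
      by eventually_elim (auto simp: F_def True)
    moreover have "\<forall>\<^sub>F y in at_right x. F y = F x"
      using lim(2)[OF True] filter_leD[OF at_le[OF subset_UNIV] away[of x]] right
      by eventually_elim (use T in \<open>auto simp: F_def True *\<close>)
    ultimately show ?thesis by (simp add: eventually_at_split)
  qed
  have "F constant_on {a..b}"
  proof (rule locally_constant_imp_constant)
    fix x assume "x \<in> {a..b}"
    with ev[of x] obtain e where e: "e > 0" "\<forall>y. y \<noteq> x \<and> dist y x < e \<longrightarrow> F y = F x"
      unfolding eventually_at by blast
    have e': "F y = F x" if "dist y x < e" for y
      using e(2) that by (cases "y = x") auto
    have "openin (top_of_set {a..b}) ({a..b} \<inter> ball x e)" by (simp add: openin_open_Int)
    moreover have "x \<in> {a..b} \<inter> ball x e" using e(1) \<open>x \<in> _\<close> by simp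
    moreover have "\<forall>y\<in>{a..b} \<inter> ball x e. F y = F x" using e' by (simp add: dist_commute)
    ultimately show "\<exists>U. openin (top_of_set {a..b}) U \<and> x \<in> U \<and> (\<forall>y\<in>U. F y = F x)" by blast
  qed auto
  hence "F a = F b" using \<open>a \<le> b\<close> by (auto simp: constant_on_def)
  moreover have "a \<notin> T" "b \<notin> T" "T \<inter> {..<a} = {}" "T \<inter> {..<b} = T" using T by auto
  ultimately show ?thesis by (simp add: F_def algebra_simps)
qed

lemma cis_eq_cis_iff: "cis x = cis y \<longleftrightarrow> (\<exists>n::int. x = y + 2 * pi * n)"
  using sin_cos_eq_iff[of x y] by (auto simp: complex_eq_iff mult_ac)

text \<open>The circle is cut open at a direction outside the finite set \<open>R\<close>. Then all
  angles of \<open>R\<close> lie strictly inside the interval, as \<open>sum_jumps\<close>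
  demands.\<close>

lemma ex_angles:
  assumes "finite R" "R \<subseteq> sphere 0 1"
  obtains a T where "finite T" "T \<subseteq> {a<..<a + 2 * pi}" "bij_betw cis T R"
    "\<And>\<theta>. \<theta> \<in> {a..a + 2 * pi} - T \<Longrightarrow> cis \<theta> \<notin> R"
proof -
  have inj: "inj_on cis {b..<b + 2 * pi}" for b
  proof (rule inj_onI)
    fix x y assume xy: "x \<in> {b..<b + 2 * pi}" "y \<in> {b..<b + 2 * pi}" "cis x = cis y"
    then obtain n :: int where n: "x = y + 2 * pi * n" by (auto simp: cis_eq_cis_iff)
    hence "\<bar>2 * pi * n\<bar> < 2 * pi * 1" using xy by auto
    hence "\<bar>real_of_int n\<bar> < 1" by (simp add: abs_mult)
    hence "n = 0" by linarith
    thus "x = y" using n by simp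
  qed
  have "infinite (cis ` {0..<0 + 2 * pi})"
    using inj[of 0] infinite_Ico[of 0 "2 * pi"] pi_gt_zero by (simp add: finite_image_iff)
  hence "\<not> cis ` {0..<0 + 2 * pi} \<subseteq> R" using assms(1) finite_subset by blast
  then obtain a where a: "cis a \<notin> R" by blast
  define T where "T = {\<tau> \<in> {a<..<a + 2 * pi}. cis \<tau> \<in> R}"
  have injT: "inj_on cis T" by (rule inj_on_subset[OF inj[of a]]) (auto simp: T_def)
  have ca: "cis (a + 2 * pi) = cis a" using cis_eq_cis_iff[of "a + 2 * pi" a] by (metis mult.right_neutral of_int_1)
  have im: "cis ` T = R"
  proof (intro equalityI subsetI)
    fix d assume d: "d \<in> R"
    define w where "w = d * cis (- a)"
    have "norm d = 1" using d assms(2) by auto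
    hence "norm w = 1" by (simp add: w_def norm_mult)
    define x where "x = Arg2pi w"
    have x: "0 \<le> x" "x < 2 * pi" "w = cis x"
      using Arg2pi[of w] \<open>norm w = 1\<close> by (auto simp: x_def is_Arg_def cis_conv_exp)
    have "d = w * cis a" by (simp add: w_def mult.assoc cis_mult)
    hence dx: "d = cis (a + x)" using x(3) by (simp add: cis_mult add.commute)
    have "x \<noteq> 0" using dx a d by auto
    hence "a + x \<in> T" using x dx d by (auto simp: T_def)
    thus "d \<in> cis ` T" using dx by blast
  qed (auto simp: T_def)
  show thesis
  proof (rule that[of T a])
    show "finite T" using injT im assms(1) finite_image_iff by metis
    show "T \<subseteq> {a<..<a + 2 * pi}" by (auto simp: T_def)
    show "bij_betw cis T R" using injT im by (simp add: bij_betw_def)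
    fix \<theta> assume \<theta>: "\<theta> \<in> {a..a + 2 * pi} - T"
    hence "\<theta> = a \<or> \<theta> = a + 2 * pi \<or> (\<theta> \<in> {a<..<a + 2 * pi} \<and> \<theta> \<notin> T)" by auto
    thus "cis \<theta> \<notin> R" using a ca by (auto simp: T_def)
  qed
qed

lemma sgn_ray: "0 < r \<Longrightarrow> norm d = 1 \<Longrightarrow> sgn (of_real r * d :: complex) = d"
  by (simp add: sgn_eq norm_mult)

text \<open>Directions depend continuously on nonzero points and \<open>R\<close> is finite, so near
  a point of one ray no other ray is met. This makes a vertex chart usable as a flat chart away from
  its centre.\<close>

lemma isolated_ray:
  assumes R: "finite R" "R \<subseteq> sphere 0 1" and d: "d \<in> R" and s: "0 < s" "s < 1"
  obtains e where "0 < e" "ball (of_real s * d) e \<subseteq> ball 0 1"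
    "\<And>z. z \<in> ball (of_real s * d) e \<Longrightarrow>
       z \<in> {0} \<union> {of_real r * d | r d. 0 < r \<and> r < 1 \<and> d \<in> R} \<longleftrightarrow> Im ((z - of_real s * d) / d) = 0"
proof -
  have nR: "norm d' = 1" if "d' \<in> R" for d' using that R(2) by auto
  have nd: "norm d = 1" "d \<noteq> 0" using nR[OF d] by auto
  obtain \<delta> where \<delta>: "\<delta> > 0" "\<forall>d'\<in>R. d' \<noteq> d \<longrightarrow> \<delta> \<le> dist d d'"
    using finite_set_avoid[OF R(1), of d] by blast
  have sgn: "sgn (of_real r * d' :: complex) = d'" if "0 < r" "d' \<in> R" for r d'
    using that nR sgn_ray by blast
  have "isCont sgn (of_real s * d)" using s nd by (intro isCont_sgn) auto
  then obtain e1 where e1: "e1 > 0" "\<And>z. dist z (of_real s * d) < e1 \<Longrightarrow> dist (sgn z) d < \<delta>"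
    using \<delta>(1) sgn[OF s(1) d] unfolding continuous_at_eps_delta by metis
  \<comment> \<open>The bound \<open>e1\<close> keeps directions close to \<open>d\<close>,
    \<open>s\<close> excludes the origin and the opposite ray, and \<open>1 - s\<close> keeps the
    ball inside the unit disc.\<close>
  define e where "e = min e1 (min s (1 - s))"
  have e: "0 < e" "e \<le> e1" "e \<le> s" "e \<le> 1 - s" using e1(1) s by (auto simp: e_def)
  have nsd: "norm (of_real s * d) = s" using s nd by (simp add: norm_mult)
  have sub: "norm z < 1" if "z \<in> ball (of_real s * d) e" for z
    using that e(4) nsd norm_triangle_ineq2[of z "of_real s * d"] by (simp add: dist_norm norm_minus_commute)
  show thesis
  proof (rule that[OF e(1)])
    show "ball (of_real s * d) e \<subseteq> ball 0 1" using sub by auto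
    fix z assume z: "z \<in> ball (of_real s * d) e"
    have za: "(z - of_real s * d) / d = z / d - of_real s" using nd by (simp add: field_simps)
    have z0: "z \<noteq> 0" using z e(3) nsd by auto
    show "z \<in> {0} \<union> {of_real r * d | r d. 0 < r \<and> r < 1 \<and> d \<in> R} \<longleftrightarrow> Im ((z - of_real s * d) / d) = 0"
    proof
      assume "z \<in> {0} \<union> {of_real r * d | r d. 0 < r \<and> r < 1 \<and> d \<in> R}"
      then obtain r d' where r: "0 < r" "d' \<in> R" "z = of_real r * d'" using z0 by auto
      have "dist (sgn z) d < \<delta>" using e1(2)[of z] z e(2) by (simp add: dist_commute)
      hence "d' = d" using \<delta>(2) r sgn[OF r(1,2)] by (metis dist_commute not_le)
      thus "Im ((z - of_real s * d) / d) = 0" unfolding za using r nd by simp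
    next
      assume "Im ((z - of_real s * d) / d) = 0"
      hence "z / d = of_real (Re (z / d))" unfolding za by (simp add: complex_eq_iff)
      hence zd: "z = of_real (Re (z / d)) * d" using nd by (simp add: field_simps)
      have "norm ((z - of_real s * d) / d) < e" using z nd by (simp add: norm_divide dist_norm norm_minus_commute)
      hence "\<bar>Re (z / d) - s\<bar> < e" unfolding za using abs_Re_le_cmod[of "z / d - of_real s"] by simp
      hence pos: "Re (z / d) > 0" using e(3) by linarith
      have "norm z = Re (z / d)" by (subst zd) (use pos nd in \<open>simp add: norm_mult\<close>)
      hence "Re (z / d) < 1" using sub[OF z] by simp
      thus "z \<in> {0} \<union> {of_real r * d | r d. 0 < r \<and> r < 1 \<and> d \<in> R}" using zd pos d by blast
    qed
  qed
qed

section \<open>Charts along an arrow\<close>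

text \<open>\<open>no_loops\<close> is what acyclicity contributes: an arrow at a vertex has exactly
  one end there, so the arrows at a vertex can be matched with the rays of its chart.\<close>

locale embedded_quiver = fin_digraph G
  for G :: "('v, 'e) pre_digraph" +
  fixes S :: "'s topology" and A :: "'s chart set"
    and pos :: "'v \<Rightarrow> 's" and crv :: "'e \<Rightarrow> real \<Rightarrow> 's"
  assumes connected_S: "connected_space S" and Hausdorff_S: "Hausdorff_space S"
    and orientation_A: "orientation_of S A"
    and embedding: "quiver_embedding G S A pos crv"
    and no_loops: "p \<in> arcs G \<Longrightarrow> tail G p \<noteq> head G p"
    and verts_nonempty: "verts G \<noteq> {}"
begin

abbreviation \<Gamma> :: "'s set" where "\<Gamma> \<equiv> embedded_graph G pos crv"

abbreviation \<F> :: "'s set set" where "\<F> \<equiv> faces G S pos crv"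

lemma ex_chart: "x \<in> topspace S \<Longrightarrow> \<exists>U \<phi>. (U, \<phi>) \<in> A \<and> x \<in> U"
proof -
  assume "x \<in> topspace S"
  hence "x \<in> (\<Union>c\<in>A. fst c)" using orientation_A by (simp add: orientation_of_def)
  thus ?thesis by auto
qed

context
  fixes U \<phi> assumes chart: "(U, \<phi>) \<in> A"
begin

lemma chart_openin: "openin S U"
  and chart_open: "open (\<phi> ` U)"
  and chart_homeomorphic: "homeomorphic_map (subtopology S U) (top_of_set (\<phi> ` U)) \<phi>"
  using orientation_A chart unfolding orientation_of_def chart_on_def by fastforce+

lemma chart_subset: "U \<subseteq> topspace S"
  using chart_openin openin_subset by blast

lemma chart_inj: "inj_on \<phi> U"
  using homeomorphic_imp_injective_map[OF chart_homeomorphic] chart_subset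
  by (simp add: inf.absorb2)

lemma chart_continuous: "continuous_map (subtopology S U) euclidean \<phi>"
  using homeomorphic_imp_continuous_map[OF chart_homeomorphic]
  by (simp add: continuous_map_in_subtopology)

lemma chart_inverse_continuous: "continuous_map (top_of_set (\<phi> ` U)) S (inv_into U \<phi>)"
proof -
  obtain g where g: "homeomorphic_maps (subtopology S U) (top_of_set (\<phi> ` U)) \<phi> g"
    using chart_homeomorphic homeomorphic_map_maps by blast
  hence "continuous_map (top_of_set (\<phi> ` U)) (subtopology S U) g"
    by (simp add: homeomorphic_maps_def)
  moreover have "g z = inv_into U \<phi> z" if "z \<in> \<phi> ` U" for z
    using g that chart_inj chart_subset by (force simp: homeomorphic_maps_def inv_into_f_f)
  ultimately have "continuous_map (top_of_set (\<phi> ` U)) (subtopology S U) (inv_into U \<phi>)"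
    using continuous_map_eq[of "top_of_set (\<phi> ` U)" _ g] by force
  thus ?thesis by (simp add: continuous_map_in_subtopology)
qed

lemma chart_vimage_open: "open W \<Longrightarrow> openin S (U \<inter> \<phi> -` W)"
proof -
  assume "open W"
  hence "openin (subtopology S U) {x \<in> topspace (subtopology S U). \<phi> x \<in> W}"
    using openin_continuous_map_preimage[OF chart_continuous] by simp
  moreover have "{x \<in> topspace (subtopology S U). \<phi> x \<in> W} = U \<inter> \<phi> -` W"
    using chart_subset by auto
  ultimately show ?thesis using openin_trans_full[OF _ chart_openin] by metis
qed

lemma chart_image_open: "openin S N \<Longrightarrow> open (\<phi> ` (U \<inter> N))"
proof -
  assume N: "openin S N"
  hence "openin (subtopology S U) (U \<inter> N)" by (auto simp: openin_subtopology)
  hence "openin (top_of_set (\<phi> ` U)) (\<phi> ` (U \<inter> N))"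
    using homeomorphic_imp_open_map[OF chart_homeomorphic] by (simp add: open_map_def)
  thus ?thesis using chart_open openin_open_eq by blast
qed

lemma chart_inverse_image: "K \<subseteq> \<phi> ` U \<Longrightarrow> inv_into U \<phi> ` K = U \<inter> \<phi> -` K"
proof (intro equalityI subsetI)
  fix x assume "x \<in> U \<inter> \<phi> -` K"
  thus "x \<in> inv_into U \<phi> ` K"
    using chart_inj by (intro image_eqI[of _ _ "\<phi> x"]) auto
qed (auto intro: inv_into_into simp: f_inv_into_f subset_iff)

lemma chart_vimage_connected:
  assumes "connected K" "K \<subseteq> \<phi> ` U"
  shows "connectedin S (U \<inter> \<phi> -` K)"
proof -
  note chart_inverse_image[OF assms(2)]
  moreover have "connectedin (top_of_set (\<phi> ` U)) K"
    using assms by (simp add: connectedin_subtopology)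
  ultimately show ?thesis using connectedin_continuous_map_image[OF chart_inverse_continuous] by metis
qed

lemma chart_vimage_compact:
  assumes "compact K" "K \<subseteq> \<phi> ` U"
  shows "closedin S (U \<inter> \<phi> -` K)"
proof -
  note chart_inverse_image[OF assms(2)]
  moreover have "compactin (top_of_set (\<phi> ` U)) K"
    using assms by (simp add: compactin_subtopology)
  ultimately have "compactin S (U \<inter> \<phi> -` K)"
    using image_compactin[OF _ chart_inverse_continuous] by metis
  thus ?thesis using Hausdorff_S compactin_imp_closedin by blast
qed

end

section \<open>The embedded graph and its faces\<close>

lemmas embeddingD = embedding[unfolded quiver_embedding_def]

lemma pos_in_topspace: "v \<in> verts G \<Longrightarrow> pos v \<in> topspace S"
  using embeddingD[THEN conjunct1] by blast

lemmas pos_inj = embeddingD[THEN conjunct2, THEN conjunct1]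

lemma crv_path: "p \<in> arcs G \<Longrightarrow> pathin S (crv p)"
  and crv_0: "p \<in> arcs G \<Longrightarrow> crv p 0 = pos (tail G p)"
  and crv_1: "p \<in> arcs G \<Longrightarrow> crv p 1 = pos (head G p)"
  and crv_inj: "p \<in> arcs G \<Longrightarrow> inj_on (crv p) {0<..<1}"
  using embeddingD[THEN conjunct2, THEN conjunct2, THEN conjunct1] by simp_all

lemma crv_not_pos: "p \<in> arcs G \<Longrightarrow> t \<in> {0<..<1} \<Longrightarrow> crv p t \<notin> pos ` verts G"
  using embeddingD[THEN conjunct2, THEN conjunct2, THEN conjunct1] by fast

lemma crv_disjoint:
  "p \<in> arcs G \<Longrightarrow> q \<in> arcs G \<Longrightarrow> p \<noteq> q \<Longrightarrow> s \<in> {0<..<1} \<Longrightarrow> t \<in> {0<..<1} \<Longrightarrow> crv p s \<noteq> crv q t"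
  using embeddingD[THEN conjunct2, THEN conjunct2, THEN conjunct2, THEN conjunct1] by fast

lemmas ex_arrow_chart =
  embeddingD[THEN conjunct2, THEN conjunct2, THEN conjunct2, THEN conjunct2, THEN conjunct1, rule_format]
lemmas ex_vertex_chart =
  embeddingD[THEN conjunct2, THEN conjunct2, THEN conjunct2, THEN conjunct2, THEN conjunct2, rule_format]

lemma crv_in_graph: "p \<in> arcs G \<Longrightarrow> t \<in> {0..1} \<Longrightarrow> crv p t \<in> \<Gamma>"
  unfolding embedded_graph_def by blast

lemma pos_in_graph: "v \<in> verts G \<Longrightarrow> pos v \<in> \<Gamma>"
  by (auto simp: embedded_graph_def)

lemma graph_cases:
  assumes "x \<in> \<Gamma>"
  obtains v where "v \<in> verts G" "x = pos v"
  | p t where "p \<in> arcs G" "t \<in> {0<..<1}" "x = crv p t"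
proof -
  from assms consider "x \<in> pos ` verts G" | p t where "p \<in> arcs G" "t \<in> {0..1}" "x = crv p t"
    by (auto simp: embedded_graph_def)
  thus thesis
  proof cases
    case 1 thus thesis using that(1) by blast
  next
    case (2 p t)
    consider "t = 0" | "t = 1" | "t \<in> {0<..<1}" using 2(2) by fastforce
    thus thesis using 2 that crv_0 crv_1 by cases (metis tail_in_verts head_in_verts)+
  qed
qed

lemma crv_closedin:
  assumes "p \<in> arcs G" "closed K" "K \<subseteq> {0..1}"
  shows "closedin S (crv p ` K)"
proof -
  have "compact K" using assms(2,3) by (meson bounded_subset bounded_closed_interval compact_eq_bounded_closed)
  hence "compactin (top_of_set {0..1}) K"
    using assms(3) by (simp add: compactin_subtopology)
  hence "compactin S (crv p ` K)"
    using crv_path[OF assms(1)] image_compactin by (auto simp: pathin_def)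
  thus ?thesis using Hausdorff_S compactin_imp_closedin by blast
qed

lemma graph_closedin: "closedin S \<Gamma>"
proof -
  have "closedin S (pos ` verts G)"
    using pos_in_topspace by (intro closedin_Hausdorff_finite[OF Hausdorff_S]) auto
  moreover have "closedin S (\<Union>p\<in>arcs G. crv p ` {0..1})"
    using crv_closedin by (intro closedin_Union) auto
  ultimately show ?thesis unfolding embedded_graph_def by (rule closedin_Un)
qed

lemma face_absorbs:
  assumes "f \<in> \<F>" "connectedin S K" "K \<inter> \<Gamma> = {}" "K \<inter> f \<noteq> {}"
  shows "K \<subseteq> f"
proof -
  have "connectedin (subtopology S (topspace S - \<Gamma>)) K"
    using assms(2,3) connectedin_subset_topspace[OF assms(2)] by (auto simp: connectedin_subtopology)
  thus ?thesis using assms(1,4) connected_components_of_maximal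
    unfolding faces_def by (metis disjnt_def inf_commute)
qed

lemma faces_disjoint: "f \<in> \<F> \<Longrightarrow> f' \<in> \<F> \<Longrightarrow> x \<in> f \<Longrightarrow> x \<in> f' \<Longrightarrow> f = f'"
  using pairwise_disjoint_connected_components_of unfolding faces_def
  by (metis disjnt_iff pairwiseD)

lemma ex_face_at: "x \<in> topspace S \<Longrightarrow> x \<notin> \<Gamma> \<Longrightarrow> \<exists>f\<in>\<F>. x \<in> f"
  using Union_connected_components_of[of "subtopology S (topspace S - \<Gamma>)"] unfolding faces_def by auto

lemma face_subset: "f \<in> \<F> \<Longrightarrow> f \<subseteq> topspace S - \<Gamma>"
  using connected_components_of_subset unfolding faces_def by fastforce

lemma face_nonempty: "f \<in> \<F> \<Longrightarrow> f \<noteq> {}"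
  using nonempty_connected_components_of unfolding faces_def by blast

lemma ex_face_containing:
  assumes "connectedin S K" "K \<inter> \<Gamma> = {}" "K \<noteq> {}"
  shows "\<exists>f\<in>\<F>. K \<subseteq> f"
proof -
  from assms(3) obtain x where "x \<in> K" by auto
  moreover from this obtain f where "f \<in> \<F>" "x \<in> f"
    using ex_face_at assms connectedin_subset_topspace by blast
  ultimately show ?thesis using face_absorbs[OF _ assms(1,2)] by blast
qed

text \<open>Near \<open>crv p t\<close> the chart shows the graph as a straight line in direction \<open>d\<close>.\<close>

definition flat_chart :: "'e \<Rightarrow> real \<Rightarrow> 's set \<Rightarrow> ('s \<Rightarrow> complex) \<Rightarrow> complex \<Rightarrow> real \<Rightarrow> bool" where
  "flat_chart p t U \<phi> d e \<longleftrightarrow>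
     (U, \<phi>) \<in> A \<and> p \<in> arcs G \<and> t \<in> {0<..<1} \<and> crv p t \<in> U \<and> norm d = 1 \<and> 0 < e \<and>
     ball (\<phi> (crv p t)) e \<subseteq> \<phi> ` U \<and>
     (\<forall>x\<in>U. \<phi> x \<in> ball (\<phi> (crv p t)) e \<longrightarrow> (x \<in> \<Gamma> \<longleftrightarrow> Im ((\<phi> x - \<phi> (crv p t)) / d) = 0))"

text \<open>As long as the curve stays in the flat ball it runs in the graph, that is, on the line,
  so one real coordinate describes it. Injectivity of the chart and of the curve makes this
  coordinate injective, and therefore monotone.\<close>

lemma flat_chart_coordinate:
  assumes "flat_chart p t U \<phi> d e"
  defines "\<beta> \<equiv> \<lambda>s. Re ((\<phi> (crv p s) - \<phi> (crv p t)) / d)"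
  obtains \<delta> where "\<delta> > 0" "{t - \<delta><..<t + \<delta>} \<subseteq> {0<..<1}"
    "\<And>s. s \<in> {t - \<delta><..<t + \<delta>} \<Longrightarrow> crv p s \<in> U \<and> \<phi> (crv p s) = \<phi> (crv p t) + of_real (\<beta> s) * d"
    "continuous_on {t - \<delta><..<t + \<delta>} \<beta>" "inj_on \<beta> {t - \<delta><..<t + \<delta>}"
proof -
  note fc = assms(1)[unfolded flat_chart_def]
  have p: "p \<in> arcs G" and UA: "(U, \<phi>) \<in> A" and d: "d \<noteq> 0" using fc by auto
  let ?V = "U \<inter> \<phi> -` ball (\<phi> (crv p t)) e"
  have "openin S ?V" by (rule chart_vimage_open[OF UA]) simp
  hence "openin (top_of_set {0..1}) {s \<in> topspace (top_of_set {0..1}). crv p s \<in> ?V}"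
    by (rule openin_continuous_map_preimage[OF crv_path[OF p, unfolded pathin_def]])
  hence "openin (top_of_set {0..1}) {s \<in> {0..1}. crv p s \<in> ?V}"
    by (simp only: topspace_euclidean_subtopology)
  then obtain W where W: "open W" "{s \<in> {0..1}. crv p s \<in> ?V} = {0..1} \<inter> W"
    by (auto simp: openin_open)
  have "t \<in> W \<inter> {0<..<1}" using W(2) fc by auto
  moreover have "open (W \<inter> {0<..<1})" using W(1) by auto
  ultimately obtain \<delta> where \<delta>: "\<delta> > 0" "ball t \<delta> \<subseteq> W \<inter> {0<..<1}"
    using open_contains_ball by blast
  let ?I = "{t - \<delta><..<t + \<delta>}"
  have I: "s \<in> W" "s \<in> {0<..<1}" if "s \<in> ?I" for s
    using that \<delta>(2) by (auto simp: ball_eq_greaterThanLessThan)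
  have V: "crv p s \<in> ?V" if "s \<in> ?I" for s
  proof -
    have "s \<in> {s \<in> {0..1}. crv p s \<in> ?V}" unfolding W(2) using I[OF that] by auto
    thus ?thesis by blast
  qed
  have cU: "crv p s \<in> U \<and> \<phi> (crv p s) = \<phi> (crv p t) + of_real (\<beta> s) * d" if "s \<in> ?I" for s
  proof -
    have "crv p s \<in> \<Gamma>" using I(2)[OF that] p by (intro crv_in_graph) auto
    hence "Im ((\<phi> (crv p s) - \<phi> (crv p t)) / d) = 0" using V[OF that] fc by blast
    hence "(\<phi> (crv p s) - \<phi> (crv p t)) / d = of_real (\<beta> s)" by (simp add: \<beta>_def complex_eq_iff)
    thus ?thesis using d V[OF that] by (auto simp: field_simps)
  qed
  have "continuous_on ?I (\<phi> \<circ> crv p)"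
  proof -
    have "continuous_map (top_of_set ?I) (subtopology S U) (crv p)"
      unfolding continuous_map_in_subtopology
    proof
      show "continuous_map (top_of_set ?I) S (crv p)"
        by (rule continuous_map_from_subtopology_mono[OF crv_path[OF p, unfolded pathin_def]])
           (use I(2) in force)
    qed (use V in auto)
    hence "continuous_map (top_of_set ?I) euclidean (\<phi> \<circ> crv p)"
      using chart_continuous[OF UA] continuous_map_compose by blast
    thus ?thesis by simp
  qed
  hence "continuous_on ?I \<beta>"
    unfolding \<beta>_def o_def by (intro continuous_intros) (use d in auto)
  moreover have "inj_on \<beta> ?I"
  proof (rule inj_onI)
    fix s s' assume s: "s \<in> ?I" "s' \<in> ?I" "\<beta> s = \<beta> s'"
    hence "\<phi> (crv p s) = \<phi> (crv p s')" using cU by metis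
    hence "crv p s = crv p s'" using chart_inj[OF UA] cU s by (meson inj_onD)
    thus "s = s'" using crv_inj[OF p] I(2) s by (meson inj_onD)
  qed
  ultimately show thesis using that[of \<delta>] \<delta>(1) cU I(2) by blast
qed

text \<open>The unit vector \<open>d\<close> is the direction of travel. An arrow chart only records
  a positive real part to the right of \<open>t\<close>; monotonicity on an interval is stronger in
  form and passes on to nearby parameters.\<close>

definition directed_chart :: "'e \<Rightarrow> real \<Rightarrow> 's set \<Rightarrow> ('s \<Rightarrow> complex) \<Rightarrow> complex \<Rightarrow> real \<Rightarrow> bool" where
  "directed_chart p t U \<phi> d e \<longleftrightarrow> flat_chart p t U \<phi> d e \<and>
     (\<exists>\<delta>>0. \<forall>s s'. t - \<delta> < s \<longrightarrow> s < s' \<longrightarrow> s' < t + \<delta> \<longrightarrow> Re (\<phi> (crv p s) / d) < Re (\<phi> (crv p s') / d))"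

text \<open>The coordinate along the line is strictly monotone near \<open>t\<close>, so information
  on one side of \<open>t\<close> decides whether it increases. Arrow charts and arrows ending at a
  vertex provide it to the right of \<open>t\<close>, arrows starting at a vertex to the
  left.\<close>

lemma directed_chartI:
  assumes fc: "flat_chart p t U \<phi> d e"
    and dir: "(\<forall>\<^sub>F s in at_right t. Re (\<phi> (crv p s) / d) > Re (\<phi> (crv p t) / d)) \<or>
              (\<forall>\<^sub>F s in at_left t. Re (\<phi> (crv p s) / d) < Re (\<phi> (crv p t) / d))"
  shows "directed_chart p t U \<phi> d e"
proof -
  let ?b = "\<lambda>s. Re ((\<phi> (crv p s) - \<phi> (crv p t)) / d)"
  obtain \<delta> where \<delta>: "\<delta> > 0" "continuous_on {t - \<delta><..<t + \<delta>} ?b" "inj_on ?b {t - \<delta><..<t + \<delta>}"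
    using flat_chart_coordinate[OF fc] by metis
  let ?I = "{t - \<delta><..<t + \<delta>}"
  have b: "?b s < ?b s' \<longleftrightarrow> Re (\<phi> (crv p s) / d) < Re (\<phi> (crv p s') / d)" for s s'
    by (simp add: diff_divide_distrib)
  have "(\<forall>x\<in>?I. \<forall>y\<in>?I. x < y \<longrightarrow> ?b x < ?b y) \<or> (\<forall>x\<in>?I. \<forall>y\<in>?I. x < y \<longrightarrow> ?b y < ?b x)"
    by (rule continuous_inj_on_strict_mono_cases) (use \<delta> in auto)
  moreover have False if *: "\<forall>x\<in>?I. \<forall>y\<in>?I. x < y \<longrightarrow> ?b y < ?b x"
    using dir
  proof
    assume "\<forall>\<^sub>F s in at_right t. Re (\<phi> (crv p s) / d) > Re (\<phi> (crv p t) / d)"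
    moreover have "\<forall>\<^sub>F s in at_right t. s \<in> {t<..<t + \<delta>}"
      using \<delta>(1) by (intro eventually_at_right_real) simp
    ultimately have "\<forall>\<^sub>F s in at_right t. False"
    proof eventually_elim
      case (elim s)
      hence "s \<in> ?I" "t \<in> ?I" "t < s" using \<delta>(1) by auto
      hence "?b s < ?b t" using * by blast
      thus False using elim(1) b by (metis order_less_asym)
    qed
    thus False by simp
  next
    assume "\<forall>\<^sub>F s in at_left t. Re (\<phi> (crv p s) / d) < Re (\<phi> (crv p t) / d)"
    moreover have "\<forall>\<^sub>F s in at_left t. s \<in> {t - \<delta><..<t}"
      using \<delta>(1) by (intro eventually_at_left_real) simp
    ultimately have "\<forall>\<^sub>F s in at_left t. False"
    proof eventually_elim
      case (elim s)
      hence "s \<in> ?I" "t \<in> ?I" "s < t" using \<delta>(1) by auto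
      hence "?b t < ?b s" using * by blast
      thus False using elim(1) b by (metis order_less_asym)
    qed
    thus False by simp
  qed
  ultimately have "\<forall>x\<in>?I. \<forall>y\<in>?I. x < y \<longrightarrow> ?b x < ?b y" by blast
  hence "\<forall>s s'. t - \<delta> < s \<longrightarrow> s < s' \<longrightarrow> s' < t + \<delta> \<longrightarrow> Re (\<phi> (crv p s) / d) < Re (\<phi> (crv p s') / d)"
    unfolding b by auto
  thus ?thesis using fc \<delta>(1) unfolding directed_chart_def by blast
qed

definition half_disc :: "real \<Rightarrow> 'e \<Rightarrow> real \<Rightarrow> 's set \<Rightarrow> ('s \<Rightarrow> complex) \<Rightarrow> complex \<Rightarrow> real \<Rightarrow> 's set" where
  "half_disc \<sigma> p t U \<phi> d e =
     {x \<in> U. \<phi> x \<in> ball (\<phi> (crv p t)) e \<and> \<sigma> * Im ((\<phi> x - \<phi> (crv p t)) / d) > 0}"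

text \<open>The transition map satisfies \<open>sides_preserved\<close> on a small disc: points off
  the graph stay off the graph, the winding number is 1 by compatibility of the charts in
  \<open>A\<close>, and the diameter has its ends on the arrow. So a point just beside the arrow is
  on the side \<open>\<sigma>\<close> in both charts.\<close>

lemma half_disc_meet:
  assumes dc: "directed_chart p t U \<phi> d e" and dc': "directed_chart p t U' \<psi> 1 e'"
    and \<sigma>: "\<sigma> = 1 \<or> \<sigma> = -1"
  shows "half_disc \<sigma> p t U \<phi> d e \<inter> half_disc \<sigma> p t U' \<psi> 1 e' \<noteq> {}"
proof -
  have fc: "flat_chart p t U \<phi> d e" and fc': "flat_chart p t U' \<psi> 1 e'"
    using dc dc' by (auto simp: directed_chart_def)
  note f = fc[unfolded flat_chart_def] and f' = fc'[unfolded flat_chart_def]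
  have UA: "(U, \<phi>) \<in> A" and UA': "(U', \<psi>) \<in> A" and d: "d \<noteq> 0" using f f' by auto
  let ?z = "\<phi> (crv p t)" and ?w = "\<psi> (crv p t)"
  let ?b = "\<lambda>s. Re ((\<phi> (crv p s) - ?z) / d)"
  obtain \<delta> where \<delta>: "\<delta> > 0" "{t - \<delta><..<t + \<delta>} \<subseteq> {0<..<1}"
    "\<And>s. s \<in> {t - \<delta><..<t + \<delta>} \<Longrightarrow> crv p s \<in> U \<and> \<phi> (crv p s) = ?z + of_real (?b s) * d"
    "continuous_on {t - \<delta><..<t + \<delta>} ?b"
    using flat_chart_coordinate[OF fc] by metis
  obtain \<delta>2 where \<delta>2: "\<delta>2 > 0"
    "\<And>s. s \<in> {t - \<delta>2<..<t + \<delta>2} \<Longrightarrow> crv p s \<in> U' \<and>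
       \<psi> (crv p s) = ?w + of_real (Re ((\<psi> (crv p s) - ?w) / 1)) * 1"
    using flat_chart_coordinate[OF fc'] by metis
  obtain \<delta>3 where \<delta>3: "\<delta>3 > 0"
    "\<And>s s'. t - \<delta>3 < s \<Longrightarrow> s < s' \<Longrightarrow> s' < t + \<delta>3 \<Longrightarrow> Re (\<phi> (crv p s) / d) < Re (\<phi> (crv p s') / d)"
    using dc unfolding directed_chart_def by blast
  obtain \<delta>4 where \<delta>4: "\<delta>4 > 0"
    "\<And>s s'. t - \<delta>4 < s \<Longrightarrow> s < s' \<Longrightarrow> s' < t + \<delta>4 \<Longrightarrow> Re (\<psi> (crv p s)) < Re (\<psi> (crv p s'))"
    using dc' unfolding directed_chart_def by auto
  define \<eta> where "\<eta> = min (min \<delta> \<delta>2) (min \<delta>3 \<delta>4) / 2"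
  have \<eta>: "\<eta> > 0" "\<eta> < \<delta>" "\<eta> < \<delta>2" "\<eta> < \<delta>3" "\<eta> < \<delta>4"
    using \<delta>(1) \<delta>2(1) \<delta>3(1) \<delta>4(1) by (auto simp: \<eta>_def min_def)
  let ?N = "U' \<inter> \<psi> -` ball ?w e'"
  have "openin S ?N" by (rule chart_vimage_open[OF UA']) simp
  hence "open (\<phi> ` (U \<inter> ?N) \<inter> ball ?z e)" using chart_image_open[OF UA] by auto
  moreover have "?z \<in> \<phi> ` (U \<inter> ?N) \<inter> ball ?z e" using f f' by auto
  ultimately obtain r0 where r0: "r0 > 0" "cball ?z r0 \<subseteq> \<phi> ` (U \<inter> ?N) \<inter> ball ?z e"
    using open_contains_cball by blast
  have mono: "?b s < ?b s'" if "t - \<eta> \<le> s" "s < s'" "s' \<le> t + \<eta>" for s s'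
    using \<delta>3(2)[of s s'] that \<eta> by (simp add: diff_divide_distrib)
  \<comment> \<open>The ends of the diameter must be points of the arrow. Hence \<open>r\<close> is
    at most the distance covered by the curve in either direction, and the intermediate value
    theorem yields their parameters \<open>s1\<close> and \<open>s2\<close>; \<open>r0\<close> keeps
    the disc inside both charts.\<close>
  define r where "r = min r0 (min (?b (t + \<eta>)) (- ?b (t - \<eta>)))"
  have r: "r > 0" "r \<le> r0" "r \<le> ?b (t + \<eta>)" "- r \<ge> ?b (t - \<eta>)"
    using r0(1) mono[of t "t + \<eta>"] mono[of "t - \<eta>" t] \<eta>(1) by (auto simp: r_def)
  have sub: "cball ?z r \<subseteq> \<phi> ` (U \<inter> ?N) \<inter> ball ?z e"
    using r0(2) r(2) by (meson order_trans subset_cball)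
  have "continuous_on {t..t + \<eta>} ?b" "continuous_on {t - \<eta>..t} ?b"
    using \<eta> by (auto intro!: continuous_on_subset[OF \<delta>(4)])
  then obtain s1 s2 where s1: "t \<le> s1" "s1 \<le> t + \<eta>" "?b s1 = r" and s2: "t - \<eta> \<le> s2" "s2 \<le> t" "?b s2 = - r"
    using IVT'[of ?b t r "t + \<eta>"] IVT'[of ?b "t - \<eta>" "- r" t] r \<eta>(1) by auto
  have s1': "t < s1" and s2': "s2 < t" using s1 s2 r(1) by (auto simp: le_less)
  have \<phi>s: "crv p s1 \<in> U" "\<phi> (crv p s1) = ?z + of_real r * d" "crv p s2 \<in> U" "\<phi> (crv p s2) = ?z - of_real r * d"
    using \<delta>(3)[of s1] \<delta>(3)[of s2] s1 s2 \<eta> by auto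
  define h where "h = \<psi> \<circ> inv_into U \<phi>"
  have h: "h (\<phi> x) = \<psi> x" if "x \<in> U" for x
    using that chart_inj[OF UA] by (simp add: h_def)
  have cont: "continuous_on (cball ?z r) h"
  proof -
    have "continuous_map (top_of_set (cball ?z r)) (subtopology S U') (inv_into U \<phi>)"
      unfolding continuous_map_in_subtopology
    proof
      show "continuous_map (top_of_set (cball ?z r)) S (inv_into U \<phi>)"
        by (rule continuous_map_from_subtopology_mono[OF chart_inverse_continuous[OF UA]]) (use sub in auto)
      show "inv_into U \<phi> \<in> topspace (top_of_set (cball ?z r)) \<rightarrow> U'"
        using sub chart_inj[OF UA] by (fastforce simp: inv_into_f_f)
    qed
    hence "continuous_map (top_of_set (cball ?z r)) euclidean h"
      unfolding h_def using chart_continuous[OF UA'] continuous_map_compose by blast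
    thus ?thesis by simp
  qed
  have wn: "winding_number (h \<circ> circlepath ?z r) (h ?z) = 1"
  proof -
    have "\<forall>c\<in>A. \<forall>d\<in>A. charts_compatible c d" using orientation_A unfolding orientation_of_def by fast
    hence "charts_compatible (U, \<phi>) (U', \<psi>)" using UA UA' by blast
    hence "orientation_preserving_on (\<psi> \<circ> inv_into U \<phi>) (\<phi> ` (U \<inter> U'))"
      by (simp add: charts_compatible_def)
    moreover have "cball ?z r \<subseteq> \<phi> ` (U \<inter> U')" using sub by blast
    ultimately show ?thesis using r(1) unfolding orientation_preserving_on_def h_def by simp
  qed
  have off: "Im (h z) \<noteq> Im (h ?z)" if "z \<in> cball ?z r" "Im ((z - ?z) / d) \<noteq> 0" for z
  proof -
    have "z \<in> \<phi> ` (U \<inter> ?N)" "z \<in> ball ?z e" using that(1) sub by blast+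
    then obtain x where x: "x \<in> U" "x \<in> ?N" "z = \<phi> x" "\<phi> x \<in> ball ?z e" by blast
    hence "x \<notin> \<Gamma>" using f that(2) by blast
    thus ?thesis using x f' f h by auto
  qed
  have psi: "Im (\<psi> (crv p s)) = Im ?w" if "s \<in> {t - \<eta>..t + \<eta>}" for s
    using \<delta>2(2)[of s] that \<eta> by (simp add: complex_eq_iff)
  have h0: "h ?z = ?w" using h f by simp
  \<comment> \<open>The point beside the arrow: distance \<open>r / 2\<close>, perpendicular to
    \<open>d\<close>, on the side \<open>\<sigma>\<close>.\<close>
  define z where "z = ?z + of_real (\<sigma> * r / 2) * \<i> * d"
  have za: "Im ((z - ?z) / d) = \<sigma> * r / 2" using d by (simp add: z_def)
  have z: "z \<in> cball ?z r"
    using \<sigma> r(1) f by (auto simp: z_def dist_norm norm_mult norm_divide)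
  have ends: "Im (h (?z + of_real r * d)) = Im (h ?z)" "Re (h (?z + of_real r * d)) > Re (h ?z)"
    "Im (h (?z - of_real r * d)) = Im (h ?z)" "Re (h (?z - of_real r * d)) < Re (h ?z)"
    using h[OF \<phi>s(1)] h[OF \<phi>s(3)] psi[of s1] psi[of s2] h0 \<phi>s s1 s2 s1' s2' \<eta> \<delta>4(2)[of t s1] \<delta>4(2)[of s2 t]
    by auto
  have nd: "norm d = 1" using f by simp
  note sides = sides_preserved[OF r(1) nd cont wn off ends z]
  have pos: "\<sigma> * (Im (h z) - Im ?w) > 0"
    using \<sigma> sides za r(1) h0 by auto
  have "z \<in> \<phi> ` (U \<inter> ?N)" "z \<in> ball ?z e" using z sub by blast+
  then obtain x where x: "x \<in> U" "x \<in> ?N" "z = \<phi> x" "\<phi> x \<in> ball ?z e" by blast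
  have "x \<in> half_disc \<sigma> p t U \<phi> d e"
    using x \<sigma> r(1) za[unfolded x(3)] unfolding half_disc_def by auto
  moreover have "x \<in> half_disc \<sigma> p t U' \<psi> 1 e'"
    using x pos h[OF x(1)] by (auto simp: half_disc_def)
  ultimately show ?thesis by blast
qed

section \<open>The two sides of an arrow\<close>

lemma
  assumes fc: "flat_chart p t U \<phi> d e" and \<sigma>: "\<sigma> = 1 \<or> \<sigma> = -1"
  shows half_disc_connected: "connectedin S (half_disc \<sigma> p t U \<phi> d e)"
    and half_disc_Int_graph: "half_disc \<sigma> p t U \<phi> d e \<inter> \<Gamma> = {}"
    and half_disc_nonempty: "half_disc \<sigma> p t U \<phi> d e \<noteq> {}"
proof -
  note f = fc[unfolded flat_chart_def]
  have UA: "(U, \<phi>) \<in> A" and d: "d \<noteq> 0" using f by auto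
  let ?z = "\<phi> (crv p t)"
  let ?K = "ball ?z e \<inter> {z. \<sigma> * Im ((z - ?z) / d) > 0}"
  have "half_disc \<sigma> p t U \<phi> d e = U \<inter> \<phi> -` ?K" by (auto simp: half_disc_def)
  moreover have "connectedin S (U \<inter> \<phi> -` ?K)"
    using f by (intro chart_vimage_connected[OF UA] convex_connected convex_Int convex_side) auto
  ultimately show "connectedin S (half_disc \<sigma> p t U \<phi> d e)" by simp
  show "half_disc \<sigma> p t U \<phi> d e \<inter> \<Gamma> = {}"
    using f by (fastforce simp: half_disc_def)
  let ?y = "?z + of_real (\<sigma> * e / 2) * \<i> * d"
  have "?y \<in> ball ?z e" using \<sigma> f by (auto simp: dist_norm norm_mult norm_divide)
  then obtain x where "x \<in> U" "\<phi> x = ?y" "?y \<in> ball ?z e" using f by (metis imageE subsetD)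
  moreover have "Im ((?y - ?z) / d) = \<sigma> * e / 2" using d by simp
  ultimately have "x \<in> half_disc \<sigma> p t U \<phi> d e"
    using \<sigma> f by (auto simp: half_disc_def)
  thus "half_disc \<sigma> p t U \<phi> d e \<noteq> {}" by blast
qed

lemma arrow_chart_graph_iff:
  assumes "arrow_chart A G pos crv p t U \<phi>" "x \<in> U"
  shows "x \<in> \<Gamma> \<longleftrightarrow> Im (\<phi> x) = 0"
proof
  have a: "(U, \<phi>) \<in> A" "\<phi> ` U = ball 0 1" "\<phi> ` (U \<inter> \<Gamma>) = {z \<in> ball 0 1. Im z = 0}"
    using assms(1) by (auto simp: arrow_chart_def)
  show "Im (\<phi> x) = 0" if "x \<in> \<Gamma>" using that assms(2) a(3) by blast
  assume "Im (\<phi> x) = 0"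
  hence "\<phi> x \<in> \<phi> ` (U \<inter> \<Gamma>)" using a assms(2) by blast
  then obtain y where "y \<in> U" "y \<in> \<Gamma>" "\<phi> x = \<phi> y" by auto
  thus "x \<in> \<Gamma>" using chart_inj[OF a(1)] assms(2) by (metis inj_onD)
qed

lemma
  assumes "p \<in> arcs G" "t \<in> {0<..<1}" "arrow_chart A G pos crv p t U \<phi>"
  shows arrow_chart_directed: "directed_chart p t U \<phi> 1 1"
    and arrow_chart_half_disc: "half_disc \<sigma> p t U \<phi> 1 1 = {x \<in> U. \<sigma> * Im (\<phi> x) > 0}"
proof -
  have a: "(U, \<phi>) \<in> A" "\<phi> ` U = ball 0 1" "crv p t \<in> U" "\<phi> (crv p t) = 0"
    "\<forall>\<^sub>F s in at_right t. 0 < Re (\<phi> (crv p s))"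
    using assms(3) by (auto simp: arrow_chart_def)
  have "flat_chart p t U \<phi> 1 1"
    using assms a arrow_chart_graph_iff[OF assms(3)] by (auto simp: flat_chart_def)
  thus "directed_chart p t U \<phi> 1 1"
    by (rule directed_chartI) (use a in auto)
  show "half_disc \<sigma> p t U \<phi> 1 1 = {x \<in> U. \<sigma> * Im (\<phi> x) > 0}"
    using a by (auto simp: half_disc_def)
qed

text \<open>A nearby point of the arrow lies on the same line of the same chart, so a smaller ball
  around it works with the same direction and has the same sides.\<close>

lemma directed_chart_shift:
  assumes dc: "directed_chart p t U \<phi> d e"
  obtains \<delta> where "\<delta> > 0"
    "\<And>s. \<bar>s - t\<bar> < \<delta> \<Longrightarrow> \<exists>e'. directed_chart p s U \<phi> d e' \<and>
        half_disc \<sigma> p s U \<phi> d e' \<subseteq> half_disc \<sigma> p t U \<phi> d e"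
proof -
  have fc: "flat_chart p t U \<phi> d e" using dc by (simp add: directed_chart_def)
  note f = fc[unfolded flat_chart_def]
  have d: "d \<noteq> 0" "norm d = 1" using f by auto
  let ?z = "\<phi> (crv p t)" and ?b = "\<lambda>s. Re ((\<phi> (crv p s) - \<phi> (crv p t)) / d)"
  obtain \<delta>1 where \<delta>1: "\<delta>1 > 0" "{t - \<delta>1<..<t + \<delta>1} \<subseteq> {0<..<1}"
    "\<And>s. s \<in> {t - \<delta>1<..<t + \<delta>1} \<Longrightarrow> crv p s \<in> U \<and> \<phi> (crv p s) = ?z + of_real (?b s) * d"
    "continuous_on {t - \<delta>1<..<t + \<delta>1} ?b"
    using flat_chart_coordinate[OF fc] by metis
  obtain \<delta>2 where \<delta>2: "\<delta>2 > 0"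
    "\<forall>s s'. t - \<delta>2 < s \<longrightarrow> s < s' \<longrightarrow> s' < t + \<delta>2 \<longrightarrow> Re (\<phi> (crv p s) / d) < Re (\<phi> (crv p s') / d)"
    using dc unfolding directed_chart_def by blast
  have "continuous (at t) ?b"
    using \<delta>1(1,4) continuous_on_eq_continuous_at[of "{t - \<delta>1<..<t + \<delta>1}" ?b] by auto
  then obtain \<delta>3 where \<delta>3: "\<delta>3 > 0" "\<And>s. \<bar>s - t\<bar> < \<delta>3 \<Longrightarrow> \<bar>?b s\<bar> < e"
    using f unfolding continuous_at_eps_delta by (fastforce simp: dist_real_def)
  show thesis
  proof (rule that[of "min (min \<delta>1 \<delta>2) \<delta>3"])
    show "min (min \<delta>1 \<delta>2) \<delta>3 > 0" using \<delta>1(1) \<delta>2(1) \<delta>3(1) by simp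
    fix s assume "\<bar>s - t\<bar> < min (min \<delta>1 \<delta>2) \<delta>3"
    hence s: "s \<in> {t - \<delta>1<..<t + \<delta>1}" "\<bar>s - t\<bar> < \<delta>2" "\<bar>s - t\<bar> < \<delta>3" by auto
    let ?y = "\<phi> (crv p s)"
    have y: "crv p s \<in> U" "?y = ?z + of_real (?b s) * d" using \<delta>1(3)[OF s(1)] by auto
    have dist: "dist ?z ?y = \<bar>?b s\<bar>" by (subst y(2)) (simp add: dist_norm norm_mult d)
    define e' where "e' = e - dist ?z ?y"
    have e': "e' > 0" using \<delta>3(2)[OF s(3)] dist by (simp add: e'_def)
    have ball: "ball ?y e' \<subseteq> ball ?z e"
    proof
      fix w assume "w \<in> ball ?y e'"
      thus "w \<in> ball ?z e" using dist_triangle[of ?z w ?y] by (simp add: e'_def)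
    qed
    have im: "Im ((w - ?y) / d) = Im ((w - ?z) / d)" for w
    proof -
      have "(w - ?y) / d = (w - ?z) / d - of_real (?b s)"
        by (subst y(2)) (use d in \<open>simp add: field_simps\<close>)
      thus ?thesis by simp
    qed
    have "flat_chart p s U \<phi> d e'"
      unfolding flat_chart_def
    proof (intro conjI ballI impI)
      show "ball ?y e' \<subseteq> \<phi> ` U" using ball f by blast
      fix x assume "x \<in> U" "\<phi> x \<in> ball ?y e'"
      thus "x \<in> \<Gamma> \<longleftrightarrow> Im ((\<phi> x - ?y) / d) = 0" unfolding im using f ball by blast
    qed (use f s \<delta>1(2) y(1) e' in auto)
    moreover have "\<exists>\<delta>>0. \<forall>r r'. s - \<delta> < r \<longrightarrow> r < r' \<longrightarrow> r' < s + \<delta> \<longrightarrow> Re (\<phi> (crv p r) / d) < Re (\<phi> (crv p r') / d)"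
    proof (intro exI[of _ "\<delta>2 - \<bar>s - t\<bar>"] conjI allI impI)
      fix r r' assume "s - (\<delta>2 - \<bar>s - t\<bar>) < r" "r < r'" "r' < s + (\<delta>2 - \<bar>s - t\<bar>)"
      hence "t - \<delta>2 < r" "r < r'" "r' < t + \<delta>2" by auto
      thus "Re (\<phi> (crv p r) / d) < Re (\<phi> (crv p r') / d)" using \<delta>2(2) by blast
    qed (use s in auto)
    ultimately have "directed_chart p s U \<phi> d e'" by (simp add: directed_chart_def)
    moreover have "half_disc \<sigma> p s U \<phi> d e' \<subseteq> half_disc \<sigma> p t U \<phi> d e"
      unfolding half_disc_def im using ball by blast
    ultimately show "\<exists>e'. directed_chart p s U \<phi> d e' \<and>
        half_disc \<sigma> p s U \<phi> d e' \<subseteq> half_disc \<sigma> p t U \<phi> d e" by blast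
  qed
qed

text \<open>\<open>\<sigma> = 1\<close> is the left side and \<open>\<sigma> = -1\<close> the right side of an arrow.\<close>

definition side_face :: "real \<Rightarrow> 'e \<Rightarrow> 's set" where
  "side_face \<sigma> p = (THE f. f \<in> \<F> \<and>
     (\<exists>t\<in>{0<..<1}. \<exists>U \<phi>. arrow_chart A G pos crv p t U \<phi> \<and> {x \<in> U. \<sigma> * Im (\<phi> x) > 0} \<subseteq> f))"

context
  fixes p and \<sigma> :: real
  assumes p: "p \<in> arcs G" and \<sigma>: "\<sigma> = 1 \<or> \<sigma> = -1"
begin

text \<open>The description inside \<open>side_face\<close>, localised at one parameter, so that
  independence of the parameter can be stated.\<close>

definition side_at :: "real \<Rightarrow> 's set \<Rightarrow> bool" where
  "side_at t f \<longleftrightarrow> f \<in> \<F> \<and>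
     (\<exists>U \<phi>. arrow_chart A G pos crv p t U \<phi> \<and> {x \<in> U. \<sigma> * Im (\<phi> x) > 0} \<subseteq> f)"

lemma side_at_unique:
  assumes t: "t \<in> {0<..<1}" and dc: "directed_chart p t U \<phi> d e" and f: "f \<in> \<F>" "half_disc \<sigma> p t U \<phi> d e \<subseteq> f"
    and f': "side_at t f'"
  shows "f = f'"
proof -
  from f' obtain U' \<psi> where \<psi>: "arrow_chart A G pos crv p t U' \<psi>" "{x \<in> U'. \<sigma> * Im (\<psi> x) > 0} \<subseteq> f'" "f' \<in> \<F>"
    by (auto simp: side_at_def)
  from half_disc_meet[OF dc arrow_chart_directed[OF p t \<psi>(1)] \<sigma>]
  obtain x where "x \<in> half_disc \<sigma> p t U \<phi> d e" "x \<in> half_disc \<sigma> p t U' \<psi> 1 1" by blast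
  hence "x \<in> f" "x \<in> f'" using f \<psi> arrow_chart_half_disc[OF p t \<psi>(1)] by auto
  thus ?thesis using faces_disjoint f(1) \<psi>(3) by blast
qed

lemma ex1_side_at: "t \<in> {0<..<1} \<Longrightarrow> \<exists>!f. side_at t f"
proof -
  assume t: "t \<in> {0<..<1}"
  from ex_arrow_chart[OF p t] obtain U \<phi> where \<phi>: "arrow_chart A G pos crv p t U \<phi>" by blast
  have dc: "directed_chart p t U \<phi> 1 1" by (rule arrow_chart_directed[OF p t \<phi>])
  hence fc: "flat_chart p t U \<phi> 1 1" by (simp add: directed_chart_def)
  obtain f where f: "f \<in> \<F>" "half_disc \<sigma> p t U \<phi> 1 1 \<subseteq> f"
    using ex_face_containing[OF half_disc_connected[OF fc \<sigma>] half_disc_Int_graph[OF fc \<sigma>] half_disc_nonempty[OF fc \<sigma>]]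
    by blast
  hence "side_at t f" using \<phi> arrow_chart_half_disc[OF p t \<phi>] by (auto simp: side_at_def)
  thus ?thesis using side_at_unique[OF t dc f] by blast
qed

text \<open>The arrow chart at \<open>t\<close> also serves the neighbouring parameters, by
  \<open>directed_chart_shift\<close>, so the face is locally constant along the connected open
  interval.\<close>

lemma side_at_const:
  assumes t: "t \<in> {0<..<1}" "t' \<in> {0<..<1}" and f: "side_at t f"
  shows "side_at t' f"
proof -
  let ?f = "\<lambda>t. THE f. side_at t f"
  have "?f constant_on {0<..<1}"
  proof (rule locally_constant_imp_constant)
    fix t :: real assume t: "t \<in> {0<..<1}"
    have "side_at t (?f t)" using ex1_side_at[OF t] by (rule theI')
    then obtain U \<phi> where \<phi>: "arrow_chart A G pos crv p t U \<phi>" "{x \<in> U. \<sigma> * Im (\<phi> x) > 0} \<subseteq> ?f t" "?f t \<in> \<F>"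
      by (auto simp: side_at_def)
    obtain \<delta> where \<delta>: "\<delta> > 0" "\<And>s. \<bar>s - t\<bar> < \<delta> \<Longrightarrow> \<exists>e'. directed_chart p s U \<phi> 1 e' \<and>
        half_disc \<sigma> p s U \<phi> 1 e' \<subseteq> half_disc \<sigma> p t U \<phi> 1 1"
      using directed_chart_shift[OF arrow_chart_directed[OF p t \<phi>(1)]] by metis
    have "?f s = ?f t" if s: "s \<in> {0<..<1}" "\<bar>s - t\<bar> < \<delta>" for s
    proof -
      from \<delta>(2)[OF s(2)] obtain e' where e': "directed_chart p s U \<phi> 1 e'" "half_disc \<sigma> p s U \<phi> 1 e' \<subseteq> ?f t"
        using \<phi>(2) unfolding arrow_chart_half_disc[OF p t \<phi>(1)] by blast
      have "side_at s (?f s)" using ex1_side_at[OF s(1)] by (rule theI')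
      thus ?thesis using side_at_unique[OF s(1) e'(1) \<phi>(3) e'(2)] by blast
    qed
    moreover have "openin (top_of_set {0<..<1}) ({0<..<1} \<inter> ball t \<delta>)" by (simp add: openin_open_Int)
    moreover have "t \<in> {0<..<1} \<inter> ball t \<delta>" using t \<delta>(1) by simp
    moreover have "\<bar>s - t\<bar> < \<delta>" if "s \<in> ball t \<delta>" for s using that by (simp add: dist_real_def)
    ultimately show "\<exists>T. openin (top_of_set {0<..<1}) T \<and> t \<in> T \<and> (\<forall>s\<in>T. ?f s = ?f t)" by blast
  qed auto
  hence "?f t = ?f t'" using t by (auto simp: constant_on_def)
  moreover have "?f t = f" using f ex1_side_at[OF t(1)] by (simp add: the1_equality)
  ultimately show ?thesis using theI'[OF ex1_side_at[OF t(2)]] by simp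
qed

lemma
  shows side_face_iff: "f \<in> \<F> \<Longrightarrow> (\<exists>t\<in>{0<..<1}. \<exists>U \<phi>. arrow_chart A G pos crv p t U \<phi> \<and> {x \<in> U. \<sigma> * Im (\<phi> x) > 0} \<subseteq> f)
           \<longleftrightarrow> f = side_face \<sigma> p"
    and side_face_in_faces: "side_face \<sigma> p \<in> \<F>"
    and side_at_side_face: "t \<in> {0<..<1} \<Longrightarrow> side_at t (side_face \<sigma> p)"
proof -
  have eq: "f \<in> \<F> \<and> (\<exists>t\<in>{0<..<1}. \<exists>U \<phi>. arrow_chart A G pos crv p t U \<phi> \<and> {x \<in> U. \<sigma> * Im (\<phi> x) > 0} \<subseteq> f)
     \<longleftrightarrow> (\<exists>t\<in>{0<..<1}. side_at t f)" for f
    by (auto simp: side_at_def)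
  have half: "1 / 2 \<in> {0<..<1::real}" by simp
  have ex1: "\<exists>!f. \<exists>t\<in>{0<..<1}. side_at t f"
    using ex1_side_at[OF half] side_at_const half by metis
  have sf: "\<exists>t\<in>{0<..<1}. side_at t (side_face \<sigma> p)"
    unfolding side_face_def eq by (rule theI'[OF ex1])
  thus "side_face \<sigma> p \<in> \<F>" by (auto simp: side_at_def)
  show "t \<in> {0<..<1} \<Longrightarrow> side_at t (side_face \<sigma> p)" using sf side_at_const by blast
  show "(\<exists>t\<in>{0<..<1}. \<exists>U \<phi>. arrow_chart A G pos crv p t U \<phi> \<and> {x \<in> U. \<sigma> * Im (\<phi> x) > 0} \<subseteq> f)
           \<longleftrightarrow> f = side_face \<sigma> p" if "f \<in> \<F>"
    using eq[of f] that ex1 sf by blast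
qed

text \<open>This frees the sides from arrow charts: a chart in which the arrow runs in any direction
  \<open>d\<close>, such as a ray of a vertex chart, shows the same two faces.\<close>

lemma half_disc_subset_side_face:
  assumes dc: "directed_chart p t U \<phi> d e"
  shows "half_disc \<sigma> p t U \<phi> d e \<subseteq> side_face \<sigma> p"
proof -
  have fc: "flat_chart p t U \<phi> d e" using dc by (simp add: directed_chart_def)
  hence t: "t \<in> {0<..<1}" by (simp add: flat_chart_def)
  obtain f where f: "f \<in> \<F>" "half_disc \<sigma> p t U \<phi> d e \<subseteq> f"
    using ex_face_containing[OF half_disc_connected[OF fc \<sigma>] half_disc_Int_graph[OF fc \<sigma>] half_disc_nonempty[OF fc \<sigma>]]
    by blast
  thus ?thesis using side_at_unique[OF t dc f side_at_side_face[OF t]] by blast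
qed

end

lemma on_left_iff: "p \<in> arcs G \<Longrightarrow> f \<in> \<F> \<Longrightarrow> on_left A G pos crv f p \<longleftrightarrow> f = side_face 1 p"
  using side_face_iff[of p 1 f] by (simp add: on_left_def)

lemma on_right_iff: "p \<in> arcs G \<Longrightarrow> f \<in> \<F> \<Longrightarrow> on_right A G pos crv f p \<longleftrightarrow> f = side_face (-1) p"
  using side_face_iff[of p "-1" f] by (simp add: on_right_def)

section \<open>Faces as open sets, and functions on faces\<close>

lemma side_face_nearby:
  assumes "p \<in> arcs G" "t \<in> {0<..<1}" "arrow_chart A G pos crv p t U \<phi>" "f \<in> \<F>" "U \<inter> f \<noteq> {}"
  shows "f = side_face 1 p \<or> f = side_face (-1) p"
proof -
  from assms(5) obtain x where x: "x \<in> U" "x \<in> f" by blast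
  hence "x \<notin> \<Gamma>" using face_subset[OF assms(4)] by blast
  hence "Im (\<phi> x) \<noteq> 0" using arrow_chart_graph_iff[OF assms(3) x(1)] by blast
  then obtain \<sigma> :: real where \<sigma>: "\<sigma> = 1 \<or> \<sigma> = -1" "\<sigma> * Im (\<phi> x) > 0"
    by (metis mult_1 mult_minus1 neg_0_less_iff_less neqE)
  hence "x \<in> half_disc \<sigma> p t U \<phi> 1 1" using x arrow_chart_half_disc[OF assms(1-3)] by simp
  hence "x \<in> side_face \<sigma> p"
    using half_disc_subset_side_face[OF assms(1) \<sigma>(1) arrow_chart_directed[OF assms(1-3)]] by blast
  hence "f = side_face \<sigma> p"
    using faces_disjoint[OF assms(4) side_face_in_faces[OF assms(1) \<sigma>(1)] x(2)] by blast
  thus ?thesis using \<sigma>(1) by blast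
qed

text \<open>An open set around a point contains infinitely many points, so one that is no vertex; if
  that one lies on an arrow, its arrow chart offers points off the real axis.\<close>

lemma graph_complement_dense:
  assumes N: "openin S N" "N \<noteq> {}"
  shows "\<exists>y\<in>N. y \<notin> \<Gamma>"
proof -
  from N obtain x where x: "x \<in> N" "x \<in> topspace S" using openin_subset by blast
  from ex_chart[OF x(2)] obtain U \<phi> where \<phi>: "(U, \<phi>) \<in> A" "x \<in> U" by blast
  have "open (\<phi> ` (U \<inter> N))" by (rule chart_image_open[OF \<phi>(1) N(1)])
  hence "infinite (\<phi> ` (U \<inter> N))"
    using \<phi>(2) x(1) by (metis IntI empty_iff finite_imp_not_open image_eqI)
  moreover have "finite (\<phi> ` (U \<inter> pos ` verts G))" by simp
  ultimately have "\<not> \<phi> ` (U \<inter> N) \<subseteq> \<phi> ` (U \<inter> pos ` verts G)" by (meson finite_subset)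
  then obtain y where y: "y \<in> N" "y \<in> U" "y \<notin> pos ` verts G" by blast
  show ?thesis
  proof (cases "y \<in> \<Gamma>")
    case False thus ?thesis using y by blast
  next
    case True
    then obtain p t where p: "p \<in> arcs G" "t \<in> {0<..<1}" "y = crv p t"
      using y(3) by (elim graph_cases) auto
    from ex_arrow_chart[OF p(1,2)] obtain W \<psi> where \<psi>: "arrow_chart A G pos crv p t W \<psi>" by blast
    have WA: "(W, \<psi>) \<in> A" "crv p t \<in> W" "\<psi> (crv p t) = 0" using \<psi> by (auto simp: arrow_chart_def)
    have "open (\<psi> ` (W \<inter> N))" by (rule chart_image_open[OF WA(1) N(1)])
    moreover have "0 \<in> \<psi> ` (W \<inter> N)" using WA y(1) p(3) by force
    ultimately obtain e where e: "e > 0" "ball 0 e \<subseteq> \<psi> ` (W \<inter> N)" using open_contains_ball by blast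
    have "of_real (e / 2) * \<i> \<in> ball 0 e" using e(1) by (simp add: norm_mult norm_divide)
    then obtain z where z: "z \<in> W" "z \<in> N" "\<psi> z = of_real (e / 2) * \<i>" using e(2) by fastforce
    have "Im (\<psi> z) = e / 2" unfolding z(3) by simp
    hence "z \<notin> \<Gamma>" using arrow_chart_graph_iff[OF \<psi> z(1)] e(1) by simp
    thus ?thesis using z(2) by blast
  qed
qed

text \<open>Small discs in charts are connected, and one that avoids the closed graph is absorbed by
  the face of its centre.\<close>

lemma face_openin:
  assumes "f \<in> \<F>"
  shows "openin S f"
proof (subst openin_subopen, intro ballI)
  fix x assume x: "x \<in> f"
  hence x': "x \<in> topspace S" "x \<notin> \<Gamma>" using face_subset[OF assms] by auto
  from ex_chart[OF x'(1)] obtain U \<phi> where \<phi>: "(U, \<phi>) \<in> A" "x \<in> U" by blast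
  have "openin S (topspace S - \<Gamma>)" using graph_closedin by (rule openin_diff[OF openin_topspace])
  hence "open (\<phi> ` (U \<inter> (topspace S - \<Gamma>)))" by (rule chart_image_open[OF \<phi>(1)])
  moreover have "\<phi> x \<in> \<phi> ` (U \<inter> (topspace S - \<Gamma>))" using \<phi>(2) x' by blast
  ultimately obtain e where e: "e > 0" "ball (\<phi> x) e \<subseteq> \<phi> ` (U \<inter> (topspace S - \<Gamma>))"
    using open_contains_ball by blast
  let ?N = "U \<inter> \<phi> -` ball (\<phi> x) e"
  have "connectedin S ?N" using e(2) by (intro chart_vimage_connected[OF \<phi>(1)]) auto
  moreover have "?N \<inter> \<Gamma> = {}"
  proof -
    have "y \<notin> \<Gamma>" if "y \<in> ?N" for y
    proof -
      have "\<phi> y \<in> \<phi> ` (U \<inter> (topspace S - \<Gamma>))" using that e(2) by blast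
      thus ?thesis using chart_inj[OF \<phi>(1)] that by (auto dest: inj_onD)
    qed
    thus ?thesis by blast
  qed
  moreover have xN: "x \<in> ?N" using \<phi>(2) e(1) by simp
  ultimately have "?N \<subseteq> f" using face_absorbs[OF assms] x by blast
  moreover have "openin S ?N" by (rule chart_vimage_open[OF \<phi>(1)]) simp
  ultimately show "\<exists>N. openin S N \<and> x \<in> N \<and> N \<subseteq> f" using xN by blast
qed

lemma constant_on_faces:
  assumes c: "\<And>p. p \<in> arcs G \<Longrightarrow> c (side_face (-1) p) = c (side_face 1 p)"
    and f0: "f0 \<in> \<F>" and f1: "f1 \<in> \<F>"
  shows "c f0 = c f1"
proof -
  \<comment> \<open>Only the distinction between the value \<open>c f0\<close> and all other values
    is extended to the graph: a point belongs to \<open>O' b\<close> if all faces met by some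
    neighbourhood agree on it. Density of the complement of the graph makes the two open sets
    disjoint; it remains to cover the surface.\<close>
  define O' where "O' = (\<lambda>b. \<Union>{N. openin S N \<and> (\<forall>f\<in>\<F>. N \<inter> f \<noteq> {} \<longrightarrow> (c f = c f0 \<longleftrightarrow> b))})"
  have op: "openin S (O' b)" for b unfolding O'_def by (rule openin_Union) auto
  have val: "c f = c f0 \<longleftrightarrow> b" if "x \<in> O' b" "x \<in> f" "f \<in> \<F>" for x f b
    using that unfolding O'_def by blast
  have disj: "O' True \<inter> O' False = {}"
  proof (rule ccontr)
    assume "O' True \<inter> O' False \<noteq> {}"
    then obtain y where y: "y \<in> O' True" "y \<in> O' False" "y \<notin> \<Gamma>"
      using graph_complement_dense[of "O' True \<inter> O' False"] op by blast
    then obtain f where "f \<in> \<F>" "y \<in> f" using ex_face_at openin_subset[OF op] by blast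
    thus False using val y by blast
  qed
  have O'I: "x \<in> O' True \<union> O' False" if "openin S N" "x \<in> N" "\<And>f. f \<in> \<F> \<Longrightarrow> N \<inter> f \<noteq> {} \<Longrightarrow> c f = b" for x N b
    using that unfolding O'_def by (cases "b = c f0") blast+
  have off_verts: "x \<in> O' True \<union> O' False" if x: "x \<in> topspace S" "x \<notin> pos ` verts G" for x
  proof (cases "x \<in> \<Gamma>")
    case True
    then obtain p t where p: "p \<in> arcs G" "t \<in> {0<..<1}" "x = crv p t"
      using x(2) by (elim graph_cases) auto
    from ex_arrow_chart[OF p(1,2)] obtain U \<phi> where \<phi>: "arrow_chart A G pos crv p t U \<phi>" by blast
    hence "(U, \<phi>) \<in> A" "x \<in> U" using p(3) by (auto simp: arrow_chart_def)
    thus ?thesis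
      using side_face_nearby[OF p(1,2) \<phi>] c[OF p(1)] by (intro O'I[of U x "c (side_face 1 p)"] chart_openin) auto
  next
    case False
    then obtain f where f: "f \<in> \<F>" "x \<in> f" using ex_face_at x(1) by blast
    hence "c f' = c f" if "f' \<in> \<F>" "f \<inter> f' \<noteq> {}" for f'
      using faces_disjoint[OF f(1) that(1)] that(2) by blast
    thus ?thesis using O'I[OF face_openin[OF f(1)] f(2)] by blast
  qed
  have "x \<in> O' True \<union> O' False" if x: "x \<in> topspace S" for x
  proof -
    from ex_chart[OF x(1)] obtain U \<phi> where \<phi>: "(U, \<phi>) \<in> A" "x \<in> U" by blast
    obtain e where e: "e > 0" "ball (\<phi> x) e \<subseteq> \<phi> ` U"
      using chart_open[OF \<phi>(1)] open_contains_ball \<phi>(2) by blast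
    \<comment> \<open>Vertices are not covered by the hypothesis on arrows. A disc without finitely
      many points is connected, so the punctured disc lies in one of the two open sets; faces
      contain no vertices, so every face that meets the disc meets the punctured disc.\<close>
    let ?B = "ball (\<phi> x) e - \<phi> ` (U \<inter> pos ` verts G)"
    have "connected ?B" by (intro connected_open_diff_countable countable_finite) auto
    hence K: "connectedin S (U \<inter> \<phi> -` ?B)" using e(2) by (intro chart_vimage_connected[OF \<phi>(1)]) auto
    have "U \<inter> \<phi> -` ?B \<subseteq> O' True \<union> O' False"
    proof
      fix y assume "y \<in> U \<inter> \<phi> -` ?B"
      thus "y \<in> O' True \<union> O' False" using off_verts chart_subset[OF \<phi>(1)] by blast
    qed
    moreover have "O' True \<inter> (U \<inter> \<phi> -` ?B) = {} \<or> O' False \<inter> (U \<inter> \<phi> -` ?B) = {}"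
    proof (rule ccontr)
      assume "\<not> ?thesis"
      moreover have "O' True \<inter> O' False \<inter> (U \<inter> \<phi> -` ?B) = {}" using disj by blast
      ultimately show False
        using K op \<open>U \<inter> \<phi> -` ?B \<subseteq> O' True \<union> O' False\<close> unfolding connectedin by meson
    qed
    ultimately obtain b where b: "U \<inter> \<phi> -` ?B \<subseteq> O' b" by blast
    have "openin S (U \<inter> \<phi> -` ball (\<phi> x) e)" by (rule chart_vimage_open[OF \<phi>(1)]) simp
    moreover have "c f = c f0 \<longleftrightarrow> b" if f: "f \<in> \<F>" "(U \<inter> \<phi> -` ball (\<phi> x) e) \<inter> f \<noteq> {}" for f
    proof -
      from f(2) obtain y where y: "y \<in> U" "\<phi> y \<in> ball (\<phi> x) e" "y \<in> f" by blast
      have "y \<notin> pos ` verts G" using y(3) face_subset[OF f(1)] pos_in_graph by blast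
      hence "\<phi> y \<notin> \<phi> ` (U \<inter> pos ` verts G)" using chart_inj[OF \<phi>(1)] y(1) by (auto dest: inj_onD)
      hence "y \<in> O' b" using b y by blast
      thus ?thesis using val y(3) f(1) by blast
    qed
    moreover have "x \<in> U \<inter> \<phi> -` ball (\<phi> x) e" using e(1) \<phi>(2) by simp
    ultimately have "x \<in> O' b" unfolding O'_def by blast
    thus ?thesis by (cases b) auto
  qed
  hence "topspace S \<subseteq> O' True \<union> O' False" by blast
  hence "O' True = {} \<or> O' False = {}"
    using connected_S op disj unfolding connected_space_def by blast
  moreover obtain x where x: "x \<in> f0" "x \<in> topspace S" using face_nonempty[OF f0] face_subset[OF f0] by blast
  have "x \<notin> O' False" using val[of x False f0] x f0 by blast
  hence "x \<in> O' True" using \<open>topspace S \<subseteq> _\<close> x by blast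
  ultimately have "O' False = {}" by blast
  moreover obtain y where "y \<in> f1" "y \<in> topspace S" using face_nonempty[OF f1] face_subset[OF f1] by blast
  ultimately have "y \<in> O' True" using \<open>topspace S \<subseteq> _\<close> by blast
  thus ?thesis using val[of y True f1] \<open>y \<in> f1\<close> f1 by simp
qed

text \<open>A face beside no arrow is the only face: its indicator does not jump across any arrow,
  hence is constant. Otherwise every face is one of the two sides of one of finitely many
  arrows.\<close>

lemma finite_faces: "finite \<F>"
proof (cases "\<F> \<subseteq> side_face 1 ` arcs G \<union> side_face (-1) ` arcs G")
  case True
  thus ?thesis by (rule finite_subset) simp
next
  case False
  then obtain f where f: "f \<in> \<F>" "f \<notin> side_face 1 ` arcs G" "f \<notin> side_face (-1) ` arcs G" by blast
  have "f' = f" if "f' \<in> \<F>" for f'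
    using constant_on_faces[of "\<lambda>g. g = f" f f'] f that by blast
  hence "\<F> \<subseteq> {f}" by blast
  thus ?thesis by (rule finite_subset) simp
qed

lemma faces_nonempty: "\<F> \<noteq> {}"
proof -
  obtain v where "v \<in> verts G" using verts_nonempty by blast
  hence "topspace S \<noteq> {}" using pos_in_topspace by blast
  then obtain y where "y \<in> topspace S" "y \<notin> \<Gamma>" using graph_complement_dense[of "topspace S"] by auto
  thus ?thesis using ex_face_at by blast
qed

section \<open>Going around a vertex\<close>

lemma vertex_chart_graph_iff:
  assumes "(U, \<phi>) \<in> A" "\<phi> ` U = ball 0 1" "\<phi> ` (U \<inter> \<Gamma>) = X" "x \<in> U"
  shows "x \<in> \<Gamma> \<longleftrightarrow> \<phi> x \<in> X"
  using assms chart_inj[OF assms(1)] by (auto dest: inj_onD)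

text \<open>\<open>t\<close> is the time of first exit from the open disc of radius \<open>s0\<close>; until then the path stays on one ray.\<close>

lemma end_in_vertex_chart:
  assumes UA: "(U, \<phi>) \<in> A" and U1: "\<phi> ` U = ball 0 1" and v: "pos v \<in> U" "\<phi> (pos v) = 0" "v \<in> verts G"
    and R: "finite R" "R \<subseteq> sphere 0 1"
    and graph: "\<phi> ` (U \<inter> \<Gamma>) = {0} \<union> {of_real r * d | r d. 0 < r \<and> r < 1 \<and> d \<in> R}"
    and s0: "0 < s0" "s0 < 1"
    and e: "pathin S e" "e 0 = pos v" "e 1 \<notin> U \<inter> \<phi> -` cball 0 s0"
      "\<And>s. s \<in> {0<..<1} \<Longrightarrow> e s \<in> \<Gamma>" "\<And>s. s \<in> {0<..<1} \<Longrightarrow> e s \<noteq> pos v"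
  obtains t d where "t \<in> {0<..<1}" "d \<in> R" "e t \<in> U" "\<phi> (e t) = of_real s0 * d"
    "\<And>s. s \<in> {0<..t} \<Longrightarrow> e s \<in> U \<and> (\<exists>r>0. \<phi> (e s) = of_real r * d)"
    "\<And>s. s \<in> {0<..<t} \<Longrightarrow> Re (\<phi> (e s) / d) < s0"
proof -
  have e': "continuous_map (top_of_set {0..1}) S e" using e(1) by (simp add: pathin_def)
  have nR: "norm d' = 1" if "d' \<in> R" for d' using that R(2) by auto
  let ?V = "U \<inter> \<phi> -` ball 0 s0" and ?K = "U \<inter> \<phi> -` cball 0 s0"
  have "openin S ?V" by (rule chart_vimage_open[OF UA]) simp
  hence "openin (top_of_set {0..1}) {s \<in> topspace (top_of_set {0..1}). e s \<in> ?V}"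
    by (rule openin_continuous_map_preimage[OF e'])
  hence "openin (top_of_set {0..1}) {s \<in> {0..1}. e s \<in> ?V}" by (simp only: topspace_euclidean_subtopology)
  hence "closedin (top_of_set {0..1}) ({0..1} - {s \<in> {0..1}. e s \<in> ?V})"
    by (metis closedin_diff closedin_topspace topspace_euclidean_subtopology)
  moreover have "{0..1} - {s \<in> {0..1}. e s \<in> ?V} = {s \<in> {0..1}. e s \<notin> ?V}" by blast
  ultimately have "compact {s \<in> {0..1}. e s \<notin> ?V}" by (metis closedin_compact compact_Icc)
  moreover have "1 \<in> {s \<in> {0..1}. e s \<notin> ?V}" using e(3) by auto
  ultimately obtain t where t: "t \<in> {0..1}" "e t \<notin> ?V" "\<And>s. s \<in> {0..1} \<Longrightarrow> e s \<notin> ?V \<Longrightarrow> t \<le> s"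
    using compact_attains_inf[of "{s \<in> {0..1}. e s \<notin> ?V}"] by blast
  have "e 0 \<in> ?V" using e(2) v s0 by simp
  hence t0: "0 < t" using t(1,2) by (cases "t = 0") auto
  have before: "e s \<in> ?V" if "0 \<le> s" "s < t" for s using t(1) t(3)[of s] that by force
  \<comment> \<open>Leaving the open disc might mean leaving \<open>U\<close>. The closed disc is
    compact, hence closed in the Hausdorff space \<open>S\<close>, so the exit point is still in the
    chart and lies on the circle of radius \<open>s0\<close>.\<close>
  have "closedin S ?K" using s0 U1 by (intro chart_vimage_compact[OF UA]) auto
  hence "closedin (top_of_set {0..1}) {s \<in> topspace (top_of_set {0..1}). e s \<in> ?K}"
    by (rule closedin_continuous_map_preimage[OF e'])
  hence "closed {s \<in> {0..1}. e s \<in> ?K}"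
    by (simp only: topspace_euclidean_subtopology) (metis closedin_closed_trans closed_atLeastAtMost)
  moreover have "{0..<t} \<subseteq> {s \<in> {0..1}. e s \<in> ?K}" using before t(1) by fastforce
  ultimately have "closure {0..<t} \<subseteq> {s \<in> {0..1}. e s \<in> ?K}" by (simp add: closure_minimal)
  moreover have "t \<in> closure {0..<t}" using t0 by (simp add: closure_atLeastLessThan)
  ultimately have tK: "e t \<in> ?K" by blast
  hence nt: "e t \<in> U" "norm (\<phi> (e t)) = s0" using t(2) by auto
  have t1: "t < 1" using t(1) tK e(3) by (cases "t = 1") auto
  have inU: "e s \<in> U" if "s \<in> {0<..t}" for s using before[of s] nt(1) that by (cases "s = t") auto
  have ray: "\<exists>r d. 0 < r \<and> d \<in> R \<and> \<phi> (e s) = of_real r * d" if s: "s \<in> {0<..t}" for s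
  proof -
    have "s \<in> {0<..<1}" using s t1 by auto
    hence "e s \<in> \<Gamma>" "e s \<noteq> pos v" using e(4,5) by auto
    hence "\<phi> (e s) \<in> \<phi> ` (U \<inter> \<Gamma>)" "\<phi> (e s) \<noteq> \<phi> (pos v)"
      using inU[OF s] chart_inj[OF UA] v(1) by (auto simp: inj_on_eq_iff)
    hence "\<phi> (e s) \<in> \<phi> ` (U \<inter> \<Gamma>)" "\<phi> (e s) \<noteq> 0" using v(2) by auto
    thus ?thesis using graph by auto
  qed
  have sgn: "sgn (of_real r * d' :: complex) = d'" if "0 < r" "d' \<in> R" for r d'
    using that nR sgn_ray by blast
  have "continuous_on {0<..t} (\<phi> \<circ> e)"
  proof -
    have "continuous_map (top_of_set {0<..t}) (subtopology S U) e"
      unfolding continuous_map_in_subtopology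
    proof
      show "continuous_map (top_of_set {0<..t}) S e"
        by (rule continuous_map_from_subtopology_mono[OF e']) (use t1 in auto)
    qed (use inU in auto)
    hence "continuous_map (top_of_set {0<..t}) euclidean (\<phi> \<circ> e)"
      using chart_continuous[OF UA] continuous_map_compose by blast
    thus ?thesis by simp
  qed
  \<comment> \<open>Away from the centre the direction is continuous with values in the finite set
    \<open>R\<close>, hence constant on this interval.\<close>
  hence "continuous_on {0<..t} (\<lambda>s. sgn (\<phi> (e s)))"
    using ray nR unfolding o_def by (intro continuous_on_sgn) fastforce+
  moreover have "(\<lambda>s. sgn (\<phi> (e s))) ` {0<..t} \<subseteq> R" using ray sgn by fastforce
  hence "finite ((\<lambda>s. sgn (\<phi> (e s))) ` {0<..t})" using R(1) finite_subset by blast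
  ultimately have "(\<lambda>s. sgn (\<phi> (e s))) constant_on {0<..t}"
    by (intro continuous_finite_range_constant) auto
  then obtain d where d: "\<And>s. s \<in> {0<..t} \<Longrightarrow> sgn (\<phi> (e s)) = d" by (auto simp: constant_on_def)
  have eq: "\<exists>r>0. \<phi> (e s) = of_real r * d \<and> d \<in> R \<and> r = norm (\<phi> (e s))" if "s \<in> {0<..t}" for s
  proof -
    from ray[OF that] obtain r d' where r: "0 < r" "d' \<in> R" "\<phi> (e s) = of_real r * d'" by blast
    hence "d' = d" using d[OF that] sgn by simp
    moreover have "norm (\<phi> (e s)) = r" using r nR by (simp add: norm_mult)
    ultimately show ?thesis using r by blast
  qed
  show thesis
  proof (rule that[of t d])
    show "t \<in> {0<..<1}" using t0 t1 by simp
    show "d \<in> R" "\<phi> (e t) = of_real s0 * d" using eq[of t] t0 nt(2) by auto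
    show "e t \<in> U" by (rule nt)
    show "e s \<in> U \<and> (\<exists>r>0. \<phi> (e s) = of_real r * d)" if "s \<in> {0<..t}" for s
      using eq[OF that] inU[OF that] by blast
    show "Re (\<phi> (e s) / d) < s0" if s: "s \<in> {0<..<t}" for s
    proof -
      from s obtain r where r: "\<phi> (e s) = of_real r * d" "d \<in> R" "r = norm (\<phi> (e s))" using eq[of s] by auto
      hence "r < s0" using before[of s] s by simp
      moreover have "d \<noteq> 0" using nR[OF r(2)] by auto
      ultimately show ?thesis using r(1) by simp
    qed
  qed
qed

text \<open>For an arrow at \<open>v\<close> on the ray \<open>d\<close>, the direction of travel is
  \<open>outward v p\<close> times \<open>d\<close>: away from the vertex at its tail, towards the
  vertex at its head. The same sign names the side met when turning counterclockwise past the
  arrow.\<close>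

definition outward :: "'v \<Rightarrow> 'e \<Rightarrow> real" where
  "outward v p = (if tail G p = v then 1 else -1)"

lemma outward_cases: "outward v p = 1 \<or> outward v p = -1"
  by (simp add: outward_def)

context
  fixes v :: 'v and U :: "'s set" and \<phi> :: "'s \<Rightarrow> complex" and R :: "complex set" and s0 :: real
  assumes v: "v \<in> verts G" and UA: "(U, \<phi>) \<in> A" and U1: "\<phi> ` U = ball 0 1"
    and pv: "pos v \<in> U" "\<phi> (pos v) = 0"
    and R: "finite R" "R \<subseteq> sphere 0 1"
    and graph: "\<phi> ` (U \<inter> \<Gamma>) = {0} \<union> {of_real r * d | r d. 0 < r \<and> r < 1 \<and> d \<in> R}"
    and s0: "0 < s0" "s0 < 1"
    and isolated: "\<And>w. w \<in> verts G \<Longrightarrow> w \<noteq> v \<Longrightarrow> pos w \<notin> U \<inter> \<phi> -` cball 0 s0"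
begin

lemma ray_norm: "d \<in> R \<Longrightarrow> norm d = 1"
  using R(2) by auto

lemma flat_chart_at_ray:
  assumes "p \<in> arcs G" "t \<in> {0<..<1}" "d \<in> R" "crv p t \<in> U" "\<phi> (crv p t) = of_real s0 * d"
    and \<epsilon>: "\<epsilon> = 1 \<or> \<epsilon> = -1"
  shows "\<exists>e. flat_chart p t U \<phi> (of_real \<epsilon> * d) e"
proof -
  obtain e where e: "0 < e" "ball (of_real s0 * d) e \<subseteq> ball 0 1"
    "\<And>z. z \<in> ball (of_real s0 * d) e \<Longrightarrow>
       z \<in> {0} \<union> {of_real r * d | r d. 0 < r \<and> r < 1 \<and> d \<in> R} \<longleftrightarrow> Im ((z - of_real s0 * d) / d) = 0"
    using isolated_ray[OF R assms(3) s0] by blast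
  have \<epsilon>d: "Im (w / (of_real \<epsilon> * d)) = 0 \<longleftrightarrow> Im (w / d) = 0" for w using \<epsilon> by auto
  have "flat_chart p t U \<phi> (of_real \<epsilon> * d) e"
    unfolding flat_chart_def assms(5)
  proof (intro conjI ballI impI)
    fix x assume x: "x \<in> U" "\<phi> x \<in> ball (of_real s0 * d) e"
    show "x \<in> \<Gamma> \<longleftrightarrow> Im ((\<phi> x - of_real s0 * d) / (of_real \<epsilon> * d)) = 0"
      unfolding \<epsilon>d e(3)[OF x(2), symmetric] by (rule vertex_chart_graph_iff[OF UA U1 graph x(1)])
  qed (use assms UA U1 e ray_norm in \<open>auto simp: norm_mult\<close>)
  thus ?thesis by blast
qed

text \<open>\<open>N\<close> is the complement of the rest of the arrow beyond its first exit from
  the disc, seen from \<open>v\<close>; this rest is compact and misses \<open>pos v\<close>. Inside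
  \<open>N\<close> the arrow therefore keeps to its ray, which later identifies the arrow that fills
  a given ray.\<close>

lemma arrow_end:
  assumes p: "p \<in> arcs G" and inc: "tail G p = v \<or> head G p = v"
  shows "\<exists>t d N e. t \<in> {0<..<1} \<and> d \<in> R \<and> crv p t \<in> U \<and> \<phi> (crv p t) = of_real s0 * d \<and>
     directed_chart p t U \<phi> (of_real (outward v p) * d) e \<and> openin S N \<and> pos v \<in> N \<and>
     (\<forall>s\<in>{0<..<1}. crv p s \<in> N \<longrightarrow> crv p s \<in> U \<and> (\<exists>r>0. \<phi> (crv p s) = of_real r * d))"
proof -
  note \<Gamma>s = crv_in_graph[OF p] and not_v = crv_not_pos[OF p]
  have pos_v: "pos v \<noteq> crv p s" if "s \<in> {0<..<1}" for s using not_v[OF that] v by (metis imageI)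
  have pos_neq: "pos w \<noteq> pos v" if "w \<in> verts G" "w \<noteq> v" for w
    using pos_inj that v by (meson inj_onD)
  have ends: "tail G p \<in> verts G" "head G p \<in> verts G" using p by auto
  show ?thesis
  proof (cases "tail G p = v")
    case True
    hence hv: "head G p \<noteq> v" using no_loops[OF p] by auto
    obtain t d where t: "t \<in> {0<..<1}" "d \<in> R" "crv p t \<in> U" "\<phi> (crv p t) = of_real s0 * d"
      "\<And>s. s \<in> {0<..t} \<Longrightarrow> crv p s \<in> U \<and> (\<exists>r>0. \<phi> (crv p s) = of_real r * d)"
      "\<And>s. s \<in> {0<..<t} \<Longrightarrow> Re (\<phi> (crv p s) / d) < s0"
    proof (rule end_in_vertex_chart[OF UA U1 pv v R graph s0 crv_path[OF p]])
      show "crv p 0 = pos v" using crv_0[OF p] True by simp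
      show "crv p 1 \<notin> U \<inter> \<phi> -` cball 0 s0" using crv_1[OF p] isolated[OF ends(2) hv] by simp
      show "crv p s \<in> \<Gamma>" if "s \<in> {0<..<1}" for s using that by (intro \<Gamma>s) auto
      show "crv p s \<noteq> pos v" if "s \<in> {0<..<1}" for s using pos_v[OF that] by simp
    qed blast
    have d0: "d \<noteq> 0" using ray_norm[OF t(2)] by auto
    obtain e where e: "flat_chart p t U \<phi> (of_real (outward v p) * d) e"
      using flat_chart_at_ray[OF p t(1-4) outward_cases] by blast
    have "\<forall>\<^sub>F s in at_left t. s \<in> {0<..<t}" using t(1) by (intro eventually_at_left_real) simp
    hence "\<forall>\<^sub>F s in at_left t. Re (\<phi> (crv p s) / d) < Re (\<phi> (crv p t) / d)"
      by eventually_elim (use t(6) d0 in \<open>simp add: t(4)\<close>)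
    hence "directed_chart p t U \<phi> (of_real (outward v p) * d) e"
      by (intro directed_chartI[OF e] disjI2) (simp add: outward_def True)
    moreover have "openin S (topspace S - crv p ` {t..1})"
      using t(1) by (intro openin_diff openin_topspace crv_closedin[OF p]) auto
    moreover have "pos v \<in> topspace S - crv p ` {t..1}"
    proof -
      have "pos v \<noteq> crv p s" if "s \<in> {t..1}" for s
        using pos_v[of s] that t(1) crv_1[OF p] pos_neq[OF ends(2) hv] by (cases "s = 1") auto
      thus ?thesis using pos_in_topspace[OF v] by blast
    qed
    moreover have "\<forall>s\<in>{0<..<1}. crv p s \<in> topspace S - crv p ` {t..1} \<longrightarrow>
        crv p s \<in> U \<and> (\<exists>r>0. \<phi> (crv p s) = of_real r * d)"
    proof (intro ballI impI)
      fix s :: real assume s: "s \<in> {0<..<1}" "crv p s \<in> topspace S - crv p ` {t..1}"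
      hence "s \<notin> {t..1}" by blast
      thus "crv p s \<in> U \<and> (\<exists>r>0. \<phi> (crv p s) = of_real r * d)" using s(1) by (intro t(5)) auto
    qed
    ultimately show ?thesis using t(1-4) by blast
  next
    case False
    hence hv: "head G p = v" using inc by auto
    \<comment> \<open>The arrow is reversed to start at \<open>v\<close>. What is known before the
      exit then concerns parameters to the right of \<open>1 - t\<close>, and the direction of
      travel becomes \<open>- d\<close>.\<close>
    let ?e = "\<lambda>s. crv p (1 - s)"
    have "pathin S ?e"
    proof -
      have "continuous_map (top_of_set {0..1}) (top_of_set {0..1::real}) (\<lambda>s. 1 - s)"
        by (auto simp: continuous_map_in_subtopology intro!: continuous_intros)
      from continuous_map_compose[OF this crv_path[OF p, unfolded pathin_def]]
      show ?thesis by (simp add: pathin_def o_def)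
    qed
    then obtain t d where t: "t \<in> {0<..<1}" "d \<in> R" "?e t \<in> U" "\<phi> (?e t) = of_real s0 * d"
      "\<And>s. s \<in> {0<..t} \<Longrightarrow> ?e s \<in> U \<and> (\<exists>r>0. \<phi> (?e s) = of_real r * d)"
      "\<And>s. s \<in> {0<..<t} \<Longrightarrow> Re (\<phi> (?e s) / d) < s0"
    proof (rule end_in_vertex_chart[OF UA U1 pv v R graph s0])
      show "?e 0 = pos v" using crv_1[OF p] hv by simp
      show "?e 1 \<notin> U \<inter> \<phi> -` cball 0 s0" using crv_0[OF p] isolated[OF ends(1) False] by simp
      show "?e s \<in> \<Gamma>" if "s \<in> {0<..<1}" for s using that by (intro \<Gamma>s) auto
      show "?e s \<noteq> pos v" if "s \<in> {0<..<1}" for s using pos_v[of "1 - s"] that by auto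
    qed blast
    have d0: "d \<noteq> 0" using ray_norm[OF t(2)] by auto
    let ?t = "1 - t"
    have t': "?t \<in> {0<..<1}" using t(1) by auto
    obtain e where e: "flat_chart p ?t U \<phi> (of_real (outward v p) * d) e"
      using flat_chart_at_ray[OF p t' t(2-4) outward_cases] by blast
    have "\<forall>\<^sub>F s in at_right ?t. s \<in> {?t<..<1}" using t(1) by (intro eventually_at_right_real) simp
    hence "\<forall>\<^sub>F s in at_right ?t. Re (\<phi> (crv p s) / - d) > Re (\<phi> (crv p ?t) / - d)"
    proof eventually_elim
      case (elim s)
      hence "Re (\<phi> (crv p s) / d) < s0" using t(6)[of "1 - s"] by simp
      thus ?case using d0 by (simp add: t(4))
    qed
    hence "directed_chart p ?t U \<phi> (of_real (outward v p) * d) e"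
      by (intro directed_chartI[OF e] disjI1) (simp add: outward_def False)
    moreover have "openin S (topspace S - crv p ` {0..?t})"
      using t(1) by (intro openin_diff openin_topspace crv_closedin[OF p]) auto
    moreover have "pos v \<in> topspace S - crv p ` {0..?t}"
    proof -
      have "pos v \<noteq> crv p s" if "s \<in> {0..?t}" for s
        using pos_v[of s] that t(1) crv_0[OF p] pos_neq[OF ends(1) False] by (cases "s = 0") auto
      thus ?thesis using pos_in_topspace[OF v] by blast
    qed
    moreover have "\<forall>s\<in>{0<..<1}. crv p s \<in> topspace S - crv p ` {0..?t} \<longrightarrow>
        crv p s \<in> U \<and> (\<exists>r>0. \<phi> (crv p s) = of_real r * d)"
    proof (intro ballI impI)
      fix s :: real assume s: "s \<in> {0<..<1}" "crv p s \<in> topspace S - crv p ` {0..?t}"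
      hence "s \<notin> {0..?t}" by blast
      thus "crv p s \<in> U \<and> (\<exists>r>0. \<phi> (crv p s) = of_real r * d)" using s(1) t(5)[of "1 - s"] by simp
    qed
    ultimately show ?thesis using t' t(2-4) by blast
  qed
qed

text \<open>Injectivity holds because the point at distance \<open>s0\<close> on a ray is interior
  to just one arrow. For surjectivity, other vertices and arrows away from \<open>v\<close> form a
  closed set \<open>K\<close> without \<open>pos v\<close>; a point of the ray close to the centre
  thus lies on an arrow at \<open>v\<close>, inside the neighbourhood where that arrow keeps to its
  own ray.\<close>

lemma ex_ray_of_arrow:
  obtains D :: "'e \<Rightarrow> complex"
  where "bij_betw D {p \<in> arcs G. tail G p = v \<or> head G p = v} R"
    "\<And>p. p \<in> arcs G \<Longrightarrow> tail G p = v \<or> head G p = v \<Longrightarrow> \<exists>t e. \<phi> (crv p t) = of_real s0 * D p \<and>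
       directed_chart p t U \<phi> (of_real (outward v p) * D p) e"
proof -
  let ?I = "{p \<in> arcs G. tail G p = v \<or> head G p = v}"
  have "\<forall>p\<in>?I. \<exists>t d N e. t \<in> {0<..<1} \<and> d \<in> R \<and> crv p t \<in> U \<and> \<phi> (crv p t) = of_real s0 * d \<and>
     directed_chart p t U \<phi> (of_real (outward v p) * d) e \<and> openin S N \<and> pos v \<in> N \<and>
     (\<forall>s\<in>{0<..<1}. crv p s \<in> N \<longrightarrow> crv p s \<in> U \<and> (\<exists>r>0. \<phi> (crv p s) = of_real r * d))"
    using arrow_end by simp
  from this[THEN bchoice] obtain t where "\<forall>p\<in>?I. \<exists>d N e. t p \<in> {0<..<1} \<and> d \<in> R \<and> crv p (t p) \<in> U \<and> \<phi> (crv p (t p)) = of_real s0 * d \<and>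
     directed_chart p (t p) U \<phi> (of_real (outward v p) * d) e \<and> openin S N \<and> pos v \<in> N \<and>
     (\<forall>s\<in>{0<..<1}. crv p s \<in> N \<longrightarrow> crv p s \<in> U \<and> (\<exists>r>0. \<phi> (crv p s) = of_real r * d))" ..
  from this[THEN bchoice] obtain D where "\<forall>p\<in>?I. \<exists>N e. t p \<in> {0<..<1} \<and> D p \<in> R \<and> crv p (t p) \<in> U \<and> \<phi> (crv p (t p)) = of_real s0 * D p \<and>
     directed_chart p (t p) U \<phi> (of_real (outward v p) * D p) e \<and> openin S N \<and> pos v \<in> N \<and>
     (\<forall>s\<in>{0<..<1}. crv p s \<in> N \<longrightarrow> crv p s \<in> U \<and> (\<exists>r>0. \<phi> (crv p s) = of_real r * D p))" ..
  from this[THEN bchoice] obtain N where N: "\<forall>p\<in>?I. \<exists>e. t p \<in> {0<..<1} \<and> D p \<in> R \<and> crv p (t p) \<in> U \<and> \<phi> (crv p (t p)) = of_real s0 * D p \<and>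
     directed_chart p (t p) U \<phi> (of_real (outward v p) * D p) e \<and> openin S (N p) \<and> pos v \<in> N p \<and>
     (\<forall>s\<in>{0<..<1}. crv p s \<in> N p \<longrightarrow> crv p s \<in> U \<and> (\<exists>r>0. \<phi> (crv p s) = of_real r * D p))" ..
  have inj: "inj_on D ?I"
  proof (rule inj_onI)
    fix p q assume pq: "p \<in> ?I" "q \<in> ?I" "D p = D q"
    have "\<phi> (crv p (t p)) = \<phi> (crv q (t q))" "crv p (t p) \<in> U" "crv q (t q) \<in> U" "t p \<in> {0<..<1}" "t q \<in> {0<..<1}"
      using bspec[OF N pq(1)] bspec[OF N pq(2)] pq(3) by auto
    moreover from this have "crv p (t p) = crv q (t q)" using chart_inj[OF UA] by (meson inj_onD)
    ultimately show "p = q" using crv_disjoint pq by blast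
  qed
  have "R \<subseteq> D ` ?I"
  proof
    fix d assume d: "d \<in> R"
    define K where "K = pos ` (verts G - {v}) \<union> (\<Union>p\<in>arcs G - ?I. crv p ` {0..1})"
    have "closedin S (pos ` (verts G - {v}))"
      using pos_in_topspace by (intro closedin_Hausdorff_finite[OF Hausdorff_S]) auto
    moreover have "closedin S (\<Union>p\<in>arcs G - ?I. crv p ` {0..1})"
      using crv_closedin by (intro closedin_Union) auto
    ultimately have K: "closedin S K" unfolding K_def by (rule closedin_Un)
    have vK: "pos v \<notin> K"
    proof
      assume "pos v \<in> K"
      hence "pos v \<in> pos ` (verts G - {v}) \<or> (\<exists>p\<in>arcs G - ?I. \<exists>s\<in>{0..1}. pos v = crv p s)"
        unfolding K_def by blast
      thus False
      proof
        assume "pos v \<in> pos ` (verts G - {v})"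
        thus False using pos_inj v by (auto dest: inj_onD)
      next
        assume "\<exists>p\<in>arcs G - ?I. \<exists>s\<in>{0..1}. pos v = crv p s"
        then obtain p s where p: "p \<in> arcs G" "tail G p \<noteq> v" "head G p \<noteq> v" and s: "s \<in> {0..1}" "pos v = crv p s"
          by blast
        consider "s = 0" | "s = 1" | "s \<in> {0<..<1}" using s(1) by fastforce
        thus False
        proof cases
          case 1 thus False using s(2) crv_0[OF p(1)] p v pos_inj by (metis inj_onD tail_in_verts)
        next
          case 2 thus False using s(2) crv_1[OF p(1)] p v pos_inj by (metis inj_onD head_in_verts)
        next
          case 3 thus False using s(2) crv_not_pos[OF p(1) 3] v by (metis imageI)
        qed
      qed
    qed
    \<comment> \<open>Inserting \<open>topspace S\<close> keeps the intersection open when no arrow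
      is incident with \<open>v\<close>.\<close>
    define M where "M = (topspace S - K) \<inter> \<Inter>(insert (topspace S) (N ` ?I))"
    have "openin S (\<Inter>(insert (topspace S) (N ` ?I)))"
      by (rule openin_Inter) (use N in auto)
    hence "openin S M" unfolding M_def by (intro openin_Int openin_diff[OF openin_topspace K])
    hence "open (\<phi> ` (U \<inter> M))" by (rule chart_image_open[OF UA])
    moreover have "pos v \<in> M" using N vK pos_in_topspace[OF v] by (auto simp: M_def)
    hence "0 \<in> \<phi> ` (U \<inter> M)" using pv by force
    ultimately obtain \<eta> where \<eta>: "\<eta> > 0" "ball 0 \<eta> \<subseteq> \<phi> ` (U \<inter> M)" using open_contains_ball by blast
    define r where "r = min \<eta> 1 / 2"
    have r: "0 < r" "r < \<eta>" "r < 1" using \<eta>(1) by (auto simp: r_def min_def)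
    have "of_real r * d \<in> ball 0 \<eta>" using r ray_norm[OF d] by (simp add: norm_mult)
    then obtain x where x: "x \<in> U" "x \<in> M" "\<phi> x = of_real r * d" using \<eta>(2) by fastforce
    have "x \<in> \<Gamma>" using vertex_chart_graph_iff[OF UA U1 graph x(1)] x(3) r d by blast
    have "x \<noteq> pos v" using x(3) pv(2) r(1) ray_norm[OF d] by auto
    hence xv: "x \<notin> pos ` verts G" using x(2) by (auto simp: M_def K_def)
    with \<open>x \<in> \<Gamma>\<close> obtain p s where ps: "p \<in> arcs G" "s \<in> {0<..<1}" "x = crv p s"
      by (elim graph_cases) auto
    have "p \<in> ?I"
    proof (rule ccontr)
      assume "p \<notin> ?I"
      moreover have "x \<in> crv p ` {0..1}" using ps(2,3) by auto
      ultimately have "x \<in> K" using ps(1) unfolding K_def by blast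
      thus False using x(2) by (simp add: M_def)
    qed
    moreover from this have "crv p s \<in> N p" using x(2) ps(3) by (auto simp: M_def)
    ultimately obtain r' where r': "r' > 0" "\<phi> x = of_real r' * D p" "D p \<in> R" using N ps by blast
    hence "sgn (\<phi> x) = D p" using sgn_ray ray_norm by simp
    moreover have "sgn (\<phi> x) = d" using sgn_ray[OF r(1) ray_norm[OF d]] x(3) by simp
    ultimately show "d \<in> D ` ?I" using \<open>p \<in> ?I\<close> by blast
  qed
  moreover have "D ` ?I \<subseteq> R" using N by blast
  ultimately have "bij_betw D ?I R" using inj by (simp add: bij_betw_def)
  thus thesis using that N by blast
qed

text \<open>Follow \<open>C\<close> along the circle of radius \<open>s0\<close>: it jumps exactly where an arrow is crossed.\<close>

lemma circulation_in_chart: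
  fixes C :: "'s set \<Rightarrow> 'a::ab_group_add"
  shows "(\<Sum>p\<in>{p \<in> arcs G. tail G p = v \<or> head G p = v}.
     C (side_face (outward v p) p) - C (side_face (- outward v p) p)) = 0"
proof -
  let ?I = "{p \<in> arcs G. tail G p = v \<or> head G p = v}"
  obtain D where D: "bij_betw D ?I R"
    "\<And>p. p \<in> arcs G \<Longrightarrow> tail G p = v \<or> head G p = v \<Longrightarrow> \<exists>t e. \<phi> (crv p t) = of_real s0 * D p \<and>
       directed_chart p t U \<phi> (of_real (outward v p) * D p) e"
    using ex_ray_of_arrow by blast
  obtain a T where T: "finite T" "T \<subseteq> {a<..<a + 2 * pi}" "bij_betw cis T R"
    "\<And>\<theta>. \<theta> \<in> {a..a + 2 * pi} - T \<Longrightarrow> cis \<theta> \<notin> R"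
    by (rule ex_angles[OF R]) (rule that; assumption)
  define h where "h = (\<lambda>\<theta>. inv_into ?I D (cis \<theta>))"
  have bij_h: "bij_betw h T ?I"
    unfolding h_def using bij_betw_trans[OF T(3) bij_betw_inv_into[OF D(1)]] unfolding o_def .
  have Dh: "D (h \<theta>) = cis \<theta>" "h \<theta> \<in> ?I" if "\<theta> \<in> T" for \<theta>
  proof -
    have "cis \<theta> \<in> D ` ?I" using that T(3) D(1) by (auto simp: bij_betw_def)
    thus "D (h \<theta>) = cis \<theta>" "h \<theta> \<in> ?I" unfolding h_def by (rule f_inv_into_f, rule inv_into_into)
  qed
  \<comment> \<open>Unspecified on the graph, that is, at the crossing angles, where
    \<open>sum_jumps\<close> asks for the one-sided values instead.\<close>
  define F where "F = (\<lambda>x. THE f. f \<in> \<F> \<and> x \<in> f)"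
  have F: "F x = f" if "f \<in> \<F>" "x \<in> f" for x f
    unfolding F_def using that faces_disjoint by (intro the_equality) blast+
  define x where "x = (\<lambda>\<theta>. inv_into U \<phi> (of_real s0 * cis \<theta>))"
  have x: "x \<theta> \<in> U" "\<phi> (x \<theta>) = of_real s0 * cis \<theta>" for \<theta>
  proof -
    have "of_real s0 * cis \<theta> \<in> \<phi> ` U" using s0 by (simp add: U1 norm_mult)
    thus "x \<theta> \<in> U" "\<phi> (x \<theta>) = of_real s0 * cis \<theta>"
      unfolding x_def by (rule inv_into_into, rule f_inv_into_f)
  qed
  define f where "f = (\<lambda>\<theta>. C (F (x \<theta>)))"
  have cont: "\<forall>\<^sub>F y in at \<theta>. of_real s0 * cis y \<in> W" if "open W" "of_real s0 * cis \<theta> \<in> W" for W \<theta>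
  proof -
    have "((\<lambda>y. of_real s0 * cis y) \<longlongrightarrow> of_real s0 * cis \<theta>) (at \<theta>)"
      by (intro tendsto_intros)
    thus ?thesis using that by (rule topological_tendstoD)
  qed
  have "f (a + 2 * pi) - f a = (\<Sum>\<tau>\<in>T. C (side_face (outward v (h \<tau>)) (h \<tau>)) - C (side_face (- outward v (h \<tau>)) (h \<tau>)))"
  proof (rule sum_jumps[OF T(1,2)])
    show "a \<le> a + 2 * pi" by simp
    fix \<theta> assume "\<theta> \<in> {a..a + 2 * pi} - T"
    hence "cis \<theta> \<notin> R" by (rule T(4))
    have "x \<theta> \<notin> \<Gamma>"
    proof
      assume "x \<theta> \<in> \<Gamma>"
      hence "of_real s0 * cis \<theta> \<in> {0} \<union> {of_real r * d | r d. 0 < r \<and> r < 1 \<and> d \<in> R}"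
        using vertex_chart_graph_iff[OF UA U1 graph x(1)[of \<theta>]] x(2) by metis
      then obtain r d where "0 < r" "d \<in> R" "of_real s0 * cis \<theta> = of_real r * d" using s0 by auto
      hence "cis \<theta> = d" using sgn_ray[of s0 "cis \<theta>"] sgn_ray[of r d] ray_norm s0(1) by simp
      thus False using \<open>d \<in> R\<close> \<open>cis \<theta> \<notin> R\<close> by simp
    qed
    then obtain g where g: "g \<in> \<F>" "x \<theta> \<in> g" using ex_face_at chart_subset[OF UA] x(1) by blast
    have "open (\<phi> ` (U \<inter> g))" by (rule chart_image_open[OF UA face_openin[OF g(1)]])
    moreover have "of_real s0 * cis \<theta> \<in> \<phi> ` (U \<inter> g)" using x[of \<theta>] g(2) by (metis IntI imageI)
    ultimately have "\<forall>\<^sub>F y in at \<theta>. of_real s0 * cis y \<in> \<phi> ` (U \<inter> g)" by (rule cont)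
    thus "\<forall>\<^sub>F y in at \<theta>. f y = f \<theta>"
    proof eventually_elim
      case (elim y)
      then obtain z where z: "z \<in> U" "z \<in> g" "\<phi> z = \<phi> (x y)" by (auto simp: x(2))
      hence "x y = z" using chart_inj[OF UA] x(1) by (metis inj_onD)
      thus ?case using F g z(2) by (simp add: f_def)
    qed
  next
    fix \<tau> assume \<tau>: "\<tau> \<in> T"
    let ?p = "h \<tau>"
    let ?\<epsilon> = "outward v ?p"
    have p: "?p \<in> arcs G" using Dh(2)[OF \<tau>] by simp
    have \<epsilon>: "?\<epsilon> = 1 \<or> ?\<epsilon> = -1" by (rule outward_cases)
    obtain t e where te: "\<phi> (crv ?p t) = of_real s0 * cis \<tau>"
      "directed_chart ?p t U \<phi> (of_real ?\<epsilon> * cis \<tau>) e"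
      using D(2)[of ?p] Dh[OF \<tau>] by auto
    have "0 < e" using te(2) by (simp add: directed_chart_def flat_chart_def)
    hence near: "\<forall>\<^sub>F y in at \<tau>. of_real s0 * cis y \<in> ball (of_real s0 * cis \<tau>) e"
      by (intro cont) auto
    \<comment> \<open>The signed distance from the line of the arrow, relative to its direction of
      travel. Just after the angle \<open>\<tau>\<close> the point is on the left of an outgoing and
      on the right of an incoming arrow, just before it on the opposite side.\<close>
    have im: "Im ((\<phi> (x y) - \<phi> (crv ?p t)) / (of_real ?\<epsilon> * cis \<tau>)) = ?\<epsilon> * s0 * sin (y - \<tau>)" for y
    proof -
      have "(\<phi> (x y) - \<phi> (crv ?p t)) / (of_real ?\<epsilon> * cis \<tau>) = of_real (?\<epsilon> * s0) * (cis (y - \<tau>) - 1)"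
        using \<epsilon> by (auto simp: x(2) te(1) cis_divide[symmetric] field_simps)
      thus ?thesis by simp
    qed
    have side: "f y = C (side_face (k * ?\<epsilon>) ?p)"
      if "of_real s0 * cis y \<in> ball (of_real s0 * cis \<tau>) e" "k * sin (y - \<tau>) > 0" "k = 1 \<or> k = -1" for y k
    proof -
      have k\<epsilon>: "k * ?\<epsilon> = 1 \<or> k * ?\<epsilon> = -1" using \<epsilon> that(3) by auto
      have "k * ?\<epsilon> * (?\<epsilon> * s0 * sin (y - \<tau>)) = s0 * (k * sin (y - \<tau>))" using \<epsilon> by auto
      also have "\<dots> > 0" using that(2) s0(1) by simp
      finally have "x y \<in> half_disc (k * ?\<epsilon>) ?p t U \<phi> (of_real ?\<epsilon> * cis \<tau>) e"
        using x[of y] that(1) im[of y] by (simp add: half_disc_def te(1))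
      hence "x y \<in> side_face (k * ?\<epsilon>) ?p"
        using half_disc_subset_side_face[OF p k\<epsilon> te(2)] by blast
      thus ?thesis using F side_face_in_faces[OF p k\<epsilon>] by (simp add: f_def)
    qed
    have nearL: "\<forall>\<^sub>F y in at_left \<tau>. of_real s0 * cis y \<in> ball (of_real s0 * cis \<tau>) e"
      and nearR: "\<forall>\<^sub>F y in at_right \<tau>. of_real s0 * cis y \<in> ball (of_real s0 * cis \<tau>) e"
      using near by (simp_all add: eventually_at_split)
    have "\<forall>\<^sub>F y in at_left \<tau>. y \<in> {\<tau> - pi<..<\<tau>}" by (intro eventually_at_left_real) simp
    thus "\<forall>\<^sub>F y in at_left \<tau>. f y = C (side_face (- outward v ?p) ?p)"
      using nearL
    proof eventually_elim
      case (elim y)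
      have "sin (\<tau> - y) > 0" using elim by (intro sin_gt_zero) auto
      moreover have "sin (y - \<tau>) = - sin (\<tau> - y)" by (metis minus_diff_eq sin_minus)
      ultimately show ?case using side[of y "-1"] elim by simp
    qed
    have "\<forall>\<^sub>F y in at_right \<tau>. y \<in> {\<tau><..<\<tau> + pi}" by (intro eventually_at_right_real) simp
    thus "\<forall>\<^sub>F y in at_right \<tau>. f y = C (side_face (outward v ?p) ?p)"
      using nearR
    proof eventually_elim
      case (elim y)
      have "sin (y - \<tau>) > 0" using elim by (intro sin_gt_zero) auto
      thus ?case using side[of y 1] elim by simp
    qed
  qed
  also have "\<dots> = (\<Sum>p\<in>?I. C (side_face (outward v p) p) - C (side_face (- outward v p) p))"
    using sum.reindex_bij_betw[OF bij_h, of "\<lambda>p. C (side_face (outward v p) p) - C (side_face (- outward v p) p)"] .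
  also have "f (a + 2 * pi) = f a"
  proof -
    have "cis (a + 2 * pi) = cis a" by (metis cis_eq_cis_iff mult.right_neutral of_int_1)
    thus ?thesis by (simp add: f_def x_def)
  qed
  finally show ?thesis by simp
qed

end

text \<open>In the total jump around \<open>v\<close> outgoing arrows count left minus right,
  incoming ones right minus left; that the total vanishes is a conservation law at
  \<open>v\<close>.\<close>

lemma vertex_circulation:
  fixes C :: "'s set \<Rightarrow> 'a::ab_group_add"
  assumes v: "v \<in> verts G"
  shows "(\<Sum>p\<in>{p \<in> arcs G. tail G p = v}. C (side_face (-1) p) - C (side_face 1 p)) =
         (\<Sum>p\<in>{p \<in> arcs G. head G p = v}. C (side_face (-1) p) - C (side_face 1 p))"
proof -
  obtain U \<phi> where "vertex_chart A G pos crv v U \<phi>" using ex_vertex_chart[OF v] by blast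
  then obtain R where \<phi>: "(U, \<phi>) \<in> A" "\<phi> ` U = ball 0 1" "pos v \<in> U" "\<phi> (pos v) = 0" "finite R" "R \<subseteq> sphere 0 1"
    "\<phi> ` (U \<inter> \<Gamma>) = {0} \<union> {of_real r * d | r d. 0 < r \<and> r < 1 \<and> d \<in> R}"
    by (auto simp: vertex_chart_def)
  obtain \<delta> where \<delta>: "\<delta> > 0" "\<forall>z\<in>\<phi> ` (U \<inter> pos ` verts G). z \<noteq> 0 \<longrightarrow> \<delta> \<le> dist 0 z"
    using finite_set_avoid[of "\<phi> ` (U \<inter> pos ` verts G)" 0] by auto
  \<comment> \<open>The closed disc of radius \<open>s0\<close> contains no other vertex, so every
    arrow at \<open>v\<close> has to leave it.\<close>
  define s0 where "s0 = min \<delta> 1 / 2"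
  have s0: "0 < s0" "s0 < 1" "s0 < \<delta>" using \<delta>(1) by (auto simp: s0_def min_def)
  have isolated: "pos w \<notin> U \<inter> \<phi> -` cball 0 s0" if w: "w \<in> verts G" "w \<noteq> v" for w
  proof
    assume *: "pos w \<in> U \<inter> \<phi> -` cball 0 s0"
    have "pos w \<noteq> pos v" using w v pos_inj by (meson inj_onD)
    hence "\<phi> (pos w) \<noteq> 0" using * \<phi>(3,4) chart_inj[OF \<phi>(1)] by (metis IntD1 inj_onD)
    hence "\<delta> \<le> dist 0 (\<phi> (pos w))" using \<delta>(2) * w(1) by blast
    thus False using * s0(3) by auto
  qed
  have "{p \<in> arcs G. tail G p = v \<or> head G p = v} = {p \<in> arcs G. tail G p = v} \<union> {p \<in> arcs G. head G p = v}"
    by blast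
  moreover have "{p \<in> arcs G. tail G p = v} \<inter> {p \<in> arcs G. head G p = v} = {}"
    by (auto dest: no_loops)
  ultimately have "(\<Sum>p\<in>{p \<in> arcs G. tail G p = v \<or> head G p = v}.
       C (side_face (outward v p) p) - C (side_face (- outward v p) p)) =
     (\<Sum>p\<in>{p \<in> arcs G. tail G p = v}. C (side_face (outward v p) p) - C (side_face (- outward v p) p)) +
     (\<Sum>p\<in>{p \<in> arcs G. head G p = v}. C (side_face (outward v p) p) - C (side_face (- outward v p) p))"
    by (simp add: sum.union_disjoint)
  also have "(\<Sum>p\<in>{p \<in> arcs G. tail G p = v}. C (side_face (outward v p) p) - C (side_face (- outward v p) p)) =
      - (\<Sum>p\<in>{p \<in> arcs G. tail G p = v}. C (side_face (-1) p) - C (side_face 1 p))"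
    unfolding sum_negf[symmetric] by (intro sum.cong) (auto simp: outward_def)
  also have "(\<Sum>p\<in>{p \<in> arcs G. head G p = v}. C (side_face (outward v p) p) - C (side_face (- outward v p) p)) =
      (\<Sum>p\<in>{p \<in> arcs G. head G p = v}. C (side_face (-1) p) - C (side_face 1 p))"
    by (intro sum.cong) (use no_loops in \<open>auto simp: outward_def\<close>)
  finally have "(\<Sum>p\<in>{p \<in> arcs G. tail G p = v \<or> head G p = v}.
       C (side_face (outward v p) p) - C (side_face (- outward v p) p)) =
     - (\<Sum>p\<in>{p \<in> arcs G. tail G p = v}. C (side_face (-1) p) - C (side_face 1 p)) +
      (\<Sum>p\<in>{p \<in> arcs G. head G p = v}. C (side_face (-1) p) - C (side_face 1 p))" .
  moreover have "(\<Sum>p\<in>{p \<in> arcs G. tail G p = v \<or> head G p = v}.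
       C (side_face (outward v p) p) - C (side_face (- outward v p) p)) = 0"
    using circulation_in_chart[OF v \<phi> s0(1,2) isolated, where C = C] .
  ultimately have "0 = - (\<Sum>p\<in>{p \<in> arcs G. tail G p = v}. C (side_face (-1) p) - C (side_face 1 p)) +
      (\<Sum>p\<in>{p \<in> arcs G. head G p = v}. C (side_face (-1) p) - C (side_face 1 p))" by simp
  moreover have "x = y" if "0 = - x + y" for x y :: 'a using that by (simp add: eq_neg_iff_add_eq_0)
  ultimately show ?thesis by blast
qed

text \<open>Sorted by end vertices, \<open>X v\<close> is multiplied by the outgoing jumps at
  \<open>v\<close> minus the incoming ones. The two families of weights are the potential
  differences and the circulations of the graph.\<close>

lemma vertex_face_orthogonal:
  fixes X :: "'v \<Rightarrow> 'a::comm_ring_1" and C :: "'s set \<Rightarrow> 'a"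
  shows "(\<Sum>p\<in>arcs G. (X (tail G p) - X (head G p)) * (C (side_face (-1) p) - C (side_face 1 p))) = 0"
proof -
  let ?w = "\<lambda>p. C (side_face (-1) p) - C (side_face 1 p)"
  have group: "(\<Sum>p\<in>arcs G. X (k p) * ?w p) = (\<Sum>v\<in>verts G. X v * (\<Sum>p\<in>{p \<in> arcs G. k p = v}. ?w p))"
    if "k ` arcs G \<subseteq> verts G" for k
  proof -
    have "(\<Sum>p\<in>arcs G. X (k p) * ?w p) = (\<Sum>v\<in>verts G. \<Sum>p\<in>{p \<in> arcs G. k p = v}. X (k p) * ?w p)"
      using that by (intro sum.group[symmetric]) auto
    also have "\<dots> = (\<Sum>v\<in>verts G. X v * (\<Sum>p\<in>{p \<in> arcs G. k p = v}. ?w p))"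
      by (auto simp: sum_distrib_left intro!: sum.cong)
    finally show ?thesis .
  qed
  have "(\<Sum>p\<in>arcs G. (X (tail G p) - X (head G p)) * ?w p)
      = (\<Sum>p\<in>arcs G. X (tail G p) * ?w p) - (\<Sum>p\<in>arcs G. X (head G p) * ?w p)"
    by (simp add: left_diff_distrib sum_subtractf)
  also have "\<dots> = 0"
    using vertex_circulation[where C = C] by (subst (1 2) group) (auto intro!: sum.cong)
  finally show ?thesis .
qed

text \<open>For each arrow only the faces on its two sides survive in the sum; if they are the same
  face, both expressions are 0. A relation among face derivations thus says that \<open>c\<close>
  does not jump across arrows.\<close>

lemma sum_face_derivation:
  "(\<Sum>f\<in>\<F>. map_scale (c f) (face_derivation A G pos crv f))
    = weight_derivation G (\<lambda>p. c (side_face (-1) p) - c (side_face 1 p))"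
proof -
  have "(\<Sum>f\<in>\<F>. map_scale (c f) (face_derivation A G pos crv f))
    = weight_derivation G (\<lambda>p. \<Sum>f\<in>\<F>. c f *
        ((if on_right A G pos crv f p then 1 else 0) - (if on_left A G pos crv f p then 1 else 0)))"
    unfolding face_derivation_def by (rule sum_weight_derivation[OF wf_digraph_axioms])
  also have "\<dots> = weight_derivation G (\<lambda>p. c (side_face (-1) p) - c (side_face 1 p))"
    unfolding weight_derivation_eq_iff[OF wf_digraph_axioms]
  proof
    fix p assume p: "p \<in> arcs G"
    have "(\<Sum>f\<in>\<F>. c f * ((if on_right A G pos crv f p then 1 else 0) - (if on_left A G pos crv f p then 1 else 0)))
        = (\<Sum>f\<in>\<F>. c f * ((if f = side_face (-1) p then 1 else 0) - (if f = side_face 1 p then 1 else 0)))"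
      by (intro sum.cong) (simp_all add: on_right_iff on_left_iff p)
    also have "\<dots> = c (side_face (-1) p) - c (side_face 1 p)"
      using side_face_in_faces[OF p] finite_faces
      by (simp add: right_diff_distrib sum_subtractf if_distrib[of "(*) _"] cong: if_cong)
    finally show "(\<Sum>f\<in>\<F>. c f * ((if on_right A G pos crv f p then 1 else 0) - (if on_left A G pos crv f p then 1 else 0)))
        = c (side_face (-1) p) - c (side_face 1 p)" .
  qed
  finally show ?thesis .
qed

end

theorem theorem4p9:
  fixes G :: "('v, 'e) pre_digraph"
    and S :: "'s topology" and A :: "'s chart set"
    and pos :: "'v \<Rightarrow> 's" and crv :: "'e \<Rightarrow> real \<Rightarrow> 's" and g :: nat
  assumes "fin_digraph G"
    and "Digraph_Component.connected G"
    and "acyclic_quiver G"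
    and "minimal_genus_embedding G g S A pos crv"
  shows "int (map_dim (vertex_derivations G :: ('v, 'e, 'k::field) pa_map set)) = int (card (verts G)) - 1
    \<and> int (map_dim (face_derivations G S A pos crv :: ('v, 'e, 'k) pa_map set))
          = int (card (faces G S pos crv)) - 1
    \<and> (vertex_derivations G :: ('v, 'e, 'k) pa_map set) \<subseteq> arrow_derivations G
    \<and> (face_derivations G S A pos crv :: ('v, 'e, 'k) pa_map set) \<subseteq> arrow_derivations G
    \<and> (CHAR('k) = 0 \<longrightarrow>
         vertex_derivations G \<inter> face_derivations G S A pos crv = ({0} :: ('v, 'e, 'k) pa_map set))"
proof -
  interpret fin_digraph G by fact
  have surface: "closed_oriented_surface S A" and "quiver_embedding G S A pos crv"
    using assms(4) by (auto simp: minimal_genus_embedding_def)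
  interpret embedded_quiver G S A pos crv
  proof
    show "tail G p \<noteq> head G p" if p: "p \<in> arcs G" for p
    proof
      assume "tail G p = head G p"
      hence "awalk (tail G p) [p] (tail G p)" using arc_implies_awalk[OF p] by simp
      hence "cycle [p]" unfolding cycle_def by (intro exI[of _ "tail G p"]) simp
      thus False using assms(3) by (auto simp: acyclic_quiver_def)
    qed
    show "verts G \<noteq> {}"
      using assms(2) by (auto simp: Digraph_Component.connected_def strongly_connected_def)
  qed (use surface \<open>quiver_embedding G S A pos crv\<close> in \<open>auto simp: closed_oriented_surface_def\<close>)
  interpret M: vector_space "map_scale :: 'k \<Rightarrow> ('v, 'e, 'k) pa_map \<Rightarrow> _"
    by (rule vector_space_map_scale)
  note wf = wf_digraph_axioms
  let ?V = "vertex_derivations G :: ('v, 'e, 'k) pa_map set"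
  let ?F = "face_derivations G S A pos crv :: ('v, 'e, 'k) pa_map set"
  have wd_0: "weight_derivation G w = 0 \<longleftrightarrow> (\<forall>p\<in>arcs G. w p = 0)" for w :: "'e \<Rightarrow> 'k"
    unfolding weight_derivation_0[OF wf, symmetric] weight_derivation_eq_iff[OF wf] by simp
  have span_subset: "M.span B \<subseteq> arrow_derivations G" if "B \<subseteq> arrow_derivations G" for B
    using M.span_minimal[OF that[unfolded arrow_derivations_def map_span_def] M.subspace_span]
    unfolding arrow_derivations_def map_span_def .
  have "int (M.dim (M.span (vertex_derivation G ` verts G))) = int (card (verts G)) - 1"
  proof (rule M.dim_span_image_if_relations_constant)
    fix c :: "'v \<Rightarrow> 'k"
    show "(\<Sum>v\<in>verts G. map_scale (c v) (vertex_derivation G v)) = 0 \<longleftrightarrow> (\<forall>u\<in>verts G. \<forall>v\<in>verts G. c u = c v)"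
      unfolding sum_vertex_derivation[OF assms(1)] wd_0
    proof (intro iffI ballI)
      fix u v assume *: "\<forall>p\<in>arcs G. c (tail G p) - c (head G p) = 0" "u \<in> verts G" "v \<in> verts G"
      show "c u = c v"
        using connected_imp_constant[OF assms(2) _ \<open>u \<in> verts G\<close> \<open>v \<in> verts G\<close>, of c] * by simp
    next
      fix p assume "\<forall>u\<in>verts G. \<forall>v\<in>verts G. c u = c v" "p \<in> arcs G"
      hence "c (tail G p) = c (head G p)" using tail_in_verts head_in_verts by blast
      thus "c (tail G p) - c (head G p) = 0" by simp
    qed
  qed (use verts_nonempty in auto)
  moreover have "int (M.dim (M.span (face_derivation A G pos crv ` \<F>))) = int (card \<F>) - 1"
  proof (rule M.dim_span_image_if_relations_constant)
    fix c :: "'s set \<Rightarrow> 'k"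
    show "(\<Sum>f\<in>\<F>. map_scale (c f) (face_derivation A G pos crv f)) = 0 \<longleftrightarrow> (\<forall>f\<in>\<F>. \<forall>f'\<in>\<F>. c f = c f')"
      unfolding sum_face_derivation wd_0
    proof (intro iffI ballI)
      fix f f' assume *: "\<forall>p\<in>arcs G. c (side_face (-1) p) - c (side_face 1 p) = 0" "f \<in> \<F>" "f' \<in> \<F>"
      show "c f = c f'"
        using constant_on_faces[OF _ \<open>f \<in> \<F>\<close> \<open>f' \<in> \<F>\<close>, of c] * by simp
    next
      fix p assume c: "\<forall>f\<in>\<F>. \<forall>f'\<in>\<F>. c f = c f'" and p: "p \<in> arcs G"
      have "c (side_face (-1) p) = c (side_face 1 p)"
        using c side_face_in_faces[OF p] by blast
      thus "c (side_face (-1) p) - c (side_face 1 p) = 0" by simp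
    qed
  qed (use faces_nonempty finite_faces in auto)
  moreover have "?V \<subseteq> arrow_derivations G"
    unfolding vertex_derivations_def map_span_def
    by (intro span_subset image_subsetI)
       (simp add: vertex_derivation_eq_weight_derivation[OF wf] weight_derivation_in_arrow_derivations[OF assms(1)])
  moreover have "?F \<subseteq> arrow_derivations G"
    unfolding face_derivations_def map_span_def
    by (intro span_subset image_subsetI)
       (simp add: face_derivation_def weight_derivation_in_arrow_derivations[OF assms(1)])
  moreover have "?V \<inter> ?F = {0}" if char: "CHAR('k) = 0"
  proof (intro equalityI subsetI)
    fix D assume "D \<in> ?V \<inter> ?F"
    hence "D \<in> M.span (vertex_derivation G ` verts G)" "D \<in> M.span (face_derivation A G pos crv ` \<F>)"
      by (simp_all add: vertex_derivations_def face_derivations_def map_span_def)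
    then obtain X C where "D = (\<Sum>v\<in>verts G. map_scale (X v) (vertex_derivation G v))"
      "D = (\<Sum>f\<in>\<F>. map_scale (C f) (face_derivation A G pos crv f))"
      using M.in_span_finite_image[OF finite_verts] M.in_span_finite_image[OF finite_faces] by meson
    hence X: "D = weight_derivation G (\<lambda>p. X (tail G p) - X (head G p))"
      and C: "D = weight_derivation G (\<lambda>p. C (side_face (-1) p) - C (side_face 1 p))"
      by (simp_all only: sum_vertex_derivation[OF assms(1)] sum_face_derivation)
    hence XC: "\<forall>p\<in>arcs G. X (tail G p) - X (head G p) = C (side_face (-1) p) - C (side_face 1 p)"
      by (simp add: weight_derivation_eq_iff[OF wf])
    have "X (tail G p) - X (head G p) = 0" if p: "p \<in> arcs G" for p
    proof (rule ccontr)
      assume "X (tail G p) - X (head G p) \<noteq> 0"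
      then obtain l :: "'k \<Rightarrow> rat" where l: "\<And>a b. l (a - b) = l a - l b" "l (X (tail G p) - X (head G p)) = 1"
        using ex_additive_functional_rat[OF char] by blast
      \<comment> \<open>By \<open>XC\<close> the two factors of each square can be written as a
        vertex weight and a face weight. Orthogonality for \<open>l\<close> composed with
        \<open>X\<close> and with \<open>C\<close> then makes a rational sum of squares vanish,
        although its term at \<open>p\<close> is 1.\<close>
      have "(\<Sum>q\<in>arcs G. (l (X (tail G q) - X (head G q)))\<^sup>2)
          = (\<Sum>q\<in>arcs G. (l (X (tail G q)) - l (X (head G q))) * (l (C (side_face (-1) q)) - l (C (side_face 1 q))))"
        using XC by (intro sum.cong) (auto simp: power2_eq_square l(1)[symmetric])
      also have "\<dots> = 0" by (rule vertex_face_orthogonal[where X = "\<lambda>v. l (X v)" and C = "\<lambda>f. l (C f)"])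
      finally have "(l (X (tail G p) - X (head G p)))\<^sup>2 = 0"
        using p by (simp add: sum_nonneg_eq_0_iff)
      thus False using l(2) by simp
    qed
    thus "D \<in> {0}" unfolding X by (simp add: wd_0)
  qed (simp add: vertex_derivations_def face_derivations_def map_span_def M.span_zero)
  ultimately show ?thesis
    by (simp add: map_dim_def vertex_derivations_def face_derivations_def map_span_def)
qed
end
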